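(* Let $K/L$ be a finite extension of finite extensions of $\mathbb{Q}_p$. If $\Lambda_K(\mathfrak{X}_K)=o_K[\![o_K]\!]$, then $\Lambda_L(\mathfrak{X}_L)=o_L[\![o_L]\!]$.
   Context: For a finite extension $F/\mathbb{Q}_p$, $\mathfrak{X}_F$ denotes the character variety of $(o_F,+)$: the rigid analytic curve over $F$ whose points over a complete extension $E$ of $F$ are the locally $F$-analytic characters $o_F\to E^\times$. $\Lambda_F(\mathfrak{X}_F)$ is the ring of rigid analytic functions on $\mathfrak{X}_F$ defined over $F$ with supremum norm at most $1$, and $o_F[\![o_F]\!]$ (the Iwasawa algebra, i.e. $o_F$-valued measures on $o_F$) is regarded as a subring via $\mu\mapsto(\chi\mapsto\mu(\chi))$, which is injective. *)

theory Defs
  imports "HOL-Analysis.Analysis" "HOL-Computational_Algebra.Polynomial"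
begin

section \<open>Fields with a non-archimedean absolute value\<close>

text \<open>
  The library's normed fields are real algebras, which excludes p-adic fields; hence a separate
  class with its own absolute value, whose metric is the one of the class \<^class>\<open>metric_space\<close>.
\<close>

class nonarch_valued_field = field_char_0 + metric_space +
  fixes vabs :: "'a \<Rightarrow> real"
  assumes dist_vabs: "dist x y = vabs (x - y)"
    and vabs_mult: "vabs (x * y) = vabs x * vabs y"
    and vabs_add: "vabs (x + y) \<le> max (vabs x) (vabs y)"
begin

lemma vabs_nonneg: "0 \<le> vabs x"
  using zero_le_dist[of x 0] by (simp add: dist_vabs)

lemma vabs_eq_0: "vabs x = 0 \<longleftrightarrow> x = 0"
  using dist_eq_0_iff[of x 0] by (simp add: dist_vabs)

lemma vabs_1: "vabs 1 = 1"
proof -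
  have "vabs 1 = vabs 1 * vabs 1"
    using vabs_mult[of 1 1] by simp
  moreover have "vabs 1 \<noteq> 0"
    using vabs_eq_0[of 1] by simp
  ultimately show ?thesis by simp
qed

lemma vabs_minus: "vabs (- x) = vabs x"
proof -
  have "vabs (- 1) * vabs (- 1) = 1"
    using vabs_mult[of "- 1" "- 1"] vabs_1 by simp
  then have "vabs (- 1) = 1"
    using vabs_nonneg[of "- 1"] by (metis abs_of_nonneg abs_mult_self_eq real_sqrt_abs2 real_sqrt_one)
  then show ?thesis
    using vabs_mult[of "- 1" x] by simp
qed

lemma vabs_diff: "vabs (x - y) \<le> max (vabs x) (vabs y)"
  using vabs_add[of x "- y"] by (simp add: vabs_minus)

end

instance nonarch_valued_field < topological_ab_group_add
proof
  fix a b :: 'a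
  show "LIM x (nhds a \<times>\<^sub>F nhds b). fst x + snd x :> nhds (a + b)"
    unfolding tendsto_iff
  proof (intro allI impI)
    fix e :: real assume "e > 0"
    then have "eventually (\<lambda>x. dist x a < e) (nhds a)" "eventually (\<lambda>x. dist x b < e) (nhds b)"
      by (auto simp: eventually_nhds_metric)
    then have "eventually (\<lambda>x. dist (fst x) a < e \<and> dist (snd x) b < e) (nhds a \<times>\<^sub>F nhds b)"
      unfolding eventually_prod_filter by fastforce
    then show "eventually (\<lambda>x. dist (fst x + snd x) (a + b) < e) (nhds a \<times>\<^sub>F nhds b)"
    proof (rule eventually_mono)
      fix x :: "'a \<times> 'a" assume "dist (fst x) a < e \<and> dist (snd x) b < e"
      then show "dist (fst x + snd x) (a + b) < e"
        using vabs_add[of "fst x - a" "snd x - b"]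
        by (auto simp: dist_vabs add_diff_add intro: le_less_trans)
    qed
  qed
  have "dist (- x) (- a) = dist x a" for x
    using vabs_minus[of "x - a"] by (simp add: dist_vabs)
  then show "(uminus \<longlongrightarrow> - a) (nhds a)"
    by (auto simp: tendsto_iff eventually_nhds_metric)
qed

section \<open>Finite extensions of the p-adic numbers inside the completed algebraic closure\<close>

definition is_subfield :: "'c::field set \<Rightarrow> bool" where
  "is_subfield F \<longleftrightarrow> 0 \<in> F \<and> 1 \<in> F \<and>
     (\<forall>x\<in>F. \<forall>y\<in>F. x - y \<in> F \<and> x * y \<in> F) \<and> (\<forall>x\<in>F. inverse x \<in> F)"

definition finite_extension :: "'c::field set \<Rightarrow> 'c set \<Rightarrow> bool" where
  "finite_extension k F \<longleftrightarrow> is_subfield k \<and> is_subfield F \<and> k \<subseteq> F \<and>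
     (\<exists>B. finite B \<and> B \<subseteq> F \<and> (\<forall>x\<in>F. \<exists>c. (\<forall>b\<in>B. c b \<in> k) \<and> x = (\<Sum>b\<in>B. c b * b)))"

text \<open>
  In a complete field whose absolute value extends the p-adic one, the closure of the rationals
  is the field of p-adic numbers.
\<close>

definition Qp :: "'c::nonarch_valued_field set" where
  "Qp = closure \<rat>"

text \<open>
  The type \<open>'c\<close> is (a model of) the completion of an algebraic closure of the p-adic numbers: it is
  algebraically closed and complete by its sort, its absolute value extends the p-adic one, and the
  elements algebraic over the p-adic numbers are dense.
\<close>

definition is_Cp :: "nat \<Rightarrow> 'c::{nonarch_valued_field, alg_closed_field, complete_space} itself \<Rightarrow> bool"
  where "is_Cp p T \<longleftrightarrow> prime p \<and> vabs (of_nat p :: 'c) = 1 / real p \<and>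
     closure {x :: 'c. \<exists>f. f \<noteq> 0 \<and> (\<forall>i. coeff f i \<in> Qp) \<and> poly f x = 0} = UNIV"

definition int_ring :: "'c::nonarch_valued_field set \<Rightarrow> 'c set" where
  "int_ring F = {x \<in> F. vabs x \<le> 1}"

section \<open>The character variety and its rigid analytic functions\<close>

definition locally_analytic :: "'c::nonarch_valued_field set \<Rightarrow> ('c \<Rightarrow> 'c) \<Rightarrow> bool" where
  "locally_analytic F f \<longleftrightarrow>
     (\<forall>a\<in>int_ring F. \<exists>r>0. \<exists>c. \<forall>x\<in>int_ring F. vabs (x - a) \<le> r \<longrightarrow>
        (\<lambda>n. c n * (x - a) ^ n) sums f x)"

text \<open>
  The points of the character variety of \<open>F\<close> over the ambient field \<open>'c\<close>. Characters are functions on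
  \<open>int_ring F\<close>, made total by the value \<^const>\<open>undefined\<close> elsewhere.
\<close>

definition char_variety :: "'c::nonarch_valued_field set \<Rightarrow> ('c \<Rightarrow> 'c) set" where
  "char_variety F = {\<psi> \<in> extensional (int_ring F).
     (\<forall>x\<in>int_ring F. \<psi> x \<noteq> 0) \<and>
     (\<forall>x\<in>int_ring F. \<forall>y\<in>int_ring F. \<psi> (x + y) = \<psi> x * \<psi> y) \<and>
     locally_analytic F \<psi>}"

definition Zp_basis :: "'c::nonarch_valued_field set \<Rightarrow> 'c set \<Rightarrow> bool" where
  "Zp_basis F B \<longleftrightarrow> finite B \<and> B \<subseteq> int_ring F \<and>
     (\<forall>x\<in>int_ring F. \<exists>!c. c \<in> B \<rightarrow>\<^sub>E int_ring Qp \<and> x = (\<Sum>b\<in>B. c b * b))"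

text \<open>
  Power series in variables indexed by \<open>B\<close> with coefficients in \<open>F\<close> that converge on the closed
  polydisc of radius \<open>r\<close>. Multi-indices are the elements of \<open>B \<rightarrow>\<^sub>E UNIV\<close>.
\<close>

definition tate_series :: "'c::nonarch_valued_field set \<Rightarrow> 'c set \<Rightarrow> real \<Rightarrow> (('c \<Rightarrow> nat) \<Rightarrow> 'c) set" where
  "tate_series F B r = {c. (\<forall>\<alpha>\<in>B \<rightarrow>\<^sub>E UNIV. c \<alpha> \<in> F) \<and>
     (\<forall>\<epsilon>>0. finite {\<alpha> \<in> B \<rightarrow>\<^sub>E UNIV. vabs (c \<alpha>) * r ^ (\<Sum>b\<in>B. \<alpha> b) \<ge> \<epsilon>})}"

text \<open>
  Given a basis \<open>B\<close> of the integers of \<open>F\<close> over the p-adic integers, the map taking \<open>\<psi>\<close> to the family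
  of all \<open>\<psi> b - 1\<close> realises the character variety as a (reduced) Zariski closed subvariety of the open
  unit polydisc, and it is the increasing union of the affinoids \<open>vabs (\<psi> b - 1) \<le> r\<close> for \<open>r < 1\<close>. A rigid
  analytic function defined over \<open>F\<close> is a function whose restriction to each of these affinoids
  lies in its affinoid algebra, a quotient of the Tate algebra of the closed polydisc. Since
  \<open>(1 + z) ^ n - 1\<close> has absolute value at most that of \<open>z\<close> for each p-adic integer \<open>n\<close>, neither the
  affinoids nor the result depend on the choice of \<open>B\<close>.
\<close>

definition rigid_functions :: "'c::nonarch_valued_field set \<Rightarrow> (('c \<Rightarrow> 'c) \<Rightarrow> 'c) set" where
  "rigid_functions F = {f \<in> extensional (char_variety F).
     \<exists>B. Zp_basis F B \<and>
       (\<forall>r. 0 < r \<and> r < 1 \<longrightarrow>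
         (\<exists>c\<in>tate_series F B r. \<forall>\<psi>\<in>char_variety F. (\<forall>b\<in>B. vabs (\<psi> b - 1) \<le> r) \<longrightarrow>
            ((\<lambda>\<alpha>. c \<alpha> * (\<Prod>b\<in>B. (\<psi> b - 1) ^ \<alpha> b)) has_sum f \<psi>) (B \<rightarrow>\<^sub>E UNIV)))}"

definition bounded_functions :: "'c::nonarch_valued_field set \<Rightarrow> (('c \<Rightarrow> 'c) \<Rightarrow> 'c) set" where
  "bounded_functions F = {f \<in> rigid_functions F. \<forall>\<psi>\<in>char_variety F. vabs (f \<psi>) \<le> 1}"

section \<open>The Iwasawa algebra\<close>

definition clopen_in :: "'c::topological_space set \<Rightarrow> 'c set \<Rightarrow> bool" where
  "clopen_in S C \<longleftrightarrow> openin (top_of_set S) C \<and> closedin (top_of_set S) C"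

definition int_measures :: "'c::nonarch_valued_field set \<Rightarrow> ('c set \<Rightarrow> 'c) set" where
  "int_measures F = {\<mu>.
     (\<forall>C. clopen_in (int_ring F) C \<longrightarrow> \<mu> C \<in> int_ring F) \<and>
     (\<forall>C D. clopen_in (int_ring F) C \<and> clopen_in (int_ring F) D \<and> C \<inter> D = {} \<longrightarrow>
        \<mu> (C \<union> D) = \<mu> C + \<mu> D)}"

text \<open>The integral as a limit of Riemann sums over tagged clopen partitions of small mesh.\<close>

definition has_measure_integral ::
    "'c::nonarch_valued_field set \<Rightarrow> ('c set \<Rightarrow> 'c) \<Rightarrow> ('c \<Rightarrow> 'c) \<Rightarrow> 'c \<Rightarrow> bool" where
  "has_measure_integral F \<mu> g I \<longleftrightarrow>
     (\<forall>\<epsilon>>0. \<exists>\<delta>>0. \<forall>P t.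
        finite P \<and> partition_on (int_ring F) P \<and>
        (\<forall>C\<in>P. clopen_in (int_ring F) C \<and> t C \<in> C \<and> (\<forall>x\<in>C. \<forall>y\<in>C. vabs (x - y) < \<delta>)) \<longrightarrow>
        vabs ((\<Sum>C\<in>P. \<mu> C * g (t C)) - I) < \<epsilon>)"

text \<open>
  The Iwasawa algebra, as the set of functions on the character variety that send \<open>\<psi>\<close> to the
  integral of \<open>\<psi>\<close> against a measure.
\<close>

definition iwasawa_algebra :: "'c::nonarch_valued_field set \<Rightarrow> (('c \<Rightarrow> 'c) \<Rightarrow> 'c) set" where
  "iwasawa_algebra F = {f \<in> extensional (char_variety F).
     \<exists>\<mu>\<in>int_measures F. \<forall>\<psi>\<in>char_variety F. has_measure_integral F \<mu> \<psi> (f \<psi>)}"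

end

(*
  Let f be a bounded function on the character variety of L. Restricting characters from the integers
  of K to those of L pulls f back to a bounded function on the character variety of K, which by
  hypothesis comes from a measure mu on the integers of K. Fourier inversion with characters of finite
  order, applied to the power series of f in the coordinates of a basis adapted to L, computes
  p^(nd) mu(C) for each ball C of radius p^-n as a convergent series of rational integer multiples of
  the coefficients of f. Hence mu takes values in L, and vanishes on the balls that do not meet the
  integers of L, so that it is carried by the integers of L. Finally every character of the integers
  of L extends to K: near 0 it is an exponential, and its values lie in a divisible group. The
  opposite inclusion is the Mahler expansion of a measure.
*)
theory Submission
  imports Defs
begin

section \<open>Analysis over a non-archimedean valued field\<close>

text \<open>The coefficients of a series for f need not be unique, since the characters in general
  fill only a closed part of the polydisc, and they may change with the radius. So they are never
  compared: for each level n one radius below 1 covers all characters killed by p^n, one series at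
  that radius determines \<mu> on the balls of radius p^-n, and only the values of \<mu> are kept.
  The basis of the integers of L comes with f. It extends to K because an element of L that is
  divisible by p in the integers of K is so in those of L. The pulled back series is then constant
  in the new variables, and summing over the corresponding roots of unity kills each ball with a
  nonzero new coordinate. Composing a character of L with the projection along the new basis vectors
  extends it as a homomorphism, but in general not analytically over K. Analyticity forces the
  extension to be the same exponential series near 0; divisibility continues its values along the
  new basis vectors. Extensions are needed because the hypothesis describes f only at restrictions
  of characters of K.\<close>

lemma vabs_0 [simp]: "vabs (0::'a::nonarch_valued_field) = 0"
  by (simp add: vabs_eq_0)

lemma vabs_one [simp]: "vabs (1::'a::nonarch_valued_field) = 1"
  by (rule vabs_1)

lemma vabs_pos: "x \<noteq> 0 \<Longrightarrow> 0 < vabs (x::'a::nonarch_valued_field)"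
  using vabs_nonneg[of x] vabs_eq_0[of x] by linarith

lemma vabs_power: "vabs (x ^ n) = vabs (x::'a::nonarch_valued_field) ^ n"
  by (induction n) (simp_all add: vabs_mult)

lemma vabs_prod: "vabs (\<Prod>i\<in>A. f i) = (\<Prod>i\<in>A. vabs (f i :: 'a::nonarch_valued_field))"
  by (induction A rule: infinite_finite_induct) (simp_all add: vabs_mult)

lemma vabs_inverse: "vabs (inverse x) = inverse (vabs (x::'a::nonarch_valued_field))"
proof (cases "x = 0")
  case False
  then have "vabs x * vabs (inverse x) = 1"
    by (simp flip: vabs_mult)
  with False show ?thesis
    by (simp add: field_simps vabs_eq_0)
qed simp

lemma vabs_divide: "vabs (x / y) = vabs x / vabs (y::'a::nonarch_valued_field)"
  by (simp add: divide_inverse vabs_mult vabs_inverse)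

lemma vabs_commute: "vabs (x - y) = vabs (y - (x::'a::nonarch_valued_field))"
  using vabs_minus[of "x - y"] by simp

lemma vabs_triangle: "vabs (x - z) \<le> max (vabs (x - y)) (vabs (y - (z::'a::nonarch_valued_field)))"
  using vabs_add[of "x - y" "y - z"] by simp

lemma vabs_add_le: "vabs x \<le> e \<Longrightarrow> vabs y \<le> e \<Longrightarrow> vabs (x + y :: 'a::nonarch_valued_field) \<le> e"
  using vabs_add[of x y] by linarith

lemma vabs_add_less: "vabs x < e \<Longrightarrow> vabs y < e \<Longrightarrow> vabs (x + y :: 'a::nonarch_valued_field) < e"
  using vabs_add[of x y] by linarith

lemma vabs_diff_le: "vabs x \<le> e \<Longrightarrow> vabs y \<le> e \<Longrightarrow> vabs (x - y :: 'a::nonarch_valued_field) \<le> e"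
  using vabs_diff[of x y] by linarith

text \<open>The isosceles triangle principle: in an ultrametric triangle the two longest sides are
  equal.\<close>

lemma vabs_eq_of_near: "vabs (x - y) < vabs x \<Longrightarrow> vabs (y::'a::nonarch_valued_field) = vabs x"
  using vabs_add[of "x - y" y] vabs_diff[of x "x - y"] by auto

lemma vabs_sum_le:
  assumes "0 \<le> e" "\<And>i. i \<in> A \<Longrightarrow> vabs (f i :: 'a::nonarch_valued_field) \<le> e"
  shows "vabs (\<Sum>i\<in>A. f i) \<le> e"
  using assms by (induction A rule: infinite_finite_induct) (auto intro: vabs_add_le)

lemma vabs_of_nat_le: "vabs (of_nat n :: 'a::nonarch_valued_field) \<le> 1"
  by (induction n) (auto intro: vabs_add_le)

lemma vabs_of_int_le: "vabs (of_int n :: 'a::nonarch_valued_field) \<le> 1"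
proof (cases n)
  case (neg m)
  then show ?thesis
    using vabs_of_nat_le[of "Suc m"] vabs_minus[of "of_nat (Suc m) :: 'a"] by simp
qed (use vabs_of_nat_le in auto)

lemma vabs_mult_diff_le:
  assumes "vabs a \<le> 1" "vabs d \<le> 1" "vabs (a - b) \<le> e" "vabs (c - d) \<le> e"
  shows "vabs (a * c - b * d :: 'a::nonarch_valued_field) \<le> e"
proof -
  have "a * c - b * d = a * (c - d) + (a - b) * d"
    by (simp add: algebra_simps)
  moreover have "vabs (a * (c - d)) \<le> 1 * e" "vabs ((a - b) * d) \<le> e * 1"
    unfolding vabs_mult
    by (rule mult_mono; use assms vabs_nonneg[of "a - b"] vabs_nonneg in force)+
  ultimately show ?thesis
    by (simp add: vabs_add_le)
qed

lemma vabs_prod_diff_le: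
  assumes "0 \<le> e" "\<And>i. i \<in> A \<Longrightarrow> vabs (f i) \<le> 1" "\<And>i. i \<in> A \<Longrightarrow> vabs (g i) \<le> 1"
    and "\<And>i. i \<in> A \<Longrightarrow> vabs (f i - g i) \<le> e"
  shows "vabs ((\<Prod>i\<in>A. f i) - (\<Prod>i\<in>A. g i) :: 'a::nonarch_valued_field) \<le> e"
  using assms
proof (induction A rule: infinite_finite_induct)
  case (insert i A)
  have "vabs (\<Prod>i\<in>A. g i) \<le> 1"
    unfolding vabs_prod using insert by (auto intro!: prod_le_1 vabs_nonneg)
  with insert show ?case
    by (auto intro!: vabs_mult_diff_le)
qed auto

section \<open>Limits, series and power series\<close>

lemma tendsto_vabs_iff:
  "(f \<longlongrightarrow> l) F \<longleftrightarrow> (\<forall>e>0. eventually (\<lambda>x. vabs (f x - l :: 'a::nonarch_valued_field) < e) F)"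
  by (simp add: tendsto_iff dist_vabs)

lemma LIMSEQ_vabs_iff:
  "f \<longlonglongrightarrow> l \<longleftrightarrow> (\<forall>e>0. \<exists>N. \<forall>n\<ge>N. vabs (f n - l :: 'a::nonarch_valued_field) < e)"
  by (simp add: LIMSEQ_def dist_vabs)

lemma LIMSEQ_vabs_0_iff:
  "f \<longlonglongrightarrow> 0 \<longleftrightarrow> (\<lambda>n. vabs (f n :: 'a::nonarch_valued_field)) \<longlonglongrightarrow> 0"
  by (simp add: tendsto_vabs_iff tendsto_iff abs_of_nonneg vabs_nonneg)

text \<open>If |l| exceeded \<open>e\<close>, it would be positive, and \<open>X n\<close> would
  eventually lie closer to \<open>l\<close> than |l|, which forces |X n| = |l|.\<close>

lemma Lim_vabs_le:
  assumes "X \<longlonglongrightarrow> (l::'a::nonarch_valued_field)" "\<And>n. n \<ge> N \<Longrightarrow> vabs (X n) \<le> e"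
  shows "vabs l \<le> e"
proof (rule ccontr)
  assume "\<not> vabs l \<le> e"
  then have "0 < vabs l - e"
    by simp
  then have "0 < vabs l"
    using assms(2)[of N] vabs_nonneg[of "X N"] by linarith
  then obtain M where "\<forall>n\<ge>M. vabs (X n - l) < vabs l"
    using assms(1) LIMSEQ_vabs_iff by blast
  then have "vabs (l - X (max M N)) < vabs l"
    by (metis max.cobounded1 vabs_commute)
  from vabs_eq_of_near[OF this] assms(2)[of "max M N"] \<open>\<not> vabs l \<le> e\<close> show False
    by simp
qed

text \<open>Makes the general rules for limits and infinite sums of products applicable to these
  fields.\<close>

instance nonarch_valued_field < topological_semigroup_mult
proof
  fix a b :: 'a
  show "LIM x (nhds a \<times>\<^sub>F nhds b). fst x * snd x :> nhds (a * b)"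
    unfolding tendsto_vabs_iff
  proof (intro allI impI)
    fix e :: real assume "e > 0"
    \<comment> \<open>\<open>C\<close> dominates |a| and |b|; as \<open>d\<close> is at most 1, each
      of the three terms of the expanded difference stays below C * d, which is at most
      \<open>e\<close>.\<close>
    define C where "C = 1 + vabs a + vabs b"
    define d where "d = min 1 (e / C)"
    have C: "C > 0" "C > vabs a" "C > vabs b" and d: "d > 0" "d \<le> 1" "C * d \<le> e"
    proof -
      show C: "C > 0" "C > vabs a" "C > vabs b"
        using vabs_nonneg[of a] vabs_nonneg[of b] by (auto simp: C_def)
      show "d > 0" "d \<le> 1"
        using \<open>e > 0\<close> C by (auto simp: d_def)
      have "d \<le> e / C"
        by (simp add: d_def)
      then show "C * d \<le> e"
        using C by (simp add: field_simps)
    qed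
    then have "eventually (\<lambda>x. vabs (x - a) < d) (nhds a)" "eventually (\<lambda>x. vabs (x - b) < d) (nhds b)"
      by (auto simp: eventually_nhds_metric dist_vabs)
    then have "eventually (\<lambda>x. vabs (fst x - a) < d \<and> vabs (snd x - b) < d) (nhds a \<times>\<^sub>F nhds b)"
      unfolding eventually_prod_filter by fastforce
    then show "eventually (\<lambda>x. vabs (fst x * snd x - a * b) < e) (nhds a \<times>\<^sub>F nhds b)"
    proof (rule eventually_mono)
      fix x :: "'a \<times> 'a" assume x: "vabs (fst x - a) < d \<and> vabs (snd x - b) < d"
      have "fst x * snd x - a * b = (fst x - a) * (snd x - b) + ((fst x - a) * b + a * (snd x - b))"
        by (simp add: algebra_simps)
      moreover have "vabs ((fst x - a) * (snd x - b)) < C * d"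
        unfolding vabs_mult
        by (rule mult_strict_mono) (use x C d vabs_nonneg[of b] vabs_nonneg[of a] vabs_nonneg in \<open>auto simp: C_def\<close>)
      moreover have "vabs ((fst x - a) * b) < d * C" "vabs (a * (snd x - b)) < C * d"
        unfolding vabs_mult
        by (rule mult_strict_mono, use x C d vabs_nonneg in auto)+
      ultimately show "vabs (fst x * snd x - a * b) < e"
        using d by (auto intro!: vabs_add_less simp: mult.commute)
    qed
  qed
qed

lemma sums_imp_LIMSEQ_0:
  assumes "a sums (s::'a::nonarch_valued_field)"
  shows "a \<longlonglongrightarrow> 0"
proof -
  have "(\<lambda>n. \<Sum>i<n. a i) \<longlonglongrightarrow> s"
    using assms by (simp add: sums_def)
  from tendsto_diff[OF LIMSEQ_Suc[OF this] this] show ?thesis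
    by simp
qed

lemma nonarch_sums_diff:
  "a sums s \<Longrightarrow> b sums t \<Longrightarrow> (\<lambda>n. a n - b n :: 'a::nonarch_valued_field) sums (s - t)"
  unfolding sums_def sum_subtractf by (rule tendsto_diff)

lemma nonarch_sums_mult:
  "a sums s \<Longrightarrow> (\<lambda>n. c * a n :: 'a::nonarch_valued_field) sums (c * s)"
  unfolding sums_def sum_distrib_left[symmetric] by (intro tendsto_mult tendsto_const)

text \<open>The ultrametric bounds a block of the series by its largest term, so terms tending to 0
  already make the partial sums Cauchy; no absolute convergence is involved.\<close>

lemma nonarch_summable:
  assumes "a \<longlonglongrightarrow> (0::'a::{nonarch_valued_field,complete_space})"
  shows "summable a"
proof -
  have "Cauchy (\<lambda>n. \<Sum>i<n. a i)"
  proof (rule metric_CauchyI)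
    fix e :: real assume "0 < e"
    then obtain N where N: "\<And>n. n \<ge> N \<Longrightarrow> vabs (a n) < e / 2"
      using assms unfolding LIMSEQ_vabs_iff by (metis diff_zero half_gt_zero)
    have *: "dist (\<Sum>i<n. a i) (\<Sum>i<m. a i) < e" if "N \<le> m" "m \<le> n" for m n
    proof -
      have "(\<Sum>i<n. a i) = (\<Sum>i<m. a i) + (\<Sum>i=m..<n. a i)"
        using that sum.atLeastLessThan_concat[of 0 m n a] by (simp add: atLeast0LessThan)
      then have "dist (\<Sum>i<n. a i) (\<Sum>i<m. a i) = vabs (\<Sum>i=m..<n. a i)"
        by (simp add: dist_vabs)
      also have "\<dots> \<le> e / 2"
      proof (rule vabs_sum_le)
        fix i assume "i \<in> {m..<n}"
        then show "vabs (a i) \<le> e / 2"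
          using N[of i] that by simp
      qed (use \<open>0 < e\<close> in simp)
      finally show ?thesis
        using \<open>0 < e\<close> by linarith
    qed
    show "\<exists>M. \<forall>m\<ge>M. \<forall>n\<ge>M. dist (\<Sum>i<m. a i) (\<Sum>i<n. a i) < e"
    proof (intro exI allI impI)
      fix m n assume "m \<ge> N" "n \<ge> N"
      then show "dist (\<Sum>i<m. a i) (\<Sum>i<n. a i) < e"
        using *[of m n] *[of n m] by (cases "m \<le> n") (auto simp: dist_commute)
    qed
  qed
  then show ?thesis
    by (auto simp: Cauchy_convergent_iff convergent_def summable_def sums_def)
qed

lemma sums_vabs_le:
  assumes "a sums (s::'a::nonarch_valued_field)" "0 \<le> e" "\<And>n. vabs (a n) \<le> e"
  shows "vabs s \<le> e"
  using assms by (intro Lim_vabs_le[of "\<lambda>n. \<Sum>i<n. a i" s 0]) (auto simp: sums_def intro!: vabs_sum_le)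

text \<open>The square and the triangle of indices differ by pairs with i + j at least n. In each
  such pair one factor lies in a tail, and the ultrametric bounds the whole remainder
  \<open>?R\<close> by the largest of these products.\<close>

lemma nonarch_Cauchy_product_sums:
  fixes a b :: "nat \<Rightarrow> 'a::nonarch_valued_field"
  assumes "a sums A" "b sums B"
  shows "(\<lambda>n. \<Sum>i\<le>n. a i * b (n - i)) sums (A * B)"
proof -
  have bd: "\<exists>C. \<forall>n. vabs (f n) \<le> C" if "f sums S" for f :: "nat \<Rightarrow> 'a" and S
  proof -
    have "Bseq (\<lambda>n. vabs (f n))"
      using sums_imp_LIMSEQ_0[OF that] unfolding LIMSEQ_vabs_0_iff
      by (rule convergent_imp_Bseq[OF convergentI])
    then show ?thesis
      by (auto simp: Bseq_def abs_of_nonneg vabs_nonneg)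
  qed
  obtain C1 C2 where C12: "\<And>n. vabs (a n) \<le> C1" "\<And>n. vabs (b n) \<le> C2"
    using bd[OF assms(1)] bd[OF assms(2)] by auto
  define C where "C = max 1 (max C1 C2)"
  have C: "C > 0" "\<And>n. vabs (a n) \<le> C" "\<And>n. vabs (b n) \<le> C"
    using C12 by (auto simp: C_def le_max_iff_disj)
  let ?R = "\<lambda>n. \<Sum>(i,j)\<in>{..<n}\<times>{..<n} - {(i, j). i + j < n}. a i * b j"
  have split: "(\<Sum>m<n. \<Sum>i\<le>m. a i * b (m - i)) = (\<Sum>i<n. a i) * (\<Sum>j<n. b j) - ?R n" for n
  proof -
    have sub: "{(i, j). i + j < n} \<subseteq> {..<n}\<times>{..<n}"
      by auto
    have "(\<Sum>m<n. \<Sum>i\<le>m. a i * b (m - i)) = (\<Sum>(i,j)\<in>{(i, j). i + j < n}. a i * b j)"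
      by (rule sum.triangle_reindex[symmetric])
    also have "\<dots> = (\<Sum>(i,j)\<in>{..<n}\<times>{..<n}. a i * b j) - ?R n"
      using sum.subset_diff[OF sub, of "\<lambda>(i,j). a i * b j"] by simp
    also have "(\<Sum>(i,j)\<in>{..<n}\<times>{..<n}. a i * b j) = (\<Sum>i<n. a i) * (\<Sum>j<n. b j)"
      by (simp add: sum_product sum.cartesian_product)
    finally show ?thesis .
  qed
  have "?R \<longlonglongrightarrow> 0"
    unfolding LIMSEQ_vabs_iff
  proof (intro allI impI)
    fix e :: real assume "e > 0"
    then have "e / (2 * C) > 0"
      using C by simp
    then obtain N1 N2 where N: "\<And>n. n \<ge> N1 \<Longrightarrow> vabs (a n) < e / (2 * C)" "\<And>n. n \<ge> N2 \<Longrightarrow> vabs (b n) < e / (2 * C)"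
      using sums_imp_LIMSEQ_0[OF assms(1)] sums_imp_LIMSEQ_0[OF assms(2)]
      unfolding LIMSEQ_vabs_iff by (metis diff_zero)
    have "vabs (?R n - 0) < e" if n: "n \<ge> N1 + N2" for n
    proof -
      have "vabs (?R n) \<le> e / 2"
      proof (rule vabs_sum_le)
        fix ij assume ij: "ij \<in> {..<n}\<times>{..<n} - {(i, j). i + j < n}"
        obtain i j where [simp]: "ij = (i, j)"
          by (cases ij)
        have "i \<ge> N1 \<or> j \<ge> N2"
          using ij n by auto
        then have "vabs (a i) * vabs (b j) \<le> e / (2 * C) * C"
        proof
          assume "i \<ge> N1"
          then show ?thesis
            using N(1)[of i] C \<open>e > 0\<close> by (intro mult_mono) (auto simp: vabs_nonneg)
        next
          assume "j \<ge> N2"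
          then have "vabs (a i) * vabs (b j) \<le> C * (e / (2 * C))"
            using N(2)[of j] C \<open>e > 0\<close> by (intro mult_mono) (auto simp: vabs_nonneg)
          then show ?thesis
            by (simp add: mult.commute)
        qed
        then show "vabs (case ij of (i, j) \<Rightarrow> a i * b j) \<le> e / 2"
          using C by (simp add: vabs_mult)
      qed (use \<open>e > 0\<close> in auto)
      then show ?thesis
        using \<open>e > 0\<close> by simp
    qed
    then show "\<exists>N. \<forall>n\<ge>N. vabs (?R n - 0) < e"
      by blast
  qed
  moreover have "(\<lambda>n. (\<Sum>i<n. a i) * (\<Sum>j<n. b j)) \<longlonglongrightarrow> A * B"
    using assms unfolding sums_def by (rule tendsto_mult)
  ultimately have "(\<lambda>n. (\<Sum>i<n. a i) * (\<Sum>j<n. b j) - ?R n) \<longlonglongrightarrow> A * B - 0"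
    by (rule tendsto_diff[rotated])
  then show ?thesis
    by (simp add: sums_def split)
qed

text \<open>Identity theorem along nonzero zeros tending to 0. Once the lower coefficients vanish,
  the term of degree m is balanced by the higher ones, so |d m| is at most a constant times |x
  k|.\<close>

lemma power_series_eq_0:
  fixes d :: "nat \<Rightarrow> 'a::nonarch_valued_field"
  assumes x: "\<And>k. x k \<noteq> 0" "x \<longlonglongrightarrow> 0" and s: "\<And>k. (\<lambda>n. d n * x k ^ n) sums 0"
  shows "d n = 0"
proof (induction n rule: less_induct)
  case (less m)
  \<comment> \<open>Convergence at this single point bounds all |d n| by C / |y|^n.\<close>
  define y where "y = x 0"
  have y: "vabs y > 0"
    using x(1) by (simp add: y_def vabs_pos)
  have "Bseq (\<lambda>n. vabs (d n * y ^ n))"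
    using sums_imp_LIMSEQ_0[OF s[of 0]] unfolding LIMSEQ_vabs_0_iff y_def
    by (rule convergent_imp_Bseq[OF convergentI])
  then obtain C where C: "C > 0" "\<And>n. vabs (d n * y ^ n) \<le> C"
    by (auto simp: Bseq_def abs_of_nonneg vabs_nonneg)
  have bound: "vabs (d m) \<le> C / vabs y ^ Suc m * vabs (x k)" if k: "vabs (x k) \<le> vabs y" for k
  proof -
    let ?q = "vabs (x k) / vabs y"
    have q: "0 \<le> ?q" "?q \<le> 1"
      using k y by (auto simp: vabs_nonneg)
    have "(\<lambda>n. if n = m then d m * x k ^ m else 0) sums (d m * x k ^ m)"
      using sums_single[of m "\<lambda>_. d m * x k ^ m"] by (simp add: if_distrib)
    from nonarch_sums_diff[OF s[of k] this]
    have sm: "(\<lambda>n. d n * x k ^ n - (if n = m then d m * x k ^ m else 0)) sums (- (d m * x k ^ m))"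
      by simp
    have "vabs (- (d m * x k ^ m)) \<le> C * ?q ^ Suc m"
    proof (rule sums_vabs_le[OF sm])
      fix n
      show "vabs (d n * x k ^ n - (if n = m then d m * x k ^ m else 0)) \<le> C * ?q ^ Suc m"
      proof (cases "n \<le> m")
        case True
        moreover have "0 \<le> C * ?q ^ Suc m"
          by (intro mult_nonneg_nonneg zero_le_power q less_imp_le[OF C(1)])
        ultimately show ?thesis
          using less[of n] by (cases "n = m") auto
      next
        case False
        have "d n * x k ^ n = (d n * y ^ n) * (x k / y) ^ n"
          using y by (auto simp: power_divide)
        then have "vabs (d n * x k ^ n) = vabs (d n * y ^ n) * ?q ^ n"
          by (metis vabs_mult vabs_power vabs_divide)
        also have "\<dots> \<le> C * ?q ^ Suc m"
          using C False q by (intro mult_mono power_decreasing) (auto simp: vabs_nonneg)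
        finally show ?thesis
          using False by simp
      qed
    qed (intro mult_nonneg_nonneg zero_le_power q less_imp_le[OF C(1)])
    then have "vabs (d m) * vabs (x k) ^ m \<le> (C / vabs y ^ Suc m * vabs (x k)) * vabs (x k) ^ m"
      by (simp add: vabs_minus vabs_mult vabs_power power_divide mult.assoc mult.commute)
    then show ?thesis
      by (rule mult_right_le_imp_le) (simp add: x(1) vabs_pos)
  qed
  have v0: "(\<lambda>k. vabs (x k)) \<longlonglongrightarrow> 0"
    using x(2) by (simp only: LIMSEQ_vabs_0_iff)
  have "eventually (\<lambda>k. vabs (x k) < vabs y) sequentially"
    using v0 y by (rule order_tendstoD)
  then have "eventually (\<lambda>k. vabs (d m) \<le> C / vabs y ^ Suc m * vabs (x k)) sequentially"
    by (rule eventually_mono) (rule bound, simp)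
  moreover have "(\<lambda>k. C / vabs y ^ Suc m * vabs (x k)) \<longlonglongrightarrow> C / vabs y ^ Suc m * 0"
    by (intro tendsto_mult tendsto_const v0)
  ultimately have "vabs (d m) \<le> C / vabs y ^ Suc m * 0"
    by (intro tendsto_le[OF sequentially_bot _ tendsto_const]) auto
  then show "d m = 0"
    using vabs_nonneg[of "d m"] by (simp add: vabs_eq_0)
qed

section \<open>The p-adic absolute value on the rationals and on their closure\<close>

lemma zero_in_subfield: "is_subfield F \<Longrightarrow> 0 \<in> F"
  and one_in_subfield: "is_subfield F \<Longrightarrow> 1 \<in> F"
  and diff_in_subfield: "is_subfield F \<Longrightarrow> x \<in> F \<Longrightarrow> y \<in> F \<Longrightarrow> x - y \<in> F"
  and mult_in_subfield: "is_subfield F \<Longrightarrow> x \<in> F \<Longrightarrow> y \<in> F \<Longrightarrow> x * y \<in> F"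
  and inverse_in_subfield: "is_subfield F \<Longrightarrow> x \<in> F \<Longrightarrow> inverse x \<in> F"
  by (simp_all add: is_subfield_def)

lemma uminus_in_subfield: "is_subfield F \<Longrightarrow> x \<in> F \<Longrightarrow> - x \<in> F"
  using diff_in_subfield[of F 0 x] zero_in_subfield[of F] by simp

lemma add_in_subfield: "is_subfield F \<Longrightarrow> x \<in> F \<Longrightarrow> y \<in> F \<Longrightarrow> x + y \<in> F"
  using diff_in_subfield[of F x "- y"] uminus_in_subfield[of F y] by simp

lemma divide_in_subfield: "is_subfield F \<Longrightarrow> x \<in> F \<Longrightarrow> y \<in> F \<Longrightarrow> x / y \<in> F"
  by (simp add: divide_inverse mult_in_subfield inverse_in_subfield)

lemma sum_in_subfield: "is_subfield F \<Longrightarrow> (\<And>i. i \<in> A \<Longrightarrow> f i \<in> F) \<Longrightarrow> (\<Sum>i\<in>A. f i) \<in> F"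
  by (induction A rule: infinite_finite_induct) (auto intro: zero_in_subfield add_in_subfield)

lemma prod_in_subfield: "is_subfield F \<Longrightarrow> (\<And>i. i \<in> A \<Longrightarrow> f i \<in> F) \<Longrightarrow> (\<Prod>i\<in>A. f i) \<in> F"
  by (induction A rule: infinite_finite_induct) (auto intro: one_in_subfield mult_in_subfield)

lemma of_nat_in_subfield: "is_subfield F \<Longrightarrow> of_nat n \<in> F"
  by (induction n) (auto intro: zero_in_subfield one_in_subfield add_in_subfield)

lemma of_int_in_subfield: "is_subfield F \<Longrightarrow> of_int n \<in> F"
  by (cases n) (auto intro!: of_nat_in_subfield uminus_in_subfield diff_in_subfield one_in_subfield)

lemma power_in_subfield: "is_subfield F \<Longrightarrow> x \<in> F \<Longrightarrow> x ^ n \<in> F"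
  by (induction n) (auto intro: one_in_subfield mult_in_subfield)

lemmas subfield_intros = zero_in_subfield one_in_subfield diff_in_subfield mult_in_subfield
  inverse_in_subfield uminus_in_subfield add_in_subfield divide_in_subfield sum_in_subfield
  prod_in_subfield of_nat_in_subfield of_int_in_subfield power_in_subfield

lemma zero_in_int_ring: "is_subfield F \<Longrightarrow> 0 \<in> int_ring F"
  by (simp add: int_ring_def subfield_intros)

lemma add_in_int_ring: "is_subfield F \<Longrightarrow> x \<in> int_ring F \<Longrightarrow> y \<in> int_ring F \<Longrightarrow> x + y \<in> int_ring F"
  by (simp add: int_ring_def subfield_intros vabs_add_le)

lemma diff_in_int_ring: "is_subfield F \<Longrightarrow> x \<in> int_ring F \<Longrightarrow> y \<in> int_ring F \<Longrightarrow> x - y \<in> int_ring F"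
  by (simp add: int_ring_def subfield_intros vabs_diff_le)

lemma mult_in_int_ring: "is_subfield F \<Longrightarrow> x \<in> int_ring F \<Longrightarrow> y \<in> int_ring F \<Longrightarrow> x * y \<in> int_ring F"
  using vabs_nonneg by (auto simp: int_ring_def subfield_intros vabs_mult intro!: mult_le_one)

lemma of_nat_in_int_ring: "is_subfield F \<Longrightarrow> of_nat n \<in> int_ring F"
  by (simp add: int_ring_def subfield_intros vabs_of_nat_le)

lemma sum_in_int_ring:
  "is_subfield F \<Longrightarrow> (\<And>i. i \<in> A \<Longrightarrow> f i \<in> int_ring F) \<Longrightarrow> (\<Sum>i\<in>A. f i) \<in> int_ring F"
  by (induction A rule: infinite_finite_induct) (auto intro: zero_in_int_ring add_in_int_ring)

lemmas int_ring_intros = zero_in_int_ring add_in_int_ring diff_in_int_ring mult_in_int_ring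
  of_nat_in_int_ring sum_in_int_ring

lemma int_ring_mono: "F \<subseteq> G \<Longrightarrow> int_ring F \<subseteq> int_ring G"
  by (auto simp: int_ring_def)

locale padic_field =
  fixes p :: nat and ty :: "'c::{nonarch_valued_field, alg_closed_field, complete_space} itself"
  assumes is_Cp: "is_Cp p TYPE('c)"
begin

abbreviation Zp :: "'c set" where
  "Zp \<equiv> int_ring Qp"

lemma prime_p: "prime p"
  using is_Cp by (simp add: is_Cp_def)

lemma p_gt_1: "p > 1"
  using prime_p by (rule prime_gt_1_nat)

lemma p_power_pos: "(0::nat) < p ^ n" "(0::real) < real p ^ n"
  using p_gt_1 by auto

lemma vabs_p: "vabs (of_nat p :: 'c) = 1 / real p"
  using is_Cp by (simp add: is_Cp_def)

lemma vabs_p_power: "vabs (of_nat p ^ n :: 'c) = 1 / real p ^ n"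
  by (simp add: vabs_power vabs_p power_one_over)

lemma p_power_tendsto_0: "(\<lambda>n. 1 / real p ^ n) \<longlonglongrightarrow> 0"
  using LIMSEQ_inverse_realpow_zero[of "real p"] p_gt_1 by (simp add: inverse_eq_divide)

lemma ex_p_power_less: "e > 0 \<Longrightarrow> \<exists>n. 1 / real p ^ n < e"
  using order_tendstoD(2)[OF p_power_tendsto_0, of e] by (auto simp: eventually_sequentially)

lemma p_power_decreasing: "m \<le> n \<Longrightarrow> 1 / real p ^ n \<le> 1 / real p ^ m"
  using p_gt_1 by (intro divide_left_mono power_increasing) auto

text \<open>In a Bezout relation p x + k y = 1 the first term has absolute value below 1, so the
  second has absolute value 1, while both of its factors are at most 1.\<close>

lemma vabs_of_nat_coprime:
  assumes "\<not> p dvd k"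
  shows "vabs (of_nat k :: 'c) = 1"
proof -
  have "coprime p k"
    using prime_p assms by (rule prime_imp_coprime_nat)
  then obtain x y where "int p * x + int k * y = 1"
    using coprime_imp_gcd_eq_1 bezout_int[of "int p" "int k"]
    by (metis coprime_iff_gcd_eq_1 coprime_int_iff mult.commute)
  then have "(of_nat p * of_int x + of_nat k * of_int y :: 'c) = 1"
    by (metis of_int_1 of_int_add of_int_mult of_int_of_nat_eq)
  then have "1 - of_nat k * of_int y = (of_nat p * of_int x :: 'c)"
    by (simp add: algebra_simps)
  moreover have "vabs (of_nat p * of_int x :: 'c) < 1"
  proof -
    have "vabs (of_nat p * of_int x :: 'c) \<le> 1 / real p * 1"
      unfolding vabs_mult vabs_p by (intro mult_left_mono vabs_of_int_le) auto
    also have "\<dots> < 1"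
      using p_gt_1 by simp
    finally show ?thesis .
  qed
  ultimately have "vabs (of_nat k * of_int y :: 'c) = vabs (1 :: 'c)"
    by (intro vabs_eq_of_near) simp
  then have "vabs (of_nat k :: 'c) * vabs (of_int y :: 'c) = 1"
    by (simp add: vabs_mult)
  moreover have "vabs (of_nat k :: 'c) * vabs (of_int y :: 'c) \<le> vabs (of_nat k :: 'c) * 1"
    by (intro mult_left_mono vabs_of_int_le vabs_nonneg)
  ultimately show ?thesis
    using vabs_of_nat_le[of k, where 'a='c] by linarith
qed

text \<open>Only |p| is prescribed; splitting off the powers of p leaves a factor prime to p, which
  has absolute value 1.\<close>

lemma vabs_of_nat_le_iff: "vabs (of_nat k :: 'c) \<le> 1 / real p ^ n \<longleftrightarrow> p ^ n dvd k"
proof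
  assume "p ^ n dvd k"
  then obtain j where "k = p ^ n * j" ..
  then show "vabs (of_nat k :: 'c) \<le> 1 / real p ^ n"
    using mult_left_mono[OF vabs_of_nat_le[of j, where 'a='c], of "1 / real p ^ n"] by (simp add: vabs_mult vabs_p_power)
next
  assume le: "vabs (of_nat k :: 'c) \<le> 1 / real p ^ n"
  show "p ^ n dvd k"
  proof (cases "k = 0")
    case False
    then obtain i j where k: "k = p ^ i * j" "\<not> p dvd j"
      using prime_p p_gt_1 by (metis multiplicity_decompose' not_prime_unit)
    then have "vabs (of_nat k :: 'c) = 1 / real p ^ i"
      by (simp add: vabs_mult vabs_p_power vabs_of_nat_coprime)
    with le have "real p ^ n \<le> real p ^ i"
      using p_power_pos by (simp add: field_simps)
    then have "n \<le> i"
      using p_gt_1 by simp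
    then show ?thesis
      using k by (simp add: le_imp_power_dvd)
  qed auto
qed

lemma of_nat_eq_of_near:
  assumes "vabs (of_nat j - of_nat k :: 'c) \<le> 1 / real p ^ n" "j < p ^ n" "k < p ^ n"
  shows "j = k"
proof -
  have *: "j \<le> k" if "vabs (of_nat j - of_nat k :: 'c) \<le> 1 / real p ^ n" "j < p ^ n" for j k
  proof (rule ccontr)
    assume "\<not> j \<le> k"
    with that have "p ^ n dvd j - k"
      by (simp flip: vabs_of_nat_le_iff add: of_nat_diff)
    with \<open>\<not> j \<le> k\<close> that(2) show False
      by (auto dest: dvd_imp_le)
  qed
  show ?thesis
    using *[of j k] *[of k j] assms by (simp add: vabs_commute[of "of_nat j"])
qed

text \<open>Density of the natural numbers. A rational approximant in lowest terms of absolute value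
  at most 1 has denominator prime to p, and inverting the denominator modulo p^n yields the natural
  number.\<close>

lemma Zp_near_of_nat:
  assumes "x \<in> Zp"
  shows "\<exists>k<p ^ n. vabs (x - of_nat k) \<le> 1 / real p ^ n"
proof -
  have "x \<in> closure \<rat>" "vabs x \<le> 1"
    using assms by (auto simp: int_ring_def Qp_def)
  then obtain q where q: "q \<in> \<rat>" "vabs (q - x) < 1 / real p ^ n"
    using p_power_pos(2)[of n] by (auto simp: closure_approachable dist_vabs dest!: spec[of _ "1 / real p ^ n"])
  then obtain r where r: "q = of_rat r"
    by (auto elim: Rats_cases)
  obtain a b where ab: "quotient_of r = (a, b)"
    by (cases "quotient_of r")
  then have r': "r = of_int a / of_int b" "b > 0" "coprime a b"
    by (simp_all add: quotient_of_div quotient_of_denom_pos quotient_of_coprime)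
  define k where "k = nat b"
  have q': "q * of_nat k = of_int a" "k > 0"
    using r r' by (auto simp: k_def of_rat_divide)
  have "1 / real p ^ n \<le> 1"
    using p_gt_1 by (simp add: divide_le_eq)
  then have "vabs q \<le> 1"
    using q(2) \<open>vabs x \<le> 1\<close> vabs_add[of "q - x" x] by auto
  have "\<not> p dvd k"
  proof
    assume "p dvd k"
    then have "int p dvd b"
      using r'(2) by (simp add: k_def int_dvd_int_iff[symmetric])
    then have "\<not> int p dvd a"
      using r'(3) p_gt_1 coprime_common_divisor[of a b "int p"] by auto
    then have "\<not> p dvd nat \<bar>a\<bar>"
      by (simp add: int_dvd_int_iff[symmetric])
    then have "vabs (of_nat (nat \<bar>a\<bar>) :: 'c) = 1"
      by (rule vabs_of_nat_coprime)
    then have "vabs (of_int a :: 'c) = 1"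
      by (cases "a \<ge> 0") (auto simp: vabs_minus)
    moreover have "vabs (of_nat k :: 'c) \<le> 1 / real p"
      using vabs_of_nat_le_iff[of k 1] \<open>p dvd k\<close> by simp
    then have "vabs q * vabs (of_nat k :: 'c) \<le> 1 * (1 / real p)"
      using \<open>vabs q \<le> 1\<close> by (intro mult_mono) (auto simp: vabs_nonneg)
    moreover have "1 / real p < 1"
      using p_gt_1 by simp
    ultimately show False
      using q'(1) by (simp flip: vabs_mult)
  qed
  then have "coprime (int k) (int p ^ n)"
  proof -
    have "coprime k p"
      using prime_imp_coprime_nat[OF prime_p \<open>\<not> p dvd k\<close>] by (simp only: coprime_commute)
    then show ?thesis
      by simp
  qed
  then obtain u v where uv: "int k * u + int p ^ n * v = 1"
    by (metis bezout_int coprime_imp_gcd_eq_1 mult.commute)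
  \<comment> \<open>\<open>u\<close> inverts the denominator modulo p^n, so u * a represents the
    fraction a / k there.\<close>
  define j where "j = nat ((u * a) mod int p ^ n)"
  have pos: "int p ^ n > 0"
    using p_gt_1 by simp
  have j: "int j = (u * a) mod int p ^ n" "j < p ^ n"
    using pos p_power_pos(1)[of n] by (auto simp: j_def nat_less_iff)
  define w where "w = (u * a) div int p ^ n"
  have jw: "int j = u * a - int p ^ n * w"
    by (simp add: j(1) w_def minus_mult_div_eq_mod)
  then have "a - int k * int j = int p ^ n * (v * a + int k * w)"
  proof -
    have "a - int k * int j = a * (int k * u + int p ^ n * v) - int k * (u * a - int p ^ n * w)"
      unfolding uv jw by simp
    then show ?thesis
      by (simp add: algebra_simps)
  qed
  then have "(of_int (a - int k * int j) :: 'c) = of_int (int p ^ n * (v * a + int k * w))"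
    by simp
  then have "of_int a - of_nat k * of_nat j = (of_nat p ^ n * of_int (v * a + int k * w) :: 'c)"
    by simp
  moreover have "vabs (of_nat p ^ n * of_int (v * a + int k * w) :: 'c) \<le> 1 / real p ^ n * 1"
    unfolding vabs_mult vabs_p_power by (intro mult_left_mono vabs_of_int_le) auto
  moreover have "of_nat k * (q - of_nat j) = of_int a - of_nat k * of_nat j"
    using q'(1) by (simp add: right_diff_distrib mult.commute)
  ultimately have "vabs (of_nat k * (q - of_nat j)) \<le> 1 / real p ^ n"
    by (simp only: mult_1_right)
  then have "vabs (q - of_nat j) \<le> 1 / real p ^ n"
    using \<open>\<not> p dvd k\<close> by (simp add: vabs_mult vabs_of_nat_coprime)
  moreover have "vabs (x - q) \<le> 1 / real p ^ n"
    using q(2) by (simp add: vabs_commute)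
  ultimately have "vabs (x - of_nat j) \<le> 1 / real p ^ n"
    using vabs_triangle[of x "of_nat j" q] by linarith
  with j(2) show ?thesis
    by blast
qed

text \<open>A nonzero residue below p has absolute value 1, and lying within 1/p of \<open>x\<close>
  it would give |x| = 1; so the residue is 0.\<close>

lemma Zp_vabs_less_1:
  assumes "x \<in> Zp" "vabs x < 1"
  shows "vabs x \<le> 1 / real p"
proof -
  obtain k where k: "k < p" "vabs (x - of_nat k) \<le> 1 / real p"
    using Zp_near_of_nat[OF assms(1), of 1] by auto
  have "k = 0"
  proof (rule ccontr)
    assume "k \<noteq> 0"
    then have 1: "vabs (of_nat k :: 'c) = 1"
      using k by (intro vabs_of_nat_coprime) (auto dest: dvd_imp_le)
    have "vabs (of_nat k - x) < vabs (of_nat k :: 'c)"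
    proof -
      have "1 / real p < 1"
        using p_gt_1 by simp
      with k(2) show ?thesis
        unfolding 1 vabs_commute[of "of_nat k"] by linarith
    qed
    from vabs_eq_of_near[OF this] 1 assms(2) show False
      by simp
  qed
  with k show ?thesis
    by simp
qed

text \<open>Reduction modulo p^n with a natural representative; it has this meaning on
  \<open>Zp\<close> only.\<close>

definition res :: "nat \<Rightarrow> 'c \<Rightarrow> nat" where
  "res n x = (THE k. k < p ^ n \<and> vabs (x - of_nat k) \<le> 1 / real p ^ n)"

lemma res_eqI:
  assumes "k < p ^ n" "vabs (x - of_nat k) \<le> 1 / real p ^ n"
  shows "res n x = k"
  unfolding res_def
proof (rule the_equality)
  fix j assume j: "j < p ^ n \<and> vabs (x - of_nat j) \<le> 1 / real p ^ n"
  then have "vabs (of_nat j - of_nat k :: 'c) \<le> 1 / real p ^ n"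
    using assms vabs_triangle[of "of_nat j" "of_nat k" x] unfolding vabs_commute[of "of_nat j" x] by linarith
  then show "j = k"
    using j assms by (intro of_nat_eq_of_near) auto
qed (use assms in auto)

lemma res_less: "x \<in> Zp \<Longrightarrow> res n x < p ^ n"
  and res_near: "x \<in> Zp \<Longrightarrow> vabs (x - of_nat (res n x)) \<le> 1 / real p ^ n"
  using Zp_near_of_nat[of x n] res_eqI by blast+

lemma res_of_nat: "k < p ^ n \<Longrightarrow> res n (of_nat k) = k"
  by (rule res_eqI) auto

lemma res_eq_iff:
  assumes "x \<in> Zp" "y \<in> Zp"
  shows "res n x = res n y \<longleftrightarrow> vabs (x - y) \<le> 1 / real p ^ n"
proof
  assume *: "res n x = res n y"
  show "vabs (x - y) \<le> 1 / real p ^ n"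
    using vabs_triangle[of x y "of_nat (res n x)"] res_near[OF assms(1), of n] res_near[OF assms(2), of n]
    unfolding * by (simp add: vabs_commute[of y])
next
  assume "vabs (x - y) \<le> 1 / real p ^ n"
  then have "vabs (x - of_nat (res n y)) \<le> 1 / real p ^ n"
    using vabs_triangle[of x "of_nat (res n y)" y] res_near[OF assms(2), of n] by simp
  then show "res n x = res n y"
    by (intro res_eqI res_less assms)
qed

lemma res_add:
  assumes "is_subfield (Qp::'c set)" "x \<in> Zp" "y \<in> Zp"
  shows "res n (x + y) = (res n x + res n y) mod p ^ n"
proof (rule res_eqI)
  show "(res n x + res n y) mod p ^ n < p ^ n"
    using p_power_pos by simp
  let ?s = "res n x + res n y"
  have "vabs ((x - of_nat (res n x)) + (y - of_nat (res n y))) \<le> 1 / real p ^ n"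
    by (intro vabs_add_le res_near assms)
  then have "vabs (x + y - of_nat ?s) \<le> 1 / real p ^ n"
    by (simp add: algebra_simps)
  moreover have "(of_nat ?s - of_nat (?s mod p ^ n) :: 'c) = of_nat (p ^ n * (?s div p ^ n))"
    by (metis add_diff_cancel_right' mult_div_mod_eq of_nat_add)
  then have "vabs (of_nat ?s - of_nat (?s mod p ^ n) :: 'c) \<le> 1 / real p ^ n"
    by (simp only: vabs_of_nat_le_iff dvd_triv_left)
  ultimately show "vabs (x + y - of_nat (?s mod p ^ n)) \<le> 1 / real p ^ n"
    using vabs_triangle[of "x + y" "of_nat (?s mod p ^ n)" "of_nat ?s"] by linarith
qed

end

section \<open>Integers of finite extensions\<close>

text \<open>The scalars need not form a field: \<open>lin_span Zp B\<close> is the lattice generated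
  by \<open>B\<close>.\<close>

definition lin_span :: "'c::field set \<Rightarrow> 'c set \<Rightarrow> 'c set" where
  "lin_span k B = {x. \<exists>c. (\<forall>b\<in>B. c b \<in> k) \<and> x = (\<Sum>b\<in>B. c b * b)}"

lemma lin_span_empty [simp]: "lin_span k {} = {0}"
  by (auto simp: lin_span_def)

lemma lin_span_insert:
  assumes "finite B" "b \<notin> B"
  shows "lin_span k (insert b B) = {v + c * b | v c. v \<in> lin_span k B \<and> c \<in> k}"
proof (intro set_eqI iffI)
  fix x assume "x \<in> lin_span k (insert b B)"
  then obtain c where "\<forall>b\<in>insert b B. c b \<in> k" "x = (\<Sum>b\<in>insert b B. c b * b)"
    by (auto simp: lin_span_def)
  then show "x \<in> {v + c * b | v c. v \<in> lin_span k B \<and> c \<in> k}"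
    using assms by (intro CollectI exI[of _ "\<Sum>b\<in>B. c b * b"] exI[of _ "c b"]) (auto simp: lin_span_def add.commute)
next
  fix x assume "x \<in> {v + c * b | v c. v \<in> lin_span k B \<and> c \<in> k}"
  then obtain c d where c: "\<forall>b\<in>B. c b \<in> k" "d \<in> k" "x = (\<Sum>b\<in>B. c b * b) + d * b"
    by (auto simp: lin_span_def)
  have "(\<Sum>y\<in>insert b B. (c(b := d)) y * y) = d * b + (\<Sum>y\<in>B. (c(b := d)) y * y)"
    using assms by simp
  also have "(\<Sum>y\<in>B. (c(b := d)) y * y) = (\<Sum>y\<in>B. c y * y)"
    using assms by (intro sum.cong) auto
  finally show "x \<in> lin_span k (insert b B)"
    unfolding lin_span_def using c by (intro CollectI exI[of _ "c(b := d)"]) auto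
qed

lemma compact_affine_image:
  fixes b :: "'c::nonarch_valued_field"
  assumes "compact S" "compact T"
  shows "compact {v + c * b | v c. v \<in> S \<and> c \<in> T}"
proof -
  have "continuous_on (S \<times> T) (\<lambda>x. fst x + snd x * b)"
    by (intro continuous_intros)
  then have "compact ((\<lambda>x. fst x + snd x * b) ` (S \<times> T))"
    by (intro compact_continuous_image compact_Times assms)
  moreover have "(\<lambda>x. fst x + snd x * b) ` (S \<times> T) = {v + c * b | v c. v \<in> S \<and> c \<in> T}"
    by force
  ultimately show ?thesis
    by simp
qed

lemma dist_0_vabs: "dist 0 x = vabs (x::'c::nonarch_valued_field)"
  by (simp add: dist_vabs vabs_minus)

lemma int_ring_eq: "int_ring F = F \<inter> cball 0 1"
  by (auto simp: int_ring_def dist_vabs vabs_minus)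

section \<open>Local compactness of finite dimensional spaces over the p-adic numbers\<close>

context padic_field
begin

text \<open>The natural numbers below p^n form a finite net of mesh p^-n in a complete set.\<close>

lemma compact_Zp: "compact Zp"
  unfolding compact_eq_totally_bounded
proof (intro conjI allI impI)
  show "complete Zp"
    by (simp add: complete_eq_closed int_ring_eq Qp_def closed_Int)
next
  fix e :: real assume "0 < e"
  then obtain n where n: "1 / real p ^ n < e"
    using ex_p_power_less by blast
  have "Zp \<subseteq> (\<Union>x\<in>of_nat ` {..<p ^ n}. ball x e)"
  proof
    fix x :: 'c assume "x \<in> Zp"
    then show "x \<in> (\<Union>x\<in>of_nat ` {..<p ^ n}. ball x e)"
      using n res_less[of x n] res_near[of x n]
      by (intro UN_I[of "of_nat (res n x)"]) (auto simp: dist_vabs vabs_commute)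
  qed
  then show "\<exists>k. finite k \<and> Zp \<subseteq> (\<Union>x\<in>k. ball x e)"
    by blast
qed

text \<open>Multiplication by a large power of p moves the ball into the compact set
  \<open>Zp\<close>.\<close>

lemma compact_Qp_cball:
  assumes "is_subfield (Qp::'c set)"
  shows "compact (Qp \<inter> cball (0::'c) R)"
proof -
  obtain n where n: "R < real p ^ n"
    using p_gt_1 real_arch_pow[of "real p" R] by auto
  have "compact {v + c * inverse (of_nat p ^ n) | v c. v \<in> {0::'c} \<and> c \<in> Zp}"
    by (intro compact_affine_image compact_Zp) auto
  moreover have eq: "Qp \<inter> cball 0 R = Qp \<inter> cball 0 R \<inter> {v + c * inverse (of_nat p ^ n) | v c. v \<in> {0::'c} \<and> c \<in> Zp}"
  proof -
    have "x \<in> {v + c * inverse (of_nat p ^ n) | v c. v \<in> {0::'c} \<and> c \<in> Zp}" if "x \<in> Qp" "x \<in> cball 0 R" for x :: 'c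
    proof -
      have "vabs (x * of_nat p ^ n) \<le> 1"
        using that n p_power_pos(2)[of n] by (simp add: dist_0_vabs vabs_mult vabs_p_power field_simps)
      then have "x * of_nat p ^ n \<in> Zp"
        using that assms by (simp add: int_ring_def subfield_intros)
      moreover have "x = 0 + (x * of_nat p ^ n) * inverse (of_nat p ^ n)"
        using p_gt_1 by simp
      ultimately show ?thesis
        by blast
    qed
    then show ?thesis
      by blast
  qed
  moreover have "closed (Qp \<inter> cball (0::'c) R)"
    by (simp add: Qp_def closed_Int)
  ultimately show ?thesis
    by (subst eq) (rule closed_Int_compact)
qed

text \<open>A limit point x of \<open>W\<close> is already a limit of points of \<open>W\<close> in
  the ball of radius |x| + 1, which form a closed set.\<close>

lemma closed_if_cball_compact:
  fixes W :: "'c set"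
  assumes "\<And>R. compact (W \<inter> cball 0 R)"
  shows "closed W"
proof -
  have "x \<in> W" if x: "x \<in> closure W" for x
  proof -
    have "x \<in> closure (W \<inter> cball 0 (vabs x + 1))"
      unfolding closure_approachable
    proof (intro allI impI)
      fix e :: real assume "0 < e"
      then obtain y where y: "y \<in> W" "dist y x < min e 1"
        using x unfolding closure_approachable by (metis min_less_iff_conj zero_less_one)
      then have "vabs y \<le> vabs x + 1"
        using vabs_add[of "y - x" x] vabs_nonneg[of x] by (simp add: dist_vabs max_def split: if_splits)
      then show "\<exists>y\<in>W \<inter> cball 0 (vabs x + 1). dist y x < e"
        using y by (intro bexI[of _ y]) (auto simp: dist_0_vabs)
    qed
    then show ?thesis
      using compact_imp_closed[OF assms] by auto
  qed
  then have "closure W = W"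
    using closure_subset by blast
  then show ?thesis
    using closed_closure[of W] by simp
qed

text \<open>Induction on the generators. A new vector b outside the span V has positive distance d
  from V, because V is closed. Hence |c| d is at most |v + c b|, and a bounded sum has a bounded
  coefficient and a bounded part in V.\<close>

lemma lin_span_compact:
  assumes k: "is_subfield (Qp::'c set)" and "finite B"
  shows "compact (lin_span (Qp::'c set) B \<inter> cball 0 R)"
  using assms(2)
proof (induction B arbitrary: R rule: finite_induct)
  case empty
  then show ?case
    by (auto intro!: finite_imp_compact)
next
  case (insert b B)
  define V where "V = lin_span Qp B"
  have V0: "0 \<in> V"
    unfolding V_def lin_span_def using k by (intro CollectI exI[of _ "\<lambda>_. 0"]) (auto simp: subfield_intros)
  have Vadd: "x + y \<in> V" if "x \<in> V" "y \<in> V" for x y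
  proof -
    obtain c d where "\<forall>b\<in>B. c b \<in> Qp" "x = (\<Sum>b\<in>B. c b * b)" "\<forall>b\<in>B. d b \<in> Qp" "y = (\<Sum>b\<in>B. d b * b)"
      using \<open>x \<in> V\<close> \<open>y \<in> V\<close> by (auto simp: V_def lin_span_def)
    then show ?thesis
      unfolding V_def lin_span_def using k
      by (intro CollectI exI[of _ "\<lambda>b. c b + d b"]) (auto simp: subfield_intros sum.distrib algebra_simps)
  qed
  have Vmult: "a * x \<in> V" if "x \<in> V" "a \<in> Qp" for x a
  proof -
    obtain c where "\<forall>b\<in>B. c b \<in> Qp" "x = (\<Sum>b\<in>B. c b * b)"
      using \<open>x \<in> V\<close> by (auto simp: V_def lin_span_def)
    then show ?thesis
      unfolding V_def lin_span_def using k that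
      by (intro CollectI exI[of _ "\<lambda>b. a * c b"]) (auto simp: subfield_intros sum_distrib_left mult.assoc)
  qed
  define W where "W = lin_span Qp (insert b B)"
  have W: "W = {v + c * b | v c. v \<in> V \<and> c \<in> Qp}"
    unfolding W_def V_def using insert by (intro lin_span_insert)
  have cV: "compact (V \<inter> cball 0 R)" for R
    using insert by (simp add: V_def)
  show ?case
  proof (cases "b \<in> V")
    case True
    have "v + c * b \<in> V" if "v \<in> V" "c \<in> Qp" for v c
      using that True by (intro Vadd Vmult)
    moreover have "v = v + 0 * b" "0 \<in> (Qp::'c set)" for v
      using k by (auto simp: subfield_intros)
    ultimately have "W = V"
      unfolding W by blast
    then show ?thesis
      using cV by (simp add: W_def)
  next
    case False
    have "closed V"
      by (rule closed_if_cball_compact) (rule cV)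
    with False have "b \<notin> closure V"
      by simp
    then obtain d where d: "d > 0" "\<And>v. v \<in> V \<Longrightarrow> \<not> dist v b < d"
      unfolding closure_approachable by blast
    show ?thesis
    proof (cases "R \<ge> 0")
      case False
      then have "lin_span Qp (insert b B) \<inter> cball 0 R = {}"
        by simp
      then show ?thesis
        by simp
    next
      case True
      \<comment> \<open>Bounds the part in V: it is x - c b with |x| at most \<open>R\<close> and
        |c| at most \<open>R / d\<close>.\<close>
      define R' where "R' = max R (R / d * vabs b)"
      let ?T = "{v + c * b | v c. v \<in> V \<inter> cball 0 R' \<and> c \<in> Qp \<inter> cball 0 (R / d)}"
      have "x \<in> ?T" if x: "x \<in> W" "vabs x \<le> R" for x
      proof -
        obtain v c where vc: "v \<in> V" "c \<in> Qp" "x = v + c * b"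
          using x W by auto
        have "vabs c \<le> R / d"
        proof (cases "c = 0")
          case False
          have "- inverse c * v \<in> V"
            using vc k by (intro Vmult) (auto simp: subfield_intros)
          then have "d \<le> vabs (- inverse c * v - b)"
            using d(2) by (auto simp: dist_vabs not_less)
          also have "- inverse c * v - b = - (inverse c * x)"
            using False vc(3) by (simp add: algebra_simps)
          also have "vabs \<dots> = vabs x / vabs c"
            by (simp only: vabs_minus vabs_mult vabs_inverse divide_inverse mult.commute)
          finally have "d * vabs c \<le> vabs x"
            using False vabs_pos[of c] by (simp add: field_simps)
          then show ?thesis
            using x d by (simp add: field_simps)
        qed (use True d in auto)
        moreover have "vabs v \<le> R'"
        proof -
          have "vabs (c * b) \<le> R / d * vabs b"
            unfolding vabs_mult by (intro mult_right_mono vabs_nonneg calculation)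
          then have "vabs (x - c * b) \<le> R'"
            using x by (intro vabs_diff_le) (auto simp: R'_def)
          then show ?thesis
            using vc by simp
        qed
        ultimately show ?thesis
          using vc by (auto simp: dist_0_vabs)
      qed
      then have "W \<inter> cball 0 R \<subseteq> cball 0 R \<inter> ?T"
        by (auto simp: dist_0_vabs)
      moreover have "?T \<subseteq> W"
        unfolding W by blast
      ultimately have "W \<inter> cball 0 R = cball 0 R \<inter> ?T"
        by blast
      moreover have "compact ?T"
        by (intro compact_affine_image cV compact_Qp_cball k)
      ultimately show ?thesis
        unfolding W_def by (simp add: closed_Int_compact)
    qed
  qed
qed

lemma finite_extension_eq_lin_span:
  assumes "finite_extension Qp (F::'c set)"
  shows "\<exists>B. finite B \<and> F = lin_span Qp B"
proof -
  obtain B where B: "finite B" "B \<subseteq> F" "\<And>x. x \<in> F \<Longrightarrow> \<exists>c. (\<forall>b\<in>B. c b \<in> Qp) \<and> x = (\<Sum>b\<in>B. c b * b)"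
    using assms unfolding finite_extension_def by blast
  have F: "is_subfield F" "Qp \<subseteq> F"
    using assms by (auto simp: finite_extension_def)
  have "lin_span Qp B \<subseteq> F"
    unfolding lin_span_def using B(2) F by (auto intro!: subfield_intros)
  moreover have "F \<subseteq> lin_span Qp B"
    using B(3) by (auto simp: lin_span_def)
  ultimately show ?thesis
    using B(1) by blast
qed

end

section \<open>Integral bases from independence modulo p\<close>

locale padic_extension = padic_field p ty
  for p and ty :: "'c::{nonarch_valued_field, alg_closed_field, complete_space} itself" +
  fixes F :: "'c set"
  assumes finite_ext: "finite_extension Qp F"
begin

lemma subfield_Qp: "is_subfield (Qp::'c set)" and subfield: "is_subfield F" and Qp_subset: "Qp \<subseteq> F"
  using finite_ext by (auto simp: finite_extension_def)

lemma closed_F: "closed F"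
  using finite_extension_eq_lin_span[OF finite_ext] lin_span_compact[OF subfield_Qp]
  by (metis closed_if_cball_compact)

lemma compact_int_ring: "compact (int_ring F)"
  using finite_extension_eq_lin_span[OF finite_ext] lin_span_compact[OF subfield_Qp]
  by (metis int_ring_eq)

lemma Zp_subset: "Zp \<subseteq> int_ring F"
  by (intro int_ring_mono Qp_subset)

text \<open>Linear independence modulo p over the residue field of \<open>Zp\<close>, phrased with
  lifts: an integer of absolute value at most 1/p is one divisible by p.\<close>

definition p_indep :: "'c set \<Rightarrow> bool" where
  "p_indep B \<longleftrightarrow> finite B \<and> B \<subseteq> int_ring F \<and>
     (\<forall>c. (\<forall>b\<in>B. c b \<in> Zp) \<and> vabs (\<Sum>b\<in>B. c b * b) \<le> 1 / real p \<longrightarrow> (\<forall>b\<in>B. vabs (c b) \<le> 1 / real p))"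

lemma p_indepD:
  "p_indep B \<Longrightarrow> (\<And>b. b \<in> B \<Longrightarrow> c b \<in> Zp) \<Longrightarrow> vabs (\<Sum>b\<in>B. c b * b) \<le> 1 / real p \<Longrightarrow> b \<in> B \<Longrightarrow> vabs (c b) \<le> 1 / real p"
  unfolding p_indep_def by blast

text \<open>A relation whose coefficients are divisible by p^n can be divided by p^n, and
  independence modulo p gives one more factor p; so the coefficients are divisible by all powers of
  p.\<close>

lemma p_indep_unique:
  assumes B: "p_indep B" and e: "\<And>b. b \<in> B \<Longrightarrow> e b \<in> Zp" "(\<Sum>b\<in>B. e b * b) = 0" and b: "b \<in> B"
  shows "e b = 0"
proof -
  have "\<forall>b\<in>B. vabs (e b) \<le> 1 / real p ^ n" for n
  proof (induction n)
    case 0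
    then show ?case
      using e by (simp add: int_ring_def)
  next
    case (Suc n)
    have "vabs (e b / of_nat p ^ n) \<le> 1 / real p" if "b \<in> B" for b
    proof (rule p_indepD[OF B, where c = "\<lambda>b. e b / of_nat p ^ n"])
      show "e b / of_nat p ^ n \<in> Zp" if "b \<in> B" for b
        using Suc that e(1)[OF that] subfield_Qp p_power_pos(2)[of n]
        by (auto simp: int_ring_def subfield_intros vabs_divide vabs_p_power field_simps)
      have "(\<Sum>b\<in>B. e b / of_nat p ^ n * b) = (\<Sum>b\<in>B. e b * b) / of_nat p ^ n"
        by (simp add: sum_divide_distrib)
      then show "vabs (\<Sum>b\<in>B. e b / of_nat p ^ n * b) \<le> 1 / real p"
        using e by simp
    qed fact
    then show ?case
      using p_power_pos(2)[of n] p_gt_1 by (simp add: vabs_divide vabs_p_power field_simps)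
  qed
  then have "vabs (e b) \<le> 1 / real p ^ n" for n
    using b by blast
  then have "\<not> vabs (e b) > 0"
    using ex_p_power_less by (meson not_less)
  then show ?thesis
    using vabs_pos by blast
qed

text \<open>Compactness gives a finite net of mesh 1/p. Two members of \<open>B\<close> near the
  same point would differ by a multiple of p, which is a relation with coefficients 1 and
  -1.\<close>

lemma p_indep_card_bounded: "\<exists>N. \<forall>B. p_indep B \<longrightarrow> card B \<le> N"
proof -
  have "0 < 1 / real p"
    using p_gt_1 by simp
  then obtain k where k: "finite k" "int_ring F \<subseteq> (\<Union>x\<in>k. ball x (1 / real p))"
    using compact_int_ring unfolding compact_eq_totally_bounded by meson
  have "card B \<le> card k" if B: "p_indep B" for B
  proof -
    have "\<forall>b\<in>B. \<exists>x\<in>k. dist x b < 1 / real p"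
      using k B by (fastforce simp: p_indep_def)
    then obtain g where g: "\<And>b. b \<in> B \<Longrightarrow> g b \<in> k" "\<And>b. b \<in> B \<Longrightarrow> dist (g b) b < 1 / real p"
      by metis
    have "inj_on g B"
    proof (rule inj_onI, rule ccontr)
      fix x y assume xy: "x \<in> B" "y \<in> B" "g x = g y" "x \<noteq> y"
      let ?c = "\<lambda>b. if b = x then 1 else if b = y then - 1 else 0"
      have "vabs (x - y) \<le> 1 / real p"
        using g(2)[OF xy(1)] g(2)[OF xy(2)] vabs_triangle[of x y "g x"] xy(3)
        by (simp add: dist_vabs vabs_commute[of "g y" x])
      moreover have "(\<Sum>b\<in>B. ?c b * b) = (\<Sum>b\<in>{x, y}. ?c b * b)"
        using B xy by (intro sum.mono_neutral_right) (auto simp: p_indep_def)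
      then have "(\<Sum>b\<in>B. ?c b * b) = x - y"
        using xy by simp
      moreover have "?c b \<in> Zp" for b
        using subfield_Qp by (auto simp: int_ring_def subfield_intros vabs_minus)
      ultimately have "vabs (?c x) \<le> 1 / real p"
        using p_indepD[OF B, of ?c x] xy(1) by simp
      then show False
        using p_gt_1 by simp
    qed
    then show ?thesis
      using k(1) g(1) by (meson card_inj_on_le image_subsetI)
  qed
  then show ?thesis
    by blast
qed

lemma lin_span_Zp_compact:
  assumes "finite B"
  shows "compact (lin_span Zp B)"
  using assms
  by (induction B rule: finite_induct) (auto simp: lin_span_insert intro!: compact_affine_image compact_Zp)

text \<open>
  A maximal independent family modulo \<open>p\<close> spans the integers modulo \<open>p\<close>, hence its span over the
  p-adic integers is dense by successive approximation, and closed by compactness.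
\<close>

lemma ex_Zp_basis:
  assumes "p_indep B0"
  shows "\<exists>B. B0 \<subseteq> B \<and> Zp_basis F B"
proof -
  obtain N where N: "\<And>B. p_indep B \<Longrightarrow> card B \<le> N"
    using p_indep_card_bounded by blast
  define P where "P B \<longleftrightarrow> p_indep B \<and> B0 \<subseteq> B" for B
  have "P B0"
    using assms by (simp add: P_def)
  then obtain B where B: "P B" "\<And>B'. P B' \<Longrightarrow> card B' \<le> card B"
    using ex_has_greatest_nat[of P B0 card "N + 1"] N by (metis P_def le_imp_less_Suc Suc_eq_plus1)
  have pB: "p_indep B" "finite B" "B \<subseteq> int_ring F"
    using B(1) by (auto simp: P_def p_indep_def)
  let ?S = "lin_span Zp B"
  have step: "\<exists>s\<in>?S. vabs (x - s) \<le> 1 / real p" if x: "x \<in> int_ring F" for x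
  proof (cases "x \<in> B")
    case True
    have "(\<Sum>b\<in>B. (if b = x then 1 else 0) * b) = x"
      using True pB by (simp add: if_distrib[of "\<lambda>z. z * _"] cong: if_cong)
    then have "x \<in> ?S"
      unfolding lin_span_def using subfield_Qp
      by (intro CollectI exI[of _ "\<lambda>b. if b = x then 1 else 0"]) (auto simp: int_ring_def subfield_intros)
    then show ?thesis
      by (intro bexI[of _ x]) auto
  next
    case False
    have "\<not> p_indep (insert x B)"
    proof
      assume "p_indep (insert x B)"
      then have "P (insert x B)"
        using B(1) by (auto simp: P_def)
      from B(2)[OF this] False pB(2) show False
        by simp
    qed
    then obtain c b where c: "\<And>b. b \<in> insert x B \<Longrightarrow> c b \<in> Zp"
        "vabs (\<Sum>b\<in>insert x B. c b * b) \<le> 1 / real p" "b \<in> insert x B" "\<not> vabs (c b) \<le> 1 / real p"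
      unfolding p_indep_def using x pB by blast
    have c2: "vabs (c x * x + (\<Sum>b\<in>B. c b * b)) \<le> 1 / real p"
      using c(2) False pB(2) by simp
    \<comment> \<open>Otherwise the term of \<open>x\<close> is divisible by p and the relation
      reduces to one within \<open>B\<close>, so that every coefficient is divisible by p.\<close>
    have "\<not> vabs (c x) < 1"
    proof
      assume "vabs (c x) < 1"
      then have cx: "vabs (c x) \<le> 1 / real p"
        using c(1) by (intro Zp_vabs_less_1) auto
      have "vabs (c x * x) \<le> 1 / real p * 1"
        unfolding vabs_mult using x cx by (intro mult_mono) (auto simp: int_ring_def vabs_nonneg)
      then have "vabs (c x * x + (\<Sum>b\<in>B. c b * b) - c x * x) \<le> 1 / real p"
        using c2 by (intro vabs_diff_le) auto
      then have "vabs (\<Sum>b\<in>B. c b * b) \<le> 1 / real p"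
        by simp
      then have "\<forall>b\<in>B. vabs (c b) \<le> 1 / real p"
        using p_indepD[OF pB(1)] c(1) by auto
      with cx c(3,4) show False
        by auto
    qed
    moreover have cxZ: "c x \<in> Zp"
      using c(1) by simp
    ultimately have cx: "vabs (c x) = 1" "c x \<noteq> 0"
      by (auto simp: int_ring_def)
    let ?s = "(\<Sum>b\<in>B. (- c b / c x) * b)"
    have "?s = - (\<Sum>b\<in>B. c b * b) / c x"
      by (simp add: sum_divide_distrib sum_negf)
    then have "x - ?s = (c x * x + (\<Sum>b\<in>B. c b * b)) / c x"
      using cx by (simp add: field_simps)
    then have "vabs (x - ?s) \<le> 1 / real p"
      using c2 cx by (simp add: vabs_divide)
    moreover have "- c b / c x \<in> Zp" if "b \<in> B" for b
      using c(1)[of b] cxZ cx that subfield_Qp by (simp add: int_ring_def subfield_intros vabs_divide vabs_minus)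
    then have "?s \<in> ?S"
      unfolding lin_span_def by (intro CollectI exI[of _ "\<lambda>b. - c b / c x"]) simp
    ultimately show ?thesis
      by blast
  qed
  have approx: "\<exists>s\<in>?S. vabs (x - s) \<le> 1 / real p ^ n" if x: "x \<in> int_ring F" for x n
  proof (induction n)
    case 0
    have "0 \<in> ?S"
      unfolding lin_span_def using subfield_Qp
      by (intro CollectI exI[of _ "\<lambda>_. 0"]) (auto simp: int_ring_intros)
    then show ?case
      using x by (intro bexI[of _ 0]) (auto simp: int_ring_def)
  next
    case (Suc n)
    then obtain c where c: "\<And>b. b \<in> B \<Longrightarrow> c b \<in> Zp" "vabs (x - (\<Sum>b\<in>B. c b * b)) \<le> 1 / real p ^ n"
      by (auto simp: lin_span_def)
    \<comment> \<open>The remainder, rescaled to an integer; approximating it modulo p supplies the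
      next p-adic digit of every coefficient.\<close>
    let ?y = "(x - (\<Sum>b\<in>B. c b * b)) / of_nat p ^ n"
    have "c b * b \<in> int_ring F" if "b \<in> B" for b
      using that c(1) pB(3) Zp_subset subfield by (intro int_ring_intros) auto
    then have "x - (\<Sum>b\<in>B. c b * b) \<in> int_ring F"
      by (rule diff_in_int_ring[OF subfield x sum_in_int_ring[OF subfield]])
    then have "?y \<in> int_ring F"
      using c(2) subfield p_power_pos(2)[of n]
      by (auto simp: int_ring_def subfield_intros vabs_divide vabs_p_power field_simps)
    from step[OF this] obtain d where d: "\<And>b. b \<in> B \<Longrightarrow> d b \<in> Zp" "vabs (?y - (\<Sum>b\<in>B. d b * b)) \<le> 1 / real p"
      by (auto simp: lin_span_def)
    let ?s = "(\<Sum>b\<in>B. (c b + of_nat p ^ n * d b) * b)"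
    have "of_nat p ^ n * ?y = x - (\<Sum>b\<in>B. c b * b)"
      using p_gt_1 by simp
    then have "x - ?s = of_nat p ^ n * (?y - (\<Sum>b\<in>B. d b * b))"
      unfolding right_diff_distrib
      by (simp add: sum.distrib ring_distribs sum_distrib_left mult.assoc)
    then have "vabs (x - ?s) = 1 / real p ^ n * vabs (?y - (\<Sum>b\<in>B. d b * b))"
      by (simp only: vabs_mult vabs_p_power)
    also have "\<dots> \<le> 1 / real p ^ n * (1 / real p)"
      by (intro mult_left_mono d(2)) auto
    finally have "vabs (x - ?s) \<le> 1 / real p ^ Suc n"
      by (simp add: mult.commute)
    moreover have "c b + of_nat p ^ n * d b \<in> Zp" if "b \<in> B" for b
      using that c(1) d(1) subfield_Qp of_nat_in_int_ring[of Qp "p ^ n"] by (auto intro!: int_ring_intros)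
    then have "?s \<in> ?S"
      unfolding lin_span_def by (intro CollectI exI[of _ "\<lambda>b. c b + of_nat p ^ n * d b"]) simp
    ultimately show ?case
      by blast
  qed
  have span: "x \<in> ?S" if x: "x \<in> int_ring F" for x
  proof -
    have "x \<in> closure ?S"
      unfolding closure_approachable
    proof (intro allI impI)
      fix e :: real assume "0 < e"
      then obtain n where n: "1 / real p ^ n < e"
        using ex_p_power_less by blast
      then show "\<exists>y\<in>?S. dist y x < e"
        using approx[OF x, of n] by (force simp: dist_vabs vabs_commute)
    qed
    moreover have "closed ?S"
      by (intro compact_imp_closed lin_span_Zp_compact pB)
    ultimately show ?thesis
      by simp
  qed
  have "Zp_basis F B"
    unfolding Zp_basis_def
  proof (intro conjI ballI pB)
    fix x assume "x \<in> int_ring F"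
    then obtain c where c: "\<And>b. b \<in> B \<Longrightarrow> c b \<in> Zp" "x = (\<Sum>b\<in>B. c b * b)"
      using span by (auto simp: lin_span_def)
    show "\<exists>!c. c \<in> B \<rightarrow>\<^sub>E Zp \<and> x = (\<Sum>b\<in>B. c b * b)"
    proof (rule ex1I)
      show "restrict c B \<in> B \<rightarrow>\<^sub>E Zp \<and> x = (\<Sum>b\<in>B. restrict c B b * b)"
        using c by auto
    next
      fix d assume d: "d \<in> B \<rightarrow>\<^sub>E Zp \<and> x = (\<Sum>b\<in>B. d b * b)"
      then have "(\<Sum>b\<in>B. (d b - c b) * b) = 0"
        using c(2) by (simp add: left_diff_distrib sum_subtractf)
      then have "d b - c b = 0" if "b \<in> B" for b
        using p_indep_unique[OF pB(1), of "\<lambda>b. d b - c b"] that c(1) d subfield_Qp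
        by (auto intro!: int_ring_intros)
      then show "d = restrict c B"
        using d by (auto simp: fun_eq_iff PiE_def extensional_def)
    qed
  qed
  then show ?thesis
    using B(1) by (auto simp: P_def)
qed

lemma ex_Zp_basis': "\<exists>B. Zp_basis F B"
  using ex_Zp_basis[of "{}"] by (auto simp: p_indep_def)

text \<open>A combination divisible by p in F stays integral in F' after division by p, since both
  fields carry the same absolute value. Uniqueness of coordinates in F' then makes every coefficient
  divisible by p. This is what lets a basis for a subfield be extended.\<close>

lemma Zp_basis_subfield_p_indep:
  assumes B: "Zp_basis F' B" and F': "is_subfield F'" "F' \<subseteq> F" "Qp \<subseteq> F'"
  shows "p_indep B"
  unfolding p_indep_def
proof (intro conjI allI impI ballI)
  show "finite B" "B \<subseteq> int_ring F"
    using B int_ring_mono[OF F'(2)] by (auto simp: Zp_basis_def)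
  have uniq: "c b = d b" if "\<And>b. b \<in> B \<Longrightarrow> c b \<in> Zp" "\<And>b. b \<in> B \<Longrightarrow> d b \<in> Zp"
    "(\<Sum>b\<in>B. c b * b) \<in> int_ring F'" "(\<Sum>b\<in>B. c b * b) = (\<Sum>b\<in>B. d b * b)" "b \<in> B" for c d b
  proof -
    have "restrict c B \<in> B \<rightarrow>\<^sub>E Zp \<and> (\<Sum>b\<in>B. c b * b) = (\<Sum>b\<in>B. restrict c B b * b)"
      "restrict d B \<in> B \<rightarrow>\<^sub>E Zp \<and> (\<Sum>b\<in>B. c b * b) = (\<Sum>b\<in>B. restrict d B b * b)"
      using that by auto
    then have "restrict c B = restrict d B"
      using B that(3) unfolding Zp_basis_def by blast
    then show ?thesis
      using that(5) by (metis restrict_apply')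
  qed
  fix c b assume c: "(\<forall>b\<in>B. c b \<in> Zp) \<and> vabs (\<Sum>b\<in>B. c b * b) \<le> 1 / real p" and b: "b \<in> B"
  let ?x = "(\<Sum>b\<in>B. c b * b)"
  have mem: "c b * b \<in> int_ring F'" if "b \<in> B" for b
    using B c that F' int_ring_mono[OF F'(3)] by (auto simp: Zp_basis_def intro!: int_ring_intros)
  then have x: "?x \<in> int_ring F'"
    by (rule sum_in_int_ring[OF F'(1)])
  then have "?x / of_nat p \<in> int_ring F'"
    using c F' p_gt_1 by (simp add: int_ring_def subfield_intros vabs_divide vabs_p field_simps)
  then obtain d where d: "d \<in> B \<rightarrow>\<^sub>E Zp" "?x / of_nat p = (\<Sum>b\<in>B. d b * b)"
    using B unfolding Zp_basis_def by blast
  have dZ: "of_nat p * d b \<in> Zp" if "b \<in> B" for b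
    using d that subfield_Qp by (auto intro!: int_ring_intros)
  have "?x = (\<Sum>b\<in>B. of_nat p * d b * b)"
  proof -
    have "?x = of_nat p * (\<Sum>b\<in>B. d b * b)"
      using p_gt_1 by (simp flip: d(2))
    then show ?thesis
      by (simp add: sum_distrib_left mult.assoc)
  qed
  then have "c b = of_nat p * d b"
    using uniq[of c "\<lambda>b. of_nat p * d b" b] c dZ x b by auto
  moreover have "vabs (d b) \<le> 1"
    using d b by (auto simp: int_ring_def)
  ultimately show "vabs (c b) \<le> 1 / real p"
    using p_gt_1 by (simp add: vabs_mult vabs_p field_simps)
qed

end

section \<open>Coordinates in an integral basis\<close>

locale padic_basis = padic_extension p ty F
  for p and ty :: "'c::{nonarch_valued_field, alg_closed_field, complete_space} itself" and F :: "'c set" +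
  fixes B :: "'c set"
  assumes basis: "Zp_basis F B"
begin

lemma finite_B: "finite B" and B_subset: "B \<subseteq> int_ring F"
  using basis by (auto simp: Zp_basis_def)

definition coord :: "'c \<Rightarrow> 'c \<Rightarrow> 'c" where
  "coord x = (THE c. c \<in> B \<rightarrow>\<^sub>E Zp \<and> x = (\<Sum>b\<in>B. c b * b))"

lemma coord:
  assumes "x \<in> int_ring F"
  shows "coord x \<in> B \<rightarrow>\<^sub>E Zp" "(\<Sum>b\<in>B. coord x b * b) = x"
proof -
  have "\<exists>!c. c \<in> B \<rightarrow>\<^sub>E Zp \<and> x = (\<Sum>b\<in>B. c b * b)"
    using basis assms unfolding Zp_basis_def by blast
  from theI'[OF this] show "coord x \<in> B \<rightarrow>\<^sub>E Zp" "(\<Sum>b\<in>B. coord x b * b) = x"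
    unfolding coord_def by auto
qed

lemma coord_Zp: "x \<in> int_ring F \<Longrightarrow> b \<in> B \<Longrightarrow> coord x b \<in> Zp"
  using coord(1)[of x] by auto

lemma lin_comb_int_ring:
  assumes "\<And>b. b \<in> B \<Longrightarrow> c b \<in> Zp"
  shows "(\<Sum>b\<in>B. c b * b) \<in> int_ring F"
  using assms B_subset Zp_subset subfield by (intro int_ring_intros) auto

lemma coord_lin_comb:
  assumes "\<And>b. b \<in> B \<Longrightarrow> c b \<in> Zp" "b \<in> B"
  shows "coord (\<Sum>b\<in>B. c b * b) b = c b"
proof -
  let ?x = "\<Sum>b\<in>B. c b * b"
  have x: "?x \<in> int_ring F"
    using assms by (intro lin_comb_int_ring)
  have "restrict c B \<in> B \<rightarrow>\<^sub>E Zp \<and> ?x = (\<Sum>b\<in>B. restrict c B b * b)"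
    "coord ?x \<in> B \<rightarrow>\<^sub>E Zp \<and> ?x = (\<Sum>b\<in>B. coord ?x b * b)"
    using assms coord[OF x] by auto
  then have "restrict c B = coord ?x"
    using basis x unfolding Zp_basis_def by blast
  then show ?thesis
    using assms(2) by (metis restrict_apply')
qed

lemma coord_add:
  assumes "x \<in> int_ring F" "y \<in> int_ring F" "b \<in> B"
  shows "coord (x + y) b = coord x b + coord y b"
proof -
  have "x + y = (\<Sum>b\<in>B. (coord x b + coord y b) * b)"
    using coord(2)[OF assms(1)] coord(2)[OF assms(2)] by (simp add: ring_distribs sum.distrib)
  then show ?thesis
    using coord_lin_comb[of "\<lambda>b. coord x b + coord y b" b] assms coord_Zp subfield_Qp
    by (auto intro!: int_ring_intros)
qed

text \<open>Both sides express divisibility of the difference by p^n. Only these radii are treated: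
  in a ramified extension the absolute value need not be the maximum of those of the
  coordinates.\<close>

lemma coord_near_iff:
  assumes x: "x \<in> int_ring F" and y: "y \<in> int_ring F"
  shows "vabs (x - y) \<le> 1 / real p ^ n \<longleftrightarrow> (\<forall>b\<in>B. vabs (coord x b - coord y b) \<le> 1 / real p ^ n)"
proof
  assume le: "vabs (x - y) \<le> 1 / real p ^ n"
  let ?z = "(x - y) / of_nat p ^ n"
  have z: "?z \<in> int_ring F"
    using le diff_in_int_ring[OF subfield x y] p_power_pos(2)[of n] subfield
    by (simp add: int_ring_def subfield_intros vabs_divide vabs_p_power field_simps)
  have cz: "of_nat p ^ n * coord ?z b \<in> Zp" if "b \<in> B" for b
    using coord_Zp[OF z that] subfield_Qp of_nat_in_int_ring[of Qp "p ^ n"] by (auto intro!: int_ring_intros)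
  have xy: "x = (\<Sum>b\<in>B. (coord y b + of_nat p ^ n * coord ?z b) * b)"
  proof -
    have "of_nat p ^ n * (\<Sum>b\<in>B. coord ?z b * b) = x - y"
      unfolding coord(2)[OF z] using p_gt_1 by simp
    then show ?thesis
      using coord(2)[OF y] by (simp add: ring_distribs sum.distrib sum_distrib_left mult.assoc)
  qed
  have cx: "coord x b = coord y b + of_nat p ^ n * coord ?z b" if "b \<in> B" for b
  proof -
    have "coord y b + of_nat p ^ n * coord ?z b \<in> Zp" if "b \<in> B" for b
      by (intro add_in_int_ring subfield_Qp cz coord_Zp[OF y] that)
    from coord_lin_comb[of "\<lambda>b. coord y b + of_nat p ^ n * coord ?z b", OF this that] show ?thesis
      unfolding xy[symmetric] .
  qed
  show "\<forall>b\<in>B. vabs (coord x b - coord y b) \<le> 1 / real p ^ n"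
  proof
    fix b assume "b \<in> B"
    then show "vabs (coord x b - coord y b) \<le> 1 / real p ^ n"
      using cx[of b] coord_Zp[OF z, of b] p_power_pos(2)[of n]
      by (auto simp: vabs_mult vabs_p_power int_ring_def divide_right_mono)
  qed
next
  assume le: "\<forall>b\<in>B. vabs (coord x b - coord y b) \<le> 1 / real p ^ n"
  have "x - y = (\<Sum>b\<in>B. (coord x b - coord y b) * b)"
    using coord(2)[OF x] coord(2)[OF y] by (simp add: left_diff_distrib sum_subtractf)
  also have "vabs \<dots> \<le> 1 / real p ^ n"
  proof (rule vabs_sum_le)
    fix b assume b: "b \<in> B"
    then have "vabs b \<le> 1"
      using B_subset by (auto simp: int_ring_def)
    then have "vabs (coord x b - coord y b) * vabs b \<le> 1 / real p ^ n * 1"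
      using le b by (intro mult_mono) (auto simp: vabs_nonneg)
    then show "vabs ((coord x b - coord y b) * b) \<le> 1 / real p ^ n"
      by (simp add: vabs_mult)
  qed auto
  finally show "vabs (x - y) \<le> 1 / real p ^ n" .
qed

end

section \<open>Measures on the integers and Riemann sums\<close>

context padic_extension
begin

abbreviation OF :: "'c set" where
  "OF \<equiv> int_ring F"

lemma clopen_inI:
  assumes "C \<subseteq> S" "r > 0" "\<And>x y. x \<in> C \<Longrightarrow> y \<in> S \<Longrightarrow> vabs (x - y) \<le> r \<Longrightarrow> y \<in> C"
  shows "clopen_in S (C::'c set)"
proof -
  have "openin (top_of_set S) C"
    unfolding openin_euclidean_subtopology_iff
    using assms by (auto simp: dist_vabs vabs_commute intro!: exI[of _ r])
  moreover have "y \<in> S - C" if "x \<in> S - C" "y \<in> S" "vabs (y - x) \<le> r" for x y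
    using that assms(3)[of y x] by auto
  then have "openin (top_of_set S) (S - C)"
    unfolding openin_euclidean_subtopology_iff
    using assms(2) by (fastforce simp: dist_vabs intro!: exI[of _ r])
  ultimately show ?thesis
    using assms(1) by (auto simp: clopen_in_def closedin_def)
qed

text \<open>By compactness the continuous indicator function of \<open>C\<close> is uniformly
  continuous, so one radius works at all points of \<open>C\<close>.\<close>

lemma clopen_inD:
  assumes "clopen_in OF C"
  shows "C \<subseteq> OF" "\<exists>n. \<forall>x\<in>C. \<forall>y\<in>OF. vabs (x - y) \<le> 1 / real p ^ n \<longrightarrow> y \<in> C"
proof -
  have C: "openin (top_of_set OF) C" "openin (top_of_set OF) (OF - C)"
    using assms by (auto simp: clopen_in_def closedin_def)
  then show "C \<subseteq> OF"
    by (simp add: openin_euclidean_subtopology_iff)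
  let ?f = "\<lambda>x. if x \<in> C then 1 else 0 :: real"
  have "continuous_on OF ?f"
    unfolding continuous_on_iff
  proof (intro ballI allI impI)
    fix x e assume x: "x \<in> OF" "0 < (e::real)"
    show "\<exists>d>0. \<forall>x'\<in>OF. dist x' x < d \<longrightarrow> dist (?f x') (?f x) < e"
    proof (cases "x \<in> C")
      case True
      then obtain d where "d > 0" "\<forall>x'\<in>OF. dist x' x < d \<longrightarrow> x' \<in> C"
        using C(1) unfolding openin_euclidean_subtopology_iff by blast
      then show ?thesis
        using True x by (intro exI[of _ d]) auto
    next
      case False
      then obtain d where "d > 0" "\<forall>x'\<in>OF. dist x' x < d \<longrightarrow> x' \<in> OF - C"
        using C(2) x unfolding openin_euclidean_subtopology_iff by blast
      then show ?thesis
        using False x by (intro exI[of _ d]) auto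
    qed
  qed
  then have "uniformly_continuous_on OF ?f"
    by (intro compact_uniformly_continuous compact_int_ring)
  then obtain d where d: "d > 0" "\<And>x y. x \<in> OF \<Longrightarrow> y \<in> OF \<Longrightarrow> dist y x < d \<Longrightarrow> dist (?f y) (?f x) < 1"
    unfolding uniformly_continuous_on_def by (metis zero_less_one)
  obtain n where n: "1 / real p ^ n < d"
    using ex_p_power_less[OF d(1)] by blast
  show "\<exists>n. \<forall>x\<in>C. \<forall>y\<in>OF. vabs (x - y) \<le> 1 / real p ^ n \<longrightarrow> y \<in> C"
  proof (intro exI ballI impI)
    fix x y assume xy: "x \<in> C" "y \<in> OF" "vabs (x - y) \<le> 1 / real p ^ n"
    then have "dist (?f y) (?f x) < 1"
      using n \<open>C \<subseteq> OF\<close> by (intro d(2)) (auto simp: dist_vabs vabs_commute)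
    then show "y \<in> C"
      using xy by (auto split: if_splits)
  qed
qed

lemma clopen_in_empty: "clopen_in OF {}"
  by (rule clopen_inI[of _ _ 1]) auto

lemma clopen_in_Int: "clopen_in S C \<Longrightarrow> clopen_in S D \<Longrightarrow> clopen_in S (C \<inter> D)"
  by (simp add: clopen_in_def openin_Int closedin_Int)

lemma clopen_in_UN:
  "finite I \<Longrightarrow> (\<And>i. i \<in> I \<Longrightarrow> clopen_in S (C i)) \<Longrightarrow> clopen_in S (\<Union>i\<in>I. C i)"
  by (auto simp: clopen_in_def intro!: closedin_Union)

lemma disjoint_family_on_mono:
  assumes "disjoint_family_on D J" "\<And>j. E j \<subseteq> D j"
  shows "disjoint_family_on E J"
  using assms unfolding disjoint_family_on_def by fastforce

text \<open>Indexed and with empty members allowed, unlike \<open>partition_on\<close>; this suits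
  cells labelled by residues and preimages of partitions.\<close>

definition clopen_partition :: "'i set \<Rightarrow> ('i \<Rightarrow> 'c set) \<Rightarrow> bool" where
  "clopen_partition I C \<longleftrightarrow> finite I \<and> (\<forall>i\<in>I. clopen_in OF (C i)) \<and> disjoint_family_on C I \<and> (\<Union>i\<in>I. C i) = OF"

context
  fixes \<mu> :: "'c set \<Rightarrow> 'c"
  assumes \<mu>: "\<mu> \<in> int_measures F"
begin

lemma measure_int_ring: "clopen_in OF C \<Longrightarrow> \<mu> C \<in> OF"
  using \<mu> by (simp add: int_measures_def)

lemma measure_vabs_le: "clopen_in OF C \<Longrightarrow> vabs (\<mu> C) \<le> 1"
  using measure_int_ring by (simp add: int_ring_def)

lemma measure_Un: "clopen_in OF C \<Longrightarrow> clopen_in OF D \<Longrightarrow> C \<inter> D = {} \<Longrightarrow> \<mu> (C \<union> D) = \<mu> C + \<mu> D"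
  using \<mu> by (simp add: int_measures_def)

lemma measure_empty: "\<mu> {} = 0"
  using measure_Un[OF clopen_in_empty clopen_in_empty] by simp

lemma measure_UN:
  assumes "finite I" "\<And>i. i \<in> I \<Longrightarrow> clopen_in OF (C i)" "disjoint_family_on C I"
  shows "\<mu> (\<Union>i\<in>I. C i) = (\<Sum>i\<in>I. \<mu> (C i))"
  using assms
proof (induction I rule: finite_induct)
  case empty
  then show ?case
    by (simp add: measure_empty)
next
  case (insert i I)
  have "C i \<inter> (\<Union>i\<in>I. C i) = {}"
    using insert by (auto simp: disjoint_family_on_def)
  then have "\<mu> (C i \<union> (\<Union>i\<in>I. C i)) = \<mu> (C i) + \<mu> (\<Union>i\<in>I. C i)"
    using insert by (intro measure_Un clopen_in_UN) auto
  also have "\<mu> (\<Union>i\<in>I. C i) = (\<Sum>i\<in>I. \<mu> (C i))"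
    using insert by (auto simp: disjoint_family_on_def)
  finally show ?case
    using insert by simp
qed

text \<open>Both sums are rewritten over the common refinement. Since |\<mu>| is at most 1 and the
  absolute value is ultrametric, the number of pieces does not matter. The alternative of measure 0
  serves the descent, where only pieces meeting the smaller ring can be compared.\<close>

lemma Riemann_sums_near:
  assumes C: "clopen_partition I C" and D: "clopen_partition J D" and e: "0 \<le> e"
    and uv: "\<And>i j. i \<in> I \<Longrightarrow> j \<in> J \<Longrightarrow> C i \<inter> D j \<noteq> {} \<Longrightarrow> \<mu> (C i \<inter> D j) = 0 \<or> vabs (u i - v j) \<le> e"
  shows "vabs ((\<Sum>i\<in>I. \<mu> (C i) * u i) - (\<Sum>j\<in>J. \<mu> (D j) * v j)) \<le> e"
proof -
  have cl: "clopen_in OF (C i \<inter> D j)" if "i \<in> I" "j \<in> J" for i j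
    using that C D by (auto simp: clopen_partition_def intro: clopen_in_Int)
  have "\<mu> (C i) = (\<Sum>j\<in>J. \<mu> (C i \<inter> D j))" if i: "i \<in> I" for i
  proof -
    have "C i \<subseteq> OF"
      using C i by (auto simp: clopen_partition_def)
    then have "C i = (\<Union>j\<in>J. C i \<inter> D j)"
      using D by (auto simp: clopen_partition_def)
    also have "\<mu> \<dots> = (\<Sum>j\<in>J. \<mu> (C i \<inter> D j))"
      using D by (intro measure_UN cl[OF i]) (auto simp: clopen_partition_def elim!: disjoint_family_on_mono)
    finally show ?thesis .
  qed
  then have 1: "(\<Sum>i\<in>I. \<mu> (C i) * u i) = (\<Sum>i\<in>I. \<Sum>j\<in>J. \<mu> (C i \<inter> D j) * u i)"
    by (simp add: sum_distrib_right)
  have "\<mu> (D j) = (\<Sum>i\<in>I. \<mu> (C i \<inter> D j))" if j: "j \<in> J" for j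
  proof -
    have "D j \<subseteq> OF"
      using D j by (auto simp: clopen_partition_def)
    then have "D j = (\<Union>i\<in>I. C i \<inter> D j)"
      using C by (auto simp: clopen_partition_def)
    also have "\<mu> \<dots> = (\<Sum>i\<in>I. \<mu> (C i \<inter> D j))"
      using C by (intro measure_UN cl[OF _ j]) (auto simp: clopen_partition_def elim!: disjoint_family_on_mono)
    finally show ?thesis .
  qed
  then have "(\<Sum>j\<in>J. \<mu> (D j) * v j) = (\<Sum>j\<in>J. \<Sum>i\<in>I. \<mu> (C i \<inter> D j) * v j)"
    by (simp add: sum_distrib_right)
  also have "\<dots> = (\<Sum>i\<in>I. \<Sum>j\<in>J. \<mu> (C i \<inter> D j) * v j)"
    by (rule sum.swap)
  finally have "(\<Sum>i\<in>I. \<mu> (C i) * u i) - (\<Sum>j\<in>J. \<mu> (D j) * v j) = (\<Sum>i\<in>I. \<Sum>j\<in>J. \<mu> (C i \<inter> D j) * (u i - v j))"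
    unfolding 1 by (simp add: sum_subtractf right_diff_distrib)
  also have "vabs \<dots> \<le> e"
  proof (intro vabs_sum_le e)
    fix i j assume ij: "i \<in> I" "j \<in> J"
    consider "\<mu> (C i \<inter> D j) = 0" | "vabs (u i - v j) \<le> e"
      using uv[OF ij] measure_empty by (cases "C i \<inter> D j = {}") auto
    then show "vabs (\<mu> (C i \<inter> D j) * (u i - v j)) \<le> e"
    proof cases
      case 2
      then have "vabs (\<mu> (C i \<inter> D j)) * vabs (u i - v j) \<le> 1 * e"
        by (intro mult_mono measure_vabs_le cl ij) (auto simp: vabs_nonneg)
      then show ?thesis
        by (simp add: vabs_mult)
    qed (use e in auto)
  qed
  finally show ?thesis .
qed

end

end

section \<open>Cells: the classes modulo p^n\<close>

context padic_basis
begin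

text \<open>Labels for the classes modulo p^n, by residues of coordinates: \<open>pt a\<close> is
  the natural representative of a class and \<open>cell n a\<close> the class itself. The same set
  indexes the Mahler degrees below p^n and the exponents of the characters of level n.\<close>

definition idx :: "nat \<Rightarrow> ('c \<Rightarrow> nat) set" where
  "idx n = B \<rightarrow>\<^sub>E {..<p ^ n}"

definition pt :: "('c \<Rightarrow> nat) \<Rightarrow> 'c" where
  "pt a = (\<Sum>b\<in>B. of_nat (a b) * b)"

definition cell :: "nat \<Rightarrow> ('c \<Rightarrow> nat) \<Rightarrow> 'c set" where
  "cell n a = {x \<in> OF. vabs (x - pt a) \<le> 1 / real p ^ n}"

definition resid :: "nat \<Rightarrow> 'c \<Rightarrow> 'c \<Rightarrow> nat" where
  "resid n x = (\<lambda>b\<in>B. res n (coord x b))"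

lemma finite_idx: "finite (idx n)"
  by (simp add: idx_def finite_PiE finite_B)

lemma idxD: "a \<in> idx n \<Longrightarrow> b \<in> B \<Longrightarrow> a b < p ^ n"
  by (auto simp: idx_def)

lemma of_nat_Zp: "of_nat k \<in> Zp"
  by (simp add: of_nat_in_int_ring subfield_Qp)

lemma pt_OF: "pt a \<in> OF"
  unfolding pt_def by (intro lin_comb_int_ring of_nat_Zp)

lemma coord_pt: "b \<in> B \<Longrightarrow> coord (pt a) b = of_nat (a b)"
  unfolding pt_def by (rule coord_lin_comb) (auto simp: of_nat_Zp)

lemma resid_idx: "x \<in> OF \<Longrightarrow> resid n x \<in> idx n"
  by (auto simp: resid_def idx_def intro!: res_less coord_Zp)

lemma resid_eq_iff:
  assumes "x \<in> OF" "y \<in> OF"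
  shows "resid n x = resid n y \<longleftrightarrow> vabs (x - y) \<le> 1 / real p ^ n"
proof -
  have "resid n x = resid n y \<longleftrightarrow> (\<forall>b\<in>B. res n (coord x b) = res n (coord y b))"
    by (auto simp: resid_def fun_eq_iff restrict_def)
  also have "\<dots> \<longleftrightarrow> (\<forall>b\<in>B. vabs (coord x b - coord y b) \<le> 1 / real p ^ n)"
    using assms by (intro ball_cong refl res_eq_iff coord_Zp)
  also have "\<dots> \<longleftrightarrow> vabs (x - y) \<le> 1 / real p ^ n"
    using coord_near_iff[OF assms] by simp
  finally show ?thesis .
qed

lemma resid_pt: "a \<in> idx n \<Longrightarrow> resid n (pt a) = a"
  by (auto simp: resid_def coord_pt res_of_nat idx_def fun_eq_iff PiE_def extensional_def Pi_def)

lemma mem_cell_iff: "a \<in> idx n \<Longrightarrow> x \<in> cell n a \<longleftrightarrow> x \<in> OF \<and> resid n x = a"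
  using resid_eq_iff[OF _ pt_OF, of x n a] resid_pt[of a n] by (auto simp: cell_def)

lemma pt_in_cell: "pt a \<in> cell n a"
  by (simp add: cell_def pt_OF)

lemma cell_diam: "x \<in> cell n a \<Longrightarrow> y \<in> cell n a \<Longrightarrow> vabs (x - y) \<le> 1 / real p ^ n"
  using vabs_triangle[of x y "pt a"] by (auto simp: cell_def vabs_commute[of y])

lemma clopen_partition_cell: "clopen_partition (idx n) (cell n)"
  unfolding clopen_partition_def
proof (intro conjI ballI finite_idx)
  fix a
  show "clopen_in OF (cell n a)"
  proof (rule clopen_inI)
    fix x y assume "x \<in> cell n a" "y \<in> OF" "vabs (x - y) \<le> 1 / real p ^ n"
    then show "y \<in> cell n a"
      using vabs_triangle[of y "pt a" x] by (auto simp: cell_def vabs_commute[of y])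
  qed (use p_power_pos in \<open>auto simp: cell_def\<close>)
next
  show "disjoint_family_on (cell n) (idx n)"
    by (auto simp: disjoint_family_on_def mem_cell_iff)
  show "(\<Union>a\<in>idx n. cell n a) = OF"
    using resid_idx by (auto simp: mem_cell_iff)
qed

lemma clopen_cell: "a \<in> idx n \<Longrightarrow> clopen_in OF (cell n a)"
  using clopen_partition_cell by (simp add: clopen_partition_def)

text \<open>The uniform radius of \<open>clopen_inD\<close> makes \<open>C\<close> a disjoint union
  of cells of a single level.\<close>

lemma measure_clopen_eq_sum_cells:
  assumes \<mu>: "\<mu> \<in> int_measures F" and C: "clopen_in OF C"
  shows "\<exists>n. \<mu> C = (\<Sum>a | a \<in> idx n \<and> cell n a \<subseteq> C. \<mu> (cell n a))"
proof -
  obtain n where n: "\<And>x y. x \<in> C \<Longrightarrow> y \<in> OF \<Longrightarrow> vabs (x - y) \<le> 1 / real p ^ n \<Longrightarrow> y \<in> C"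
    using clopen_inD(2)[OF C] by blast
  have CO: "C \<subseteq> OF"
    by (rule clopen_inD(1)[OF C])
  let ?I = "{a \<in> idx n. cell n a \<subseteq> C}"
  have "x \<in> (\<Union>a\<in>?I. cell n a)" if "x \<in> C" for x
  proof -
    have x: "x \<in> OF"
      using CO that by auto
    then have xc: "x \<in> cell n (resid n x)"
      by (simp add: mem_cell_iff resid_idx)
    have "cell n (resid n x) \<subseteq> C"
    proof
      fix y assume y: "y \<in> cell n (resid n x)"
      then have "y \<in> OF"
        by (simp add: cell_def)
      then show "y \<in> C"
        using n[OF that] cell_diam[OF xc y] by blast
    qed
    with xc resid_idx[OF x] show ?thesis
      by (intro UN_I[of "resid n x"] CollectI conjI)
  qed
  then have "C = (\<Union>a\<in>?I. cell n a)"
    by auto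
  also have "\<mu> \<dots> = (\<Sum>a\<in>?I. \<mu> (cell n a))"
    using clopen_partition_cell[of n]
    by (intro measure_UN[OF \<mu>]) (auto simp: clopen_partition_def disjoint_family_on_def)
  finally show ?thesis
    by auto
qed

lemma Riemann_sum_cells_tendsto:
  assumes "has_measure_integral F \<mu> g I"
  shows "(\<lambda>n. \<Sum>a\<in>idx n. \<mu> (cell n a) * g (pt a)) \<longlonglongrightarrow> I"
  unfolding LIMSEQ_vabs_iff
proof (intro allI impI)
  fix e :: real assume "e > 0"
  then have "\<exists>d>0. \<forall>P t. finite P \<and> partition_on OF P \<and>
      (\<forall>C\<in>P. clopen_in OF C \<and> t C \<in> C \<and> (\<forall>x\<in>C. \<forall>y\<in>C. vabs (x - y) < d)) \<longrightarrow>
        vabs ((\<Sum>C\<in>P. \<mu> C * g (t C)) - I) < e"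
    by (rule mp[OF spec[OF assms[unfolded has_measure_integral_def], of e]])
  then obtain d where d: "d > 0" and dP: "\<forall>P t. finite P \<and> partition_on OF P \<and>
      (\<forall>C\<in>P. clopen_in OF C \<and> t C \<in> C \<and> (\<forall>x\<in>C. \<forall>y\<in>C. vabs (x - y) < d)) \<longrightarrow>
        vabs ((\<Sum>C\<in>P. \<mu> C * g (t C)) - I) < e"
    by (elim exE conjE)
  obtain N where N: "1 / real p ^ N < d"
    using ex_p_power_less[OF d] by blast
  have "vabs ((\<Sum>a\<in>idx n. \<mu> (cell n a) * g (pt a)) - I) < e" if "n \<ge> N" for n
  proof -
    \<comment> \<open>The integral tags sets, not labels, so the label has to be recovered from the
      cell.\<close>
    define t where "t C = pt (the_inv_into (idx n) (cell n) C)" for C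
    have inj: "inj_on (cell n) (idx n)"
    proof (rule inj_onI)
      fix a a' assume a: "a \<in> idx n" "a' \<in> idx n" "cell n a = cell n a'"
      then have "pt a \<in> cell n a'"
        using pt_in_cell by blast
      then show "a = a'"
        using a by (simp add: mem_cell_iff resid_pt)
    qed
    have t: "t (cell n a) = pt a" if "a \<in> idx n" for a
      using that inj by (simp add: t_def the_inv_into_f_f)
    have "vabs ((\<Sum>C\<in>cell n ` idx n. \<mu> C * g (t C)) - I) < e"
    proof (rule dP[THEN spec, THEN spec, THEN mp], intro conjI)
      show "partition_on OF (cell n ` idx n)"
      proof (rule partition_onI)
        show "\<Union> (cell n ` idx n) = OF"
          using clopen_partition_cell[of n] by (simp add: clopen_partition_def)
        show "{} \<notin> cell n ` idx n"
          using pt_in_cell[of _ n] by blast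
        fix C D assume "C \<in> cell n ` idx n" "D \<in> cell n ` idx n" "C \<noteq> D"
        then show "disjnt C D"
          using clopen_partition_cell[of n]
          by (fastforce simp: clopen_partition_def disjoint_family_on_def disjnt_def)
      qed
      have "vabs (x - y) < d" if "x \<in> cell n a" "y \<in> cell n a" for x y a
        using cell_diam[OF that] N p_power_decreasing[OF \<open>n \<ge> N\<close>] by linarith
      then show "\<forall>C\<in>cell n ` idx n. clopen_in OF C \<and> t C \<in> C \<and> (\<forall>x\<in>C. \<forall>y\<in>C. vabs (x - y) < d)"
        using clopen_cell pt_in_cell t by auto
    qed (simp add: finite_idx)
    then show ?thesis
      by (simp add: sum.reindex[OF inj] t)
  qed
  then show "\<exists>N. \<forall>n\<ge>N. vabs ((\<Sum>a\<in>idx n. \<mu> (cell n a) * g (pt a)) - I) < e"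
    by blast
qed

text \<open>The sums over cells of level m no longer change once m is at least \<open>n\<close>, so
  the limit is the sum of level \<open>n\<close>.\<close>

lemma integral_locally_constant:
  assumes \<mu>: "\<mu> \<in> int_measures F" and I: "has_measure_integral F \<mu> g I"
    and g: "\<And>x y. x \<in> OF \<Longrightarrow> y \<in> OF \<Longrightarrow> vabs (x - y) \<le> 1 / real p ^ n \<Longrightarrow> g x = g y"
  shows "I = (\<Sum>a\<in>idx n. \<mu> (cell n a) * g (pt a))"
proof -
  have const: "(\<Sum>a\<in>idx m. \<mu> (cell m a) * g (pt a)) = (\<Sum>a\<in>idx n. \<mu> (cell n a) * g (pt a))" if "m \<ge> n" for m
  proof -
    have "vabs ((\<Sum>a\<in>idx m. \<mu> (cell m a) * g (pt a)) - (\<Sum>a\<in>idx n. \<mu> (cell n a) * g (pt a))) \<le> 0"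
    proof (rule Riemann_sums_near[OF \<mu> clopen_partition_cell clopen_partition_cell])
      fix a a' assume "cell m a \<inter> cell n a' \<noteq> {}"
      then obtain x where x: "x \<in> cell m a" "x \<in> cell n a'"
        by auto
      then have "vabs (x - pt a) \<le> 1 / real p ^ n" "vabs (x - pt a') \<le> 1 / real p ^ n"
        using p_power_decreasing[OF that] by (auto simp: cell_def)
      then have "g x = g (pt a)" "g x = g (pt a')"
        using x by (auto intro!: g pt_OF simp: cell_def)
      then show "\<mu> (cell m a \<inter> cell n a') = 0 \<or> vabs (g (pt a) - g (pt a')) \<le> 0"
        by simp
    qed simp
    then show ?thesis
      using vabs_nonneg[of "(\<Sum>a\<in>idx m. \<mu> (cell m a) * g (pt a)) - (\<Sum>a\<in>idx n. \<mu> (cell n a) * g (pt a))"]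
      by (simp add: vabs_eq_0)
  qed
  have "(\<lambda>m. \<Sum>a\<in>idx m. \<mu> (cell m a) * g (pt a)) \<longlonglongrightarrow> (\<Sum>a\<in>idx n. \<mu> (cell n a) * g (pt a))"
    by (rule tendsto_eventually[OF eventually_sequentiallyI]) (rule const)
  then show ?thesis
    using Riemann_sum_cells_tendsto[OF I] by (rule LIMSEQ_unique[rotated])
qed

end

section \<open>Locally analytic characters\<close>

context padic_extension
begin

context
  fixes \<psi> :: "'c \<Rightarrow> 'c"
  assumes \<psi>: "\<psi> \<in> char_variety F"
begin

lemma char_nonzero: "x \<in> OF \<Longrightarrow> \<psi> x \<noteq> 0"
  and char_add: "x \<in> OF \<Longrightarrow> y \<in> OF \<Longrightarrow> \<psi> (x + y) = \<psi> x * \<psi> y"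
  and char_locally_analytic: "locally_analytic F \<psi>"
  using \<psi> by (auto simp: char_variety_def)

lemma char_0: "\<psi> 0 = 1"
  using char_add[of 0 0] char_nonzero[of 0] subfield by (simp add: int_ring_intros)

lemma char_diff: "x \<in> OF \<Longrightarrow> y \<in> OF \<Longrightarrow> \<psi> x = \<psi> (x - y) * \<psi> y"
  using char_add[of "x - y" y] subfield by (simp add: int_ring_intros)

lemma char_of_nat_mult: "x \<in> OF \<Longrightarrow> \<psi> (of_nat k * x) = \<psi> x ^ k"
proof (induction k)
  case (Suc k)
  then show ?case
    using char_add[of x "of_nat k * x"] subfield by (simp add: ring_distribs int_ring_intros)
qed (simp add: char_0)

lemma char_sum: "(\<And>i. i \<in> A \<Longrightarrow> f i \<in> OF) \<Longrightarrow> \<psi> (\<Sum>i\<in>A. f i) = (\<Prod>i\<in>A. \<psi> (f i))"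
  using subfield
  by (induction A rule: infinite_finite_induct) (auto simp: char_0 char_add int_ring_intros)

lemma char_power_series:
  "\<exists>N c. c 0 = 1 \<and> (\<forall>x\<in>OF. vabs x \<le> 1 / real p ^ N \<longrightarrow> (\<lambda>n. c n * x ^ n) sums \<psi> x)"
proof -
  have 0: "0 \<in> OF"
    using subfield by (rule zero_in_int_ring)
  then obtain r c where r: "r > 0" "\<And>x. x \<in> OF \<Longrightarrow> vabs (x - 0) \<le> r \<Longrightarrow> (\<lambda>n. c n * (x - 0) ^ n) sums \<psi> x"
    using char_locally_analytic unfolding locally_analytic_def by metis
  obtain N where N: "1 / real p ^ N < r"
    using ex_p_power_less[OF r(1)] by blast
  have "(\<lambda>n. c n * 0 ^ n) sums \<psi> 0"
    using r(2)[OF 0] r(1) by simp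
  moreover have "(\<lambda>n. c n * 0 ^ n) sums c 0"
    using sums_single[of 0 c] by (rule back_subst[of "\<lambda>f. f sums c 0"]) (auto simp: fun_eq_iff power_0_left)
  ultimately have "c 0 = 1"
    using char_0 sums_unique2 by metis
  moreover have "(\<lambda>n. c n * x ^ n) sums \<psi> x" if "x \<in> OF" "vabs x \<le> 1 / real p ^ N" for x
    using r(2)[of x] that N by simp
  ultimately show ?thesis
    by blast
qed

lemma char_near_1:
  assumes "e > 0"
  shows "\<exists>m. \<forall>x\<in>OF. vabs x \<le> 1 / real p ^ m \<longrightarrow> vabs (\<psi> x - 1) \<le> e"
proof -
  obtain N c where c: "c 0 = 1" "\<And>x. x \<in> OF \<Longrightarrow> vabs x \<le> 1 / real p ^ N \<Longrightarrow> (\<lambda>n. c n * x ^ n) sums \<psi> x"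
    using char_power_series by blast
  \<comment> \<open>A point of largest absolute value in the disc where the series is known to
    converge; the terms at it bound the coefficients.\<close>
  define y :: 'c where "y = of_nat p ^ N"
  have y: "y \<in> OF" "vabs y = 1 / real p ^ N" "vabs y > 0"
    using of_nat_in_int_ring[OF subfield, of "p ^ N"] p_power_pos(2)[of N]
    by (auto simp: y_def vabs_p_power)
  have "Bseq (\<lambda>n. vabs (c n * y ^ n))"
    using sums_imp_LIMSEQ_0[OF c(2)[OF y(1)]] y(2) unfolding LIMSEQ_vabs_0_iff
    by (intro convergent_imp_Bseq convergentI[of _ 0]) auto
  then obtain C where C: "C > 0" "\<And>n. vabs (c n * y ^ n) \<le> C"
    by (auto simp: Bseq_def abs_of_nonneg vabs_nonneg)
  have "min (vabs y) (e * vabs y / C) > 0"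
    using y C assms by simp
  then obtain m where m: "1 / real p ^ m < min (vabs y) (e * vabs y / C)"
    using ex_p_power_less by blast
  have "vabs (\<psi> x - 1) \<le> e" if x: "x \<in> OF" "vabs x \<le> 1 / real p ^ m" for x
  proof -
    have xy: "vabs x \<le> vabs y" "vabs x \<le> e * vabs y / C"
      using x m by auto
    have "(\<lambda>n. if n = 0 then 1 else 0) sums (1::'c)"
      using sums_single[of 0 "\<lambda>_. 1::'c"] by simp
    then have s: "(\<lambda>n. c n * x ^ n - (if n = 0 then 1 else 0)) sums (\<psi> x - 1)"
      using c(2)[OF x(1)] xy(1) y(2) by (intro nonarch_sums_diff) auto
    show ?thesis
    proof (rule sums_vabs_le[OF s])
      fix n
      show "vabs (c n * x ^ n - (if n = 0 then 1 else 0)) \<le> e"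
      proof (cases "n = 0")
        case False
        have q: "0 \<le> vabs x / vabs y" "vabs x / vabs y \<le> 1"
          using xy(1) y(3) by (auto simp: vabs_nonneg)
        have "c n * x ^ n = (c n * y ^ n) * (x / y) ^ n"
          using y by (auto simp: power_divide)
        then have "vabs (c n * x ^ n) = vabs (c n * y ^ n) * (vabs x / vabs y) ^ n"
          by (metis vabs_mult vabs_power vabs_divide)
        also have "\<dots> \<le> C * (vabs x / vabs y) ^ 1"
          using C False q by (intro mult_mono power_decreasing) (auto simp: vabs_nonneg)
        also have "\<dots> \<le> e"
          using xy(2) y(3) C(1) by (simp add: field_simps)
        finally show ?thesis
          using False by simp
      qed (use c assms in auto)
    qed (use assms in auto)
  qed
  then show ?thesis
    by blast
qed

text \<open>The power of \<psi> x with exponent p^m is \<psi> (p^m x), which for large m is close to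
  1 and so has absolute value 1.\<close>

lemma char_vabs:
  assumes x: "x \<in> OF"
  shows "vabs (\<psi> x) = 1"
proof -
  obtain m where m: "\<And>x. x \<in> OF \<Longrightarrow> vabs x \<le> 1 / real p ^ m \<Longrightarrow> vabs (\<psi> x - 1) \<le> 1 / 2"
    using char_near_1[of "1 / 2"] by auto
  let ?y = "of_nat (p ^ m) * x"
  have "vabs ?y \<le> 1 / real p ^ m * 1"
    unfolding of_nat_power vabs_mult vabs_p_power using x by (intro mult_left_mono) (auto simp: int_ring_def)
  then have "vabs (\<psi> ?y - 1) \<le> 1 / 2"
    using x subfield by (intro m int_ring_intros) auto
  then have "vabs (1 - \<psi> ?y) < vabs (1::'c)"
    by (simp add: vabs_commute)
  then have "vabs (\<psi> ?y) = 1"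
    using vabs_eq_of_near by fastforce
  then have "vabs (\<psi> x) ^ (p ^ m) = 1"
    by (simp only: char_of_nat_mult[OF x] vabs_power)
  then show ?thesis
    using power_eq_imp_eq_base[of "vabs (\<psi> x)" "p ^ m" 1] vabs_nonneg[of "\<psi> x"] p_power_pos(1)[of m] by simp
qed

text \<open>By the homomorphism property and |\<psi> y| = 1, closeness to 1 near 0 carries over to
  all points at once.\<close>

lemma char_uniformly_continuous:
  assumes "e > 0"
  shows "\<exists>m. \<forall>x\<in>OF. \<forall>y\<in>OF. vabs (x - y) \<le> 1 / real p ^ m \<longrightarrow> vabs (\<psi> x - \<psi> y) \<le> e"
proof -
  obtain m where m: "\<And>x. x \<in> OF \<Longrightarrow> vabs x \<le> 1 / real p ^ m \<Longrightarrow> vabs (\<psi> x - 1) \<le> e"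
    using char_near_1[OF assms] by auto
  have "vabs (\<psi> x - \<psi> y) \<le> e" if "x \<in> OF" "y \<in> OF" "vabs (x - y) \<le> 1 / real p ^ m" for x y
  proof -
    have "\<psi> x - \<psi> y = (\<psi> (x - y) - 1) * \<psi> y"
      using char_diff[OF that(1,2)] by (simp add: left_diff_distrib)
    then have "vabs (\<psi> x - \<psi> y) = vabs (\<psi> (x - y) - 1)"
      by (simp add: vabs_mult char_vabs[OF that(2)])
    also have "\<dots> \<le> e"
      using that subfield by (intro m int_ring_intros)
    finally show ?thesis .
  qed
  then show ?thesis
    by blast
qed

end

end

section \<open>The Iwasawa algebra consists of bounded functions\<close>

text \<open>Makes series with bounded coefficients converge on every closed polydisc of radius below
  1.\<close>

lemma finite_multi_index_weight_ge:
  fixes r e :: real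
  assumes "finite B" "0 \<le> r" "r < 1" "0 < e"
  shows "finite {\<alpha> \<in> B \<rightarrow>\<^sub>E (UNIV :: nat set). r ^ (\<Sum>b\<in>B. \<alpha> b) \<ge> e}"
proof -
  obtain M where M: "r ^ M < e"
    using real_arch_pow_inv[OF \<open>0 < e\<close> \<open>r < 1\<close>] by blast
  have "\<alpha> \<in> B \<rightarrow>\<^sub>E {..M}" if \<alpha>: "\<alpha> \<in> B \<rightarrow>\<^sub>E UNIV" "r ^ (\<Sum>b\<in>B. \<alpha> b) \<ge> e" for \<alpha>
  proof -
    have "\<alpha> b \<le> M" if "b \<in> B" for b
    proof (rule ccontr)
      assume "\<not> \<alpha> b \<le> M"
      then have "M \<le> (\<Sum>b\<in>B. \<alpha> b)"
        using member_le_sum[OF that, of \<alpha>] assms(1) by simp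
      then have "r ^ (\<Sum>b\<in>B. \<alpha> b) \<le> r ^ M"
        using assms by (intro power_decreasing) auto
      with M \<alpha>(2) show False
        by simp
    qed
    with \<alpha>(1) show ?thesis
      by (auto simp: PiE_def)
  qed
  then have "{\<alpha> \<in> B \<rightarrow>\<^sub>E UNIV. r ^ (\<Sum>b\<in>B. \<alpha> b) \<ge> e} \<subseteq> B \<rightarrow>\<^sub>E {..M}"
    by blast
  then show ?thesis
    by (rule finite_subset) (simp add: finite_PiE assms)
qed

context padic_field
begin

text \<open>Multiplication by k! turns each binomial coefficient into a product of k integer
  factors, and every factor moves by at most p^-n.\<close>

lemma vabs_binomial_diff_le:
  assumes "vabs (of_nat a - of_nat a' :: 'c) \<le> 1 / real p ^ n"
  shows "vabs (of_nat (a choose k) - of_nat (a' choose k) :: 'c) * vabs (fact k :: 'c) \<le> 1 / real p ^ n"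
proof -
  have *: "of_nat (a choose k) * fact k = (\<Prod>i = 0..<k. of_nat a - of_nat i :: 'c)" for a
    by (simp add: binomial_gbinomial gbinomial_prod_rev)
  have "vabs (of_nat a - of_nat i :: 'c) \<le> 1" for a i
    by (intro vabs_diff_le vabs_of_nat_le)
  then have "vabs ((\<Prod>i = 0..<k. of_nat a - of_nat i) - (\<Prod>i = 0..<k. of_nat a' - of_nat i) :: 'c) \<le> 1 / real p ^ n"
    using assms by (intro vabs_prod_diff_le) auto
  then show ?thesis
    by (simp add: * left_diff_distrib flip: vabs_mult)
qed

end

context padic_basis
begin

context
  fixes \<mu> :: "'c set \<Rightarrow> 'c"
  assumes \<mu>: "\<mu> \<in> int_measures F"
begin

text \<open>Riemann sum for the integral of a Mahler function, the product of binomial polynomials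
  in the coordinates. At \<open>pt a\<close> the coordinates are natural numbers, so ordinary
  binomial coefficients suffice; the limit \<open>mahler_coeff\<close> is the integral.\<close>

definition mahler_sum :: "nat \<Rightarrow> ('c \<Rightarrow> nat) \<Rightarrow> 'c" where
  "mahler_sum n \<alpha> = (\<Sum>a\<in>idx n. \<mu> (cell n a) * (\<Prod>b\<in>B. of_nat (a b choose \<alpha> b)))"

definition mahler_coeff :: "('c \<Rightarrow> nat) \<Rightarrow> 'c" where
  "mahler_coeff \<alpha> = lim (\<lambda>n. mahler_sum n \<alpha>)"

lemma vabs_sum_cells_le:
  assumes "\<And>a. a \<in> idx n \<Longrightarrow> vabs (u a) \<le> 1"
  shows "vabs (\<Sum>a\<in>idx n. \<mu> (cell n a) * u a) \<le> 1"
proof (rule vabs_sum_le)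
  fix a assume a: "a \<in> idx n"
  have "vabs (\<mu> (cell n a)) * vabs (u a) \<le> 1 * 1"
    by (intro mult_mono measure_vabs_le[OF \<mu>] clopen_cell a assms) (auto simp: vabs_nonneg)
  then show "vabs (\<mu> (cell n a) * u a) \<le> 1"
    by (simp add: vabs_mult)
qed simp

lemma vabs_prod_binomial_le: "vabs (\<Prod>b\<in>B. of_nat (a b choose \<alpha> b) :: 'c) \<le> 1"
  unfolding vabs_prod by (intro prod_le_1 conjI vabs_nonneg vabs_of_nat_le)

lemma mahler_sum_tendsto: "(\<lambda>n. mahler_sum n \<alpha>) \<longlonglongrightarrow> mahler_coeff \<alpha>"
proof -
  have "Cauchy (\<lambda>n. mahler_sum n \<alpha>)"
  proof (rule metric_CauchyI)
    fix e :: real assume "0 < e"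
    \<comment> \<open>The binomial polynomial of degree k has Lipschitz constant 1 / |k!|, so the
      level needed depends on \<alpha>.\<close>
    have "eventually (\<lambda>n. \<forall>b\<in>B. 1 / real p ^ n < e / 2 * vabs (fact (\<alpha> b) :: 'c)) sequentially"
      using finite_B \<open>0 < e\<close>
      by (intro eventually_ball_finite ballI order_tendstoD(2)[OF p_power_tendsto_0]) (auto intro!: vabs_pos mult_pos_pos)
    then obtain N where N: "\<And>b. b \<in> B \<Longrightarrow> 1 / real p ^ N < e / 2 * vabs (fact (\<alpha> b) :: 'c)"
      by (auto simp: eventually_sequentially)
    have "dist (mahler_sum m \<alpha>) (mahler_sum n \<alpha>) < e" if mn: "m \<ge> N" "n \<ge> N" for m n
    proof -
      have "vabs (mahler_sum m \<alpha> - mahler_sum n \<alpha>) \<le> e / 2"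
        unfolding mahler_sum_def
      proof (rule Riemann_sums_near[OF \<mu> clopen_partition_cell clopen_partition_cell])
        fix a a' assume "cell m a \<inter> cell n a' \<noteq> {}"
        then obtain x where "x \<in> cell m a" "x \<in> cell n a'"
          by auto
        then have "vabs (x - pt a) \<le> 1 / real p ^ N" "vabs (x - pt a') \<le> 1 / real p ^ N"
          using p_power_decreasing[OF mn(1)] p_power_decreasing[OF mn(2)] by (auto simp: cell_def)
        then have "vabs (pt a - pt a') \<le> 1 / real p ^ N"
          using vabs_triangle[of "pt a" "pt a'" x] by (simp add: vabs_commute[of "pt a" x])
        then have near: "vabs (of_nat (a b) - of_nat (a' b) :: 'c) \<le> 1 / real p ^ N" if "b \<in> B" for b
          using coord_near_iff[OF pt_OF pt_OF, of a a' N] coord_pt that by auto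
        have "vabs ((\<Prod>b\<in>B. of_nat (a b choose \<alpha> b)) - (\<Prod>b\<in>B. of_nat (a' b choose \<alpha> b)) :: 'c) \<le> e / 2"
        proof (rule vabs_prod_diff_le)
          fix b assume b: "b \<in> B"
          have "vabs (of_nat (a b choose \<alpha> b) - of_nat (a' b choose \<alpha> b) :: 'c) * vabs (fact (\<alpha> b) :: 'c) \<le> e / 2 * vabs (fact (\<alpha> b) :: 'c)"
            using vabs_binomial_diff_le[OF near[OF b], of "\<alpha> b"] N[OF b] by linarith
          then show "vabs (of_nat (a b choose \<alpha> b) - of_nat (a' b choose \<alpha> b) :: 'c) \<le> e / 2"
            by (rule mult_right_le_imp_le) (simp add: vabs_pos)
        qed (use \<open>0 < e\<close> in \<open>auto simp: vabs_of_nat_le\<close>)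
        then show "\<mu> (cell m a \<inter> cell n a') = 0 \<or>
            vabs ((\<Prod>b\<in>B. of_nat (a b choose \<alpha> b)) - (\<Prod>b\<in>B. of_nat (a' b choose \<alpha> b)) :: 'c) \<le> e / 2" ..
      qed (use \<open>0 < e\<close> in auto)
      then show ?thesis
        using \<open>0 < e\<close> by (simp add: dist_vabs)
    qed
    then show "\<exists>M. \<forall>m\<ge>M. \<forall>n\<ge>M. dist (mahler_sum m \<alpha>) (mahler_sum n \<alpha>) < e"
      by blast
  qed
  then show ?thesis
    unfolding mahler_coeff_def by (simp add: Cauchy_convergent_iff convergent_LIMSEQ_iff)
qed

lemma vabs_mahler_sum_le: "vabs (mahler_sum n \<alpha>) \<le> 1"
  unfolding mahler_sum_def by (intro vabs_sum_cells_le vabs_prod_binomial_le)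

lemma vabs_mahler_coeff_le: "vabs (mahler_coeff \<alpha>) \<le> 1"
  using mahler_sum_tendsto by (rule Lim_vabs_le[where N = 0]) (rule vabs_mahler_sum_le)

lemma mahler_coeff_in_F: "mahler_coeff \<alpha> \<in> F"
proof -
  have "\<mu> (cell n a) \<in> F" if "a \<in> idx n" for a n
    using measure_int_ring[OF \<mu> clopen_cell[OF that]] by (simp add: int_ring_def)
  then have "mahler_sum n \<alpha> \<in> F" for n
    unfolding mahler_sum_def using subfield by (intro subfield_intros) auto
  then show ?thesis
    by (rule closed_sequentially[OF closed_F _ mahler_sum_tendsto])
qed

text \<open>A binomial coefficient with upper entry below p^n and lower entry at least p^n vanishes;
  so each level involves finitely many degrees.\<close>

lemma mahler_sum_eq_0:
  assumes "\<alpha> \<in> B \<rightarrow>\<^sub>E UNIV" "\<alpha> \<notin> idx n"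
  shows "mahler_sum n \<alpha> = 0"
proof -
  obtain b where b: "b \<in> B" "\<not> \<alpha> b < p ^ n"
    using assms by (auto simp: idx_def PiE_iff)
  have "(\<Prod>b\<in>B. of_nat (a b choose \<alpha> b) :: 'c) = 0" if "a \<in> idx n" for a
    using idxD[OF that b(1)] b finite_B by (intro prod_zero bexI[of _ b]) auto
  then show ?thesis
    by (simp add: mahler_sum_def)
qed

lemma mahler_coeff_tate:
  assumes "0 < r" "r < 1"
  shows "mahler_coeff \<in> tate_series F B r"
  unfolding tate_series_def
proof (intro CollectI conjI ballI allI impI mahler_coeff_in_F)
  fix e :: real assume "e > 0"
  have "vabs (mahler_coeff \<alpha>) * r ^ (\<Sum>b\<in>B. \<alpha> b) \<le> 1 * r ^ (\<Sum>b\<in>B. \<alpha> b)" for \<alpha>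
    using assms by (intro mult_right_mono vabs_mahler_coeff_le) auto
  then have "{\<alpha> \<in> B \<rightarrow>\<^sub>E UNIV. vabs (mahler_coeff \<alpha>) * r ^ (\<Sum>b\<in>B. \<alpha> b) \<ge> e}
      \<subseteq> {\<alpha> \<in> B \<rightarrow>\<^sub>E UNIV. r ^ (\<Sum>b\<in>B. \<alpha> b) \<ge> e}"
    by (auto intro: order_trans)
  then show "finite {\<alpha> \<in> B \<rightarrow>\<^sub>E UNIV. vabs (mahler_coeff \<alpha>) * r ^ (\<Sum>b\<in>B. \<alpha> b) \<ge> e}"
    using finite_multi_index_weight_ge[of B r e] assms \<open>e > 0\<close> finite_B by (meson finite_subset less_imp_le)
qed

lemma char_pt:
  assumes "\<psi> \<in> char_variety F"
  shows "\<psi> (pt a) = (\<Prod>b\<in>B. \<psi> b ^ a b)"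
proof -
  have b: "of_nat (a b) * b \<in> OF" "b \<in> OF" if "b \<in> B" for b
    using that B_subset subfield by (auto intro!: int_ring_intros)
  then have "\<psi> (pt a) = (\<Prod>b\<in>B. \<psi> (of_nat (a b) * b))"
    unfolding pt_def by (intro char_sum[OF assms])
  also have "\<dots> = (\<Prod>b\<in>B. \<psi> b ^ a b)"
    by (intro prod.cong refl char_of_nat_mult[OF assms] b)
  finally show ?thesis .
qed

text \<open>Each power of \<psi> b is expanded by the binomial theorem in \<psi> b - 1; the product
  over the basis is multiplied out and the two sums are exchanged.\<close>

lemma Riemann_sum_eq_mahler:
  assumes \<psi>: "\<psi> \<in> char_variety F"
  shows "(\<Sum>a\<in>idx n. \<mu> (cell n a) * \<psi> (pt a)) = (\<Sum>\<alpha>\<in>idx n. mahler_sum n \<alpha> * (\<Prod>b\<in>B. (\<psi> b - 1) ^ \<alpha> b))"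
proof -
  have "\<psi> (pt a) = (\<Sum>\<alpha>\<in>idx n. (\<Prod>b\<in>B. of_nat (a b choose \<alpha> b)) * (\<Prod>b\<in>B. (\<psi> b - 1) ^ \<alpha> b))"
    if a: "a \<in> idx n" for a
  proof -
    have "\<psi> b ^ a b = (\<Sum>k\<in>{..<p ^ n}. of_nat (a b choose k) * (\<psi> b - 1) ^ k)" if b: "b \<in> B" for b
    proof -
      have "\<psi> b ^ a b = ((\<psi> b - 1) + 1) ^ a b"
        by simp
      also have "\<dots> = (\<Sum>k\<le>a b. of_nat (a b choose k) * (\<psi> b - 1) ^ k)"
        by (simp only: binomial_ring power_one mult_1_right)
      also have "\<dots> = (\<Sum>k\<in>{..<p ^ n}. of_nat (a b choose k) * (\<psi> b - 1) ^ k)"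
        using idxD[OF a b] by (intro sum.mono_neutral_left) auto
      finally show ?thesis .
    qed
    then have "\<psi> (pt a) = (\<Prod>b\<in>B. \<Sum>k\<in>{..<p ^ n}. of_nat (a b choose k) * (\<psi> b - 1) ^ k)"
      unfolding char_pt[OF \<psi>] by (intro prod.cong refl)
    also have "\<dots> = (\<Sum>\<alpha>\<in>idx n. \<Prod>b\<in>B. of_nat (a b choose \<alpha> b) * (\<psi> b - 1) ^ \<alpha> b)"
      unfolding idx_def by (rule prod_sum_PiE) (auto simp: finite_B)
    finally show ?thesis
      by (simp add: prod.distrib)
  qed
  then have "(\<Sum>a\<in>idx n. \<mu> (cell n a) * \<psi> (pt a)) =
      (\<Sum>a\<in>idx n. \<Sum>\<alpha>\<in>idx n. \<mu> (cell n a) * (\<Prod>b\<in>B. of_nat (a b choose \<alpha> b)) * (\<Prod>b\<in>B. (\<psi> b - 1) ^ \<alpha> b))"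
    by (simp add: sum_distrib_left mult.assoc)
  also have "\<dots> = (\<Sum>\<alpha>\<in>idx n. \<Sum>a\<in>idx n. \<mu> (cell n a) * (\<Prod>b\<in>B. of_nat (a b choose \<alpha> b)) * (\<Prod>b\<in>B. (\<psi> b - 1) ^ \<alpha> b))"
    by (rule sum.swap)
  finally show ?thesis
    by (simp add: mahler_sum_def sum_distrib_right)
qed

text \<open>The limit over the levels is exchanged with the sum over the degrees: outside the finite
  set \<open>S0\<close> the monomials are small, while the Mahler sums are bounded by 1 at every
  level.\<close>

lemma mahler_expansion:
  assumes \<psi>: "\<psi> \<in> char_variety F" and I: "has_measure_integral F \<mu> \<psi> I"
    and r: "0 < r" "r < 1" and z: "\<And>b. b \<in> B \<Longrightarrow> vabs (\<psi> b - 1) \<le> r"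
  shows "((\<lambda>\<alpha>. mahler_coeff \<alpha> * (\<Prod>b\<in>B. (\<psi> b - 1) ^ \<alpha> b)) has_sum I) (B \<rightarrow>\<^sub>E UNIV)"
  unfolding has_sum_def tendsto_vabs_iff
proof (intro allI impI)
  fix e :: real assume e: "e > 0"
  define T where "T \<alpha> = (\<Prod>b\<in>B. (\<psi> b - 1) ^ \<alpha> b)" for \<alpha>
  have T: "vabs (T \<alpha>) \<le> r ^ (\<Sum>b\<in>B. \<alpha> b)" for \<alpha>
    unfolding T_def vabs_prod vabs_power power_sum
    by (intro prod_mono conjI zero_le_power vabs_nonneg power_mono z)
  have T1: "vabs (T \<alpha>) \<le> 1" for \<alpha>
    using r by (intro order_trans[OF T] power_le_one) auto
  define S0 where "S0 = {\<alpha> \<in> B \<rightarrow>\<^sub>E (UNIV :: nat set). r ^ (\<Sum>b\<in>B. \<alpha> b) \<ge> e / 2}"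
  have "finite S0"
    unfolding S0_def using r e by (intro finite_multi_index_weight_ge finite_B) auto
  have near: "vabs ((\<Sum>\<alpha>\<in>Y. mahler_coeff \<alpha> * T \<alpha>) - I) < e"
    if Y: "finite Y" "S0 \<subseteq> Y" "Y \<subseteq> B \<rightarrow>\<^sub>E UNIV" for Y
  proof -
    have "eventually (\<lambda>n. vabs (mahler_sum n \<alpha> - mahler_coeff \<alpha>) < e / 2) sequentially" for \<alpha>
      using mahler_sum_tendsto half_gt_zero[OF e] unfolding tendsto_vabs_iff by blast
    then have "eventually (\<lambda>n. \<forall>\<alpha>\<in>Y. vabs (mahler_sum n \<alpha> - mahler_coeff \<alpha>) < e / 2) sequentially"
      by (intro eventually_ball_finite Y ballI)
    moreover have "eventually (\<lambda>n. vabs ((\<Sum>a\<in>idx n. \<mu> (cell n a) * \<psi> (pt a)) - I) < e / 2) sequentially"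
      using Riemann_sum_cells_tendsto[OF I] half_gt_zero[OF e] unfolding tendsto_vabs_iff by blast
    ultimately have "eventually (\<lambda>n. (\<forall>\<alpha>\<in>Y. vabs (mahler_sum n \<alpha> - mahler_coeff \<alpha>) < e / 2) \<and>
        vabs ((\<Sum>a\<in>idx n. \<mu> (cell n a) * \<psi> (pt a)) - I) < e / 2) sequentially"
      by (rule eventually_conj)
    then obtain n where n: "\<And>\<alpha>. \<alpha> \<in> Y \<Longrightarrow> vabs (mahler_sum n \<alpha> - mahler_coeff \<alpha>) < e / 2"
        "vabs ((\<Sum>a\<in>idx n. \<mu> (cell n a) * \<psi> (pt a)) - I) < e / 2"
      unfolding eventually_sequentially by blast
    have "(\<Sum>a\<in>idx n. \<mu> (cell n a) * \<psi> (pt a)) = (\<Sum>\<alpha>\<in>idx n. mahler_sum n \<alpha> * T \<alpha>)"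
      unfolding T_def by (rule Riemann_sum_eq_mahler[OF \<psi>])
    also have "\<dots> = (\<Sum>\<alpha>\<in>Y \<union> (idx n - Y). mahler_sum n \<alpha> * T \<alpha>)"
      using Y mahler_sum_eq_0[of _ n] finite_idx by (intro sum.mono_neutral_left) auto
    also have "\<dots> = (\<Sum>\<alpha>\<in>Y. mahler_sum n \<alpha> * T \<alpha>) + (\<Sum>\<alpha>\<in>idx n - Y. mahler_sum n \<alpha> * T \<alpha>)"
      using Y finite_idx by (intro sum.union_disjoint) auto
    finally have R: "(\<Sum>a\<in>idx n. \<mu> (cell n a) * \<psi> (pt a)) - (\<Sum>\<alpha>\<in>Y. mahler_coeff \<alpha> * T \<alpha>) =
        (\<Sum>\<alpha>\<in>Y. (mahler_sum n \<alpha> - mahler_coeff \<alpha>) * T \<alpha>) + (\<Sum>\<alpha>\<in>idx n - Y. mahler_sum n \<alpha> * T \<alpha>)"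
      by (simp add: left_diff_distrib sum_subtractf)
    have "vabs (\<Sum>\<alpha>\<in>Y. (mahler_sum n \<alpha> - mahler_coeff \<alpha>) * T \<alpha>) \<le> e / 2"
    proof (rule vabs_sum_le)
      fix \<alpha> assume "\<alpha> \<in> Y"
      then have "vabs (mahler_sum n \<alpha> - mahler_coeff \<alpha>) * vabs (T \<alpha>) \<le> e / 2 * 1"
        using e by (intro mult_mono T1 less_imp_le[OF n(1)]) (auto simp: vabs_nonneg)
      then show "vabs ((mahler_sum n \<alpha> - mahler_coeff \<alpha>) * T \<alpha>) \<le> e / 2"
        by (simp add: vabs_mult)
    qed (use e in simp)
    moreover have "vabs (\<Sum>\<alpha>\<in>idx n - Y. mahler_sum n \<alpha> * T \<alpha>) \<le> e / 2"
    proof (rule vabs_sum_le)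
      fix \<alpha> assume "\<alpha> \<in> idx n - Y"
      then have "r ^ (\<Sum>b\<in>B. \<alpha> b) \<le> e / 2"
        using Y(2) by (auto simp: S0_def idx_def)
      then have "vabs (mahler_sum n \<alpha>) * vabs (T \<alpha>) \<le> 1 * (e / 2)"
        using T[of \<alpha>] by (intro mult_mono vabs_mahler_sum_le) (auto simp: vabs_nonneg)
      then show "vabs (mahler_sum n \<alpha> * T \<alpha>) \<le> e / 2"
        by (simp add: vabs_mult)
    qed (use e in simp)
    ultimately have "vabs ((\<Sum>a\<in>idx n. \<mu> (cell n a) * \<psi> (pt a)) - (\<Sum>\<alpha>\<in>Y. mahler_coeff \<alpha> * T \<alpha>)) \<le> e / 2"
      unfolding R by (rule vabs_add_le)
    then show ?thesis
      using n(2) e vabs_triangle[of "\<Sum>\<alpha>\<in>Y. mahler_coeff \<alpha> * T \<alpha>" I "\<Sum>a\<in>idx n. \<mu> (cell n a) * \<psi> (pt a)"]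
      by (simp add: vabs_commute[of "\<Sum>\<alpha>\<in>Y. mahler_coeff \<alpha> * T \<alpha>"])
  qed
  show "eventually (\<lambda>Y. vabs ((\<Sum>\<alpha>\<in>Y. mahler_coeff \<alpha> * (\<Prod>b\<in>B. (\<psi> b - 1) ^ \<alpha> b)) - I) < e)
      (finite_subsets_at_top (B \<rightarrow>\<^sub>E UNIV))"
    unfolding eventually_finite_subsets_at_top T_def[symmetric]
    using near \<open>finite S0\<close> by (intro exI[of _ S0]) (auto simp: S0_def)
qed

end

lemma iwasawa_subset_bounded: "iwasawa_algebra F \<subseteq> bounded_functions F"
proof
  fix f assume "f \<in> iwasawa_algebra F"
  then obtain \<mu> where f: "f \<in> extensional (char_variety F)" and \<mu>: "\<mu> \<in> int_measures F"
    and I: "\<And>\<psi>. \<psi> \<in> char_variety F \<Longrightarrow> has_measure_integral F \<mu> \<psi> (f \<psi>)"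
    by (auto simp: iwasawa_algebra_def)
  have "f \<in> rigid_functions F"
    unfolding rigid_functions_def
  proof (intro CollectI conjI f exI[of _ B] basis allI impI)
    fix r :: real assume r: "0 < r \<and> r < 1"
    show "\<exists>c\<in>tate_series F B r. \<forall>\<psi>\<in>char_variety F. (\<forall>b\<in>B. vabs (\<psi> b - 1) \<le> r) \<longrightarrow>
        ((\<lambda>\<alpha>. c \<alpha> * (\<Prod>b\<in>B. (\<psi> b - 1) ^ \<alpha> b)) has_sum f \<psi>) (B \<rightarrow>\<^sub>E UNIV)"
      \<comment> \<open>One series, the Mahler expansion, serves for all radii.\<close>
      using r by (intro bexI[OF _ mahler_coeff_tate[OF \<mu>]] ballI impI mahler_expansion[OF \<mu>] I) auto
  qed
  moreover have "vabs (f \<psi>) \<le> 1" if \<psi>: "\<psi> \<in> char_variety F" for \<psi>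
    using Riemann_sum_cells_tendsto[OF I[OF \<psi>]]
  proof (rule Lim_vabs_le[where N = 0])
    fix n
    show "vabs (\<Sum>a\<in>idx n. \<mu> (cell n a) * \<psi> (pt a)) \<le> 1"
      by (intro vabs_sum_cells_le[OF \<mu>]) (simp add: char_vabs[OF \<psi> pt_OF])
  qed
  ultimately show "f \<in> bounded_functions F"
    by (simp add: bounded_functions_def)
qed

end

section \<open>Fourier inversion with characters of finite order\<close>

lemma alg_closed_nth_root:
  assumes "n > 0"
  shows "\<exists>x. x ^ n = (a :: 'a::alg_closed_field)"
proof -
  let ?f = "\<lambda>k. if k = 0 then - a else if k = n then 1 else 0"
  obtain x where "(\<Sum>k\<le>n. ?f k * x ^ k) = 0"
    using alg_closed[of n ?f] assms by auto
  moreover have "(\<Sum>k\<le>n. ?f k * x ^ k) = (\<Sum>k\<in>{0, n}. ?f k * x ^ k)"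
    by (rule sum.mono_neutral_right) auto
  ultimately show ?thesis
    using assms by auto
qed

section \<open>Roots of unity of p-power order\<close>

context padic_field
begin

text \<open>Here \<open>n\<close> is an exponent: the order is p^n. Exactness is stated as
  injectivity of the powers below p^n, the form that orthogonality uses.\<close>

definition primitive_root_of_unity :: "nat \<Rightarrow> 'c \<Rightarrow> bool" where
  "primitive_root_of_unity n z \<longleftrightarrow> z ^ (p ^ n) = 1 \<and> (\<forall>j<p ^ n. \<forall>k<p ^ n. z ^ j = z ^ k \<longrightarrow> j = k)"

text \<open>With w a root of 1 + X + ... + X^(p-1) and n = m + 1, z is a root of w of degree p^m. If
  z^d = 1 with 0 < d < p^n, the gcd of d and p^n is some p^k with k < n, and z^(p^k) = 1 would give
  w = 1.\<close>

lemma ex_primitive_root_of_unity: "\<exists>z. primitive_root_of_unity n z"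
proof (cases n)
  case 0
  then show ?thesis
    by (intro exI[of _ 1]) (simp add: primitive_root_of_unity_def)
next
  case (Suc m)
  obtain w :: 'c where w: "(\<Sum>k\<le>p - 1. w ^ k) = 0"
    using alg_closed[of "p - 1" "\<lambda>_. 1"] p_gt_1 by auto
  moreover have "{..p - 1} = {..<p}"
    using p_gt_1 by auto
  ultimately have "w ^ p = 1"
    using power_diff_1_eq[of w p] by simp
  have "w \<noteq> 1"
  proof
    assume "w = 1"
    then have "of_nat (Suc (p - 1)) = (0::'c)"
      using w by simp
    then show False
      by (simp only: of_nat_eq_0_iff)
  qed
  obtain z where z: "z ^ (p ^ m) = w"
    using alg_closed_nth_root[OF p_power_pos(1)[of m], of w] by blast
  have zn: "z ^ (p ^ n) = 1"
    using \<open>w ^ p = 1\<close> z Suc by (metis power_Suc2 power_mult)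
  have z0: "z \<noteq> 0"
    using zn p_power_pos(1)[of n] by (metis power_0_left zero_neq_one less_irrefl)
  have *: "z ^ d \<noteq> 1" if d: "0 < d" "d < p ^ n" for d
  proof
    assume zd: "z ^ d = 1"
    obtain k where k: "gcd d (p ^ n) = p ^ k" "k \<le> n"
      using divides_primepow_nat[OF prime_p, of "gcd d (p ^ n)" n] by auto
    have "p ^ k \<le> d"
      using gcd_le1_nat[of d "p ^ n"] d k by simp
    then have "k < n"
      using d p_gt_1 k(2) by (metis le_neq_implies_less not_le)
    obtain x y where "d * x = p ^ n * y + gcd d (p ^ n)"
      using bezout_nat[of d "p ^ n"] d by auto
    then have "z ^ (d * x) = z ^ (p ^ n * y + p ^ k)"
      using k by simp
    then have "z ^ (p ^ k) = 1"
      using zd zn by (simp add: power_add power_mult)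
    moreover have "p ^ m = p ^ k * p ^ (m - k)"
      using \<open>k < n\<close> Suc by (simp flip: power_add)
    ultimately have "w = 1"
      using z by (simp add: power_mult)
    with \<open>w \<noteq> 1\<close> show False ..
  qed
  have "j = k" if "z ^ j = z ^ k" "j \<le> k" "k < p ^ n" for j k
  proof (rule ccontr)
    assume "j \<noteq> k"
    have "z ^ k = z ^ (k - j) * z ^ j"
      using that(2) by (simp flip: power_add)
    then have "z ^ (k - j) = 1"
      using that(1) z0 by simp
    then show False
      using *[of "k - j"] that \<open>j \<noteq> k\<close> by simp
  qed
  then have "primitive_root_of_unity n z"
    unfolding primitive_root_of_unity_def using zn by (metis linear)
  then show ?thesis ..
qed

text \<open>The inner binomial coefficients of degree p are divisible by p, so (x - 1)^p differs
  from x^p - 1 by an element of absolute value below 1.\<close>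

lemma vabs_minus_1_less_1_if_power:
  assumes "vabs x \<le> 1" "vabs (x ^ p - 1) < 1"
  shows "vabs (x - 1 :: 'c) < 1"
proof -
  have "x ^ p = ((x - 1) + 1) ^ p"
    by simp
  also have "\<dots> = (\<Sum>k\<le>p. of_nat (p choose k) * (x - 1) ^ k)"
    by (simp only: binomial_ring power_one mult_1_right)
  also have "\<dots> = (x - 1) ^ p + (\<Sum>k<p. of_nat (p choose k) * (x - 1) ^ k)"
    by (simp add: lessThan_Suc_atMost[symmetric])
  also have "{..<p} = insert 0 {0<..<p}"
    using p_gt_1 by auto
  also have "(\<Sum>k\<in>insert 0 {0<..<p}. of_nat (p choose k) * (x - 1) ^ k) = 1 + (\<Sum>k\<in>{0<..<p}. of_nat (p choose k) * (x - 1) ^ k)"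
    by simp
  finally have eq: "(x - 1) ^ p = (x ^ p - 1) - (\<Sum>k\<in>{0<..<p}. of_nat (p choose k) * (x - 1) ^ k)"
    by simp
  have "vabs (\<Sum>k\<in>{0<..<p}. of_nat (p choose k) * (x - 1) ^ k) \<le> 1 / real p"
  proof (rule vabs_sum_le)
    fix k assume k: "k \<in> {0<..<p}"
    then have "p dvd p choose k"
      by (intro dvd_choose_prime prime_p) auto
    then have "vabs (of_nat (p choose k) :: 'c) \<le> 1 / real p"
      using vabs_of_nat_le_iff[of "p choose k" 1] by simp
    moreover have "vabs ((x - 1) ^ k) \<le> 1"
      unfolding vabs_power using assms(1) by (intro power_le_one vabs_nonneg vabs_diff_le) auto
    ultimately have "vabs (of_nat (p choose k) :: 'c) * vabs ((x - 1) ^ k) \<le> 1 / real p * 1"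
      by (intro mult_mono) (auto simp: vabs_nonneg)
    then show "vabs (of_nat (p choose k) * (x - 1) ^ k) \<le> 1 / real p"
      by (simp add: vabs_mult)
  qed simp
  moreover have "1 / real p < 1"
    using p_gt_1 by simp
  ultimately have "vabs (\<Sum>k\<in>{0<..<p}. of_nat (p choose k) * (x - 1) ^ k) < 1"
    by linarith
  with assms(2) have "vabs ((x - 1) ^ p) < 1"
    unfolding eq by (intro le_less_trans[OF vabs_diff]) simp
  then show ?thesis
    unfolding vabs_power by (metis not_le one_le_power)
qed

text \<open>Places the characters of finite order in the open unit polydisc, where rigid functions
  are given by power series.\<close>

lemma vabs_root_of_unity_minus_1:
  assumes "z ^ (p ^ n) = (1::'c)"
  shows "vabs (z - 1) < 1"
proof -
  have "vabs (z - 1) < 1" if "vabs z \<le> 1" "vabs (z ^ (p ^ n) - 1) < 1" for z :: 'c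
    using that
  proof (induction n arbitrary: z)
    case (Suc n)
    have "vabs (z ^ p) \<le> 1"
      unfolding vabs_power using Suc by (intro power_le_one vabs_nonneg)
    then have "vabs (z ^ p - 1) < 1"
      using Suc by (simp add: power_mult[symmetric])
    then show ?case
      by (rule vabs_minus_1_less_1_if_power[OF Suc.prems(1)])
  qed simp
  moreover have "vabs z ^ (p ^ n) = 1"
    using assms by (simp flip: vabs_power)
  then have "vabs z = 1"
    using power_eq_imp_eq_base[of "vabs z" "p ^ n" 1] vabs_nonneg[of z] p_power_pos(1)[of n] by simp
  ultimately show ?thesis
    using assms by simp
qed

context
  fixes n z
  assumes z: "primitive_root_of_unity n z"
begin

lemma root_power: "z ^ (p ^ n) = 1"
  using z by (simp add: primitive_root_of_unity_def)

lemma root_nonzero: "z \<noteq> 0"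
  using root_power p_power_pos(1)[of n] by (metis power_0_left zero_neq_one less_irrefl)

lemma root_power_mod: "z ^ (s * (k mod p ^ n)) = z ^ (s * k)"
proof -
  have "z ^ (s * k) = z ^ (s * (k mod p ^ n) + p ^ n * (s * (k div p ^ n)))"
    by (metis add_mult_distrib2 mod_mult_div_eq mult.left_commute)
  then show ?thesis
    by (simp add: power_add power_mult[of z "p ^ n"] root_power)
qed

text \<open>The sum is geometric with ratio w = z^(j - k), and w^(p^n) = 1, so it vanishes unless w
  = 1.\<close>

lemma root_orthogonality:
  assumes "k < p ^ n"
  shows "(\<Sum>s<p ^ n. inverse z ^ (s * k) * z ^ (s * j)) = (if j mod p ^ n = k then of_nat (p ^ n) else 0)"
proof -
  define w where "w = inverse (z ^ k) * z ^ j"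
  have w: "inverse z ^ (s * k) * z ^ (s * j) = w ^ s" for s
    by (simp add: w_def power_mult_distrib power_inverse mult.commute flip: power_mult)
  have wN: "w ^ (p ^ n) = 1"
    by (simp add: w_def power_mult_distrib power_inverse root_power flip: power_mult)
      (simp add: power_mult mult.commute[of _ "p ^ n"] root_power)
  have "w = 1 \<longleftrightarrow> z ^ j = z ^ k"
    unfolding w_def using root_nonzero by (simp add: field_simps)
  also have "z ^ j = z ^ (j mod p ^ n)"
    using root_power_mod[of 1 j] by simp
  also have "z ^ (j mod p ^ n) = z ^ k \<longleftrightarrow> j mod p ^ n = k"
    using z assms p_power_pos(1)[of n] unfolding primitive_root_of_unity_def by (metis mod_less_divisor)
  finally show ?thesis
    unfolding w using wN by (auto simp: geometric_sum)
qed

text \<open>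
  The sums \<open>\<Sum>\<^sub>s z\<^bsup>-sk\<^esup> (z\<^bsup>s\<^esup> - 1)\<^bsup>m\<^esup>\<close> are rational integers, which makes any Galois descent
  of the measure unnecessary.
\<close>

lemma root_sum_Ints:
  assumes "k < p ^ n"
  shows "(\<Sum>s<p ^ n. inverse z ^ (s * k) * (z ^ s - 1) ^ m) \<in> \<int>"
proof -
  have "(z ^ s - 1) ^ m = (\<Sum>j\<le>m. of_nat (m choose j) * (-1) ^ (m - j) * z ^ (s * j))" for s
    unfolding power_mult using binomial_ring[of "z ^ s" "- 1" m] by (simp add: mult_ac)
  then have "(\<Sum>s<p ^ n. inverse z ^ (s * k) * (z ^ s - 1) ^ m) =
      (\<Sum>s<p ^ n. \<Sum>j\<le>m. of_nat (m choose j) * (-1) ^ (m - j) * (inverse z ^ (s * k) * z ^ (s * j)))"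
    by (simp add: sum_distrib_left mult_ac)
  also have "\<dots> = (\<Sum>j\<le>m. \<Sum>s<p ^ n. of_nat (m choose j) * (-1) ^ (m - j) * (inverse z ^ (s * k) * z ^ (s * j)))"
    by (rule sum.swap)
  also have "\<dots> = (\<Sum>j\<le>m. of_nat (m choose j) * (-1) ^ (m - j) * (if j mod p ^ n = k then of_nat (p ^ n) else 0))"
    by (simp only: sum_distrib_left[symmetric] root_orthogonality[OF assms])
  also have "\<dots> \<in> \<int>"
    by (intro Ints_sum Ints_mult Ints_power) auto
  finally show ?thesis .
qed

end

end

lemma has_sum_sum_index:
  fixes g :: "'i \<Rightarrow> 'a \<Rightarrow> 'b::{topological_comm_monoid_add}"
  assumes "\<And>i. i \<in> I \<Longrightarrow> (g i has_sum x i) A"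
  shows "((\<lambda>a. \<Sum>i\<in>I. g i a) has_sum (\<Sum>i\<in>I. x i)) A"
  using assms by (induction I rule: infinite_finite_induct) (auto intro: has_sum_add)

section \<open>Characters of finite order and recovery of the measure\<close>

context padic_basis
begin

text \<open>The character modulo p^n with exponents \<open>s\<close> on the basis. Residues replace
  the p-adic coordinates so that only natural powers of \<open>z\<close> occur.\<close>

definition finite_char :: "nat \<Rightarrow> 'c \<Rightarrow> ('c \<Rightarrow> nat) \<Rightarrow> 'c \<Rightarrow> 'c" where
  "finite_char n z s = (\<lambda>x\<in>OF. \<Prod>b\<in>B. z ^ (s b * res n (coord x b)))"

context
  fixes n z
  assumes z: "primitive_root_of_unity n z"
begin

lemma finite_char_locally_constant:
  assumes "x \<in> OF" "y \<in> OF" "vabs (x - y) \<le> 1 / real p ^ n"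
  shows "finite_char n z s x = finite_char n z s y"
proof -
  have "res n (coord x b) = res n (coord y b)" if "b \<in> B" for b
  proof -
    have "resid n x b = resid n y b"
      using resid_eq_iff[OF assms(1,2), of n] assms(3) by simp
    then show ?thesis
      using that by (simp add: resid_def)
  qed
  then show ?thesis
    using assms by (simp add: finite_char_def)
qed

text \<open>Local analyticity over F comes from constancy on balls, although the coordinates are
  linear over the p-adic integers only; additivity survives the carries because \<open>z\<close> has
  order p^n.\<close>

lemma finite_char_in_char_variety: "finite_char n z s \<in> char_variety F"
  unfolding char_variety_def
proof (intro CollectI conjI ballI)
  show "finite_char n z s \<in> extensional OF"
    by (simp add: finite_char_def)
  show "finite_char n z s x \<noteq> 0" if "x \<in> OF" for x
    using that root_nonzero[OF z] finite_B by (simp add: finite_char_def)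
  show "finite_char n z s (x + y) = finite_char n z s x * finite_char n z s y"
    if "x \<in> OF" "y \<in> OF" for x y
  proof -
    have "z ^ (s b * res n (coord (x + y) b)) = z ^ (s b * res n (coord x b)) * z ^ (s b * res n (coord y b))"
      if b: "b \<in> B" for b
      unfolding coord_add[OF \<open>x \<in> OF\<close> \<open>y \<in> OF\<close> b]
        res_add[OF subfield_Qp coord_Zp[OF \<open>x \<in> OF\<close> b] coord_Zp[OF \<open>y \<in> OF\<close> b]] root_power_mod[OF z]
      by (simp add: ring_distribs power_add)
    then show ?thesis
      using that subfield by (simp add: finite_char_def int_ring_intros flip: prod.distrib)
  qed
  show "locally_analytic F (finite_char n z s)"
    unfolding locally_analytic_def
  proof (intro ballI exI conjI impI)
    fix a x assume a: "a \<in> OF" and x: "x \<in> OF" "vabs (x - a) \<le> 1 / real p ^ n"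
    let ?c = "\<lambda>k::nat. if k = 0 then finite_char n z s a else 0"
    have "(\<lambda>k. if k = 0 then finite_char n z s a else 0) sums finite_char n z s a"
      using sums_single[of 0 "\<lambda>_. finite_char n z s a"] by simp
    moreover have "(\<lambda>k. ?c k * (x - a) ^ k) = (\<lambda>k. if k = 0 then finite_char n z s a else 0)"
      by (auto simp: fun_eq_iff)
    ultimately show "(\<lambda>k. ?c k * (x - a) ^ k) sums finite_char n z s x"
      using finite_char_locally_constant[OF x(1) a x(2)] by simp
  qed (use p_power_pos in auto)
qed

lemma finite_char_pt: "finite_char n z s (pt a) = (\<Prod>b\<in>B. z ^ (s b * a b))"
proof -
  have "res n (of_nat k :: 'c) = k mod p ^ n" for k
  proof (rule res_eqI)
    have "(of_nat k - of_nat (k mod p ^ n) :: 'c) = of_nat (p ^ n * (k div p ^ n))"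
      by (metis add_diff_cancel_right' mult_div_mod_eq of_nat_add)
    then show "vabs (of_nat k - of_nat (k mod p ^ n) :: 'c) \<le> 1 / real p ^ n"
      by (simp only: vabs_of_nat_le_iff dvd_triv_left)
  qed (use p_power_pos in auto)
  then show ?thesis
    using pt_OF by (auto simp: finite_char_def coord_pt root_power_mod[OF z] intro!: prod.cong)
qed

lemma finite_char_basis:
  assumes "b \<in> B"
  shows "finite_char n z s b = z ^ s b"
proof -
  \<comment> \<open>A basis vector is \<open>pt\<close> of its own indicator function; as
    \<open>finite_char_pt\<close> admits labels outside \<open>idx n\<close>, the case n = 0 is
    covered.\<close>
  have "pt (\<lambda>b'. if b' = b then 1 else 0) = (\<Sum>b'\<in>B. if b' = b then b' else 0)"
    unfolding pt_def by (intro sum.cong) auto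
  then have "pt (\<lambda>b'. if b' = b then 1 else 0) = b"
    using assms finite_B by simp
  moreover have "(\<Prod>b'\<in>B. z ^ (s b' * (if b' = b then 1 else 0))) = (\<Prod>b'\<in>B. if b' = b then z ^ s b' else 1)"
    by (intro prod.cong) auto
  then have "(\<Prod>b'\<in>B. z ^ (s b' * (if b' = b then 1 else 0))) = z ^ s b"
    using assms finite_B by simp
  ultimately show ?thesis
    using finite_char_pt[of s "\<lambda>b'. if b' = b then 1 else 0"] by simp
qed

text \<open>The characters of level n take finitely many values on the basis, so one closed polydisc
  of radius below 1 contains them all. A single power series then serves for every \<open>s\<close>,
  as the inversion requires.\<close>

lemma finite_char_radius: "\<exists>r. 0 < r \<and> r < 1 \<and> (\<forall>s. \<forall>b\<in>B. vabs (finite_char n z s b - 1) \<le> r)"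
proof -
  let ?A = "(\<lambda>s. vabs (z ^ s - 1)) ` {..<p ^ n}"
  have fin: "finite (insert (1 / 2) ?A)"
    by simp
  \<comment> \<open>The entry 1/2 keeps \<open>r\<close> positive: for n = 0 all distances are
    0.\<close>
  define r where "r = Max (insert (1 / 2) ?A)"
  have "1 / 2 \<le> r"
    unfolding r_def by (intro Max_ge fin) simp
  moreover have "vabs (z ^ s - 1) < 1" for s
  proof (rule vabs_root_of_unity_minus_1)
    show "(z ^ s) ^ (p ^ n) = 1"
      using root_power[OF z] by (metis power_mult mult.commute power_one)
  qed
  then have "r < 1"
    unfolding r_def by (subst Max_less_iff[OF fin]) auto
  moreover have "vabs (finite_char n z s b - 1) \<le> r" if "b \<in> B" for s b
  proof -
    have "z ^ s b = z ^ (s b mod p ^ n)"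
      using root_power_mod[OF z, of 1 "s b"] by simp
    then have "vabs (finite_char n z s b - 1) \<in> ?A"
      unfolding finite_char_basis[OF that] using p_power_pos(1)[of n] by (intro image_eqI[of _ _ "s b mod p ^ n"]) auto
    then show ?thesis
      unfolding r_def using fin by (intro Max_ge) auto
  qed
  ultimately show ?thesis
    by (intro exI[of _ r]) auto
qed

text \<open>The sum over the multi-index \<open>s\<close> factors into one orthogonality sum for
  each basis vector; p^n to the power \<open>card B\<close> is the order of the group of
  classes.\<close>

lemma Fourier_inversion:
  assumes a: "a \<in> idx n"
  shows "(\<Sum>s\<in>idx n. (\<Prod>b\<in>B. inverse z ^ (s b * a b)) * (\<Sum>a'\<in>idx n. \<mu> a' * finite_char n z s (pt a'))) =
    of_nat (p ^ n) ^ card B * \<mu> a"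
proof -
  have orth: "(\<Sum>s\<in>idx n. (\<Prod>b\<in>B. inverse z ^ (s b * a b)) * finite_char n z s (pt a')) =
      (if a' = a then of_nat (p ^ n) ^ card B else 0)" if a': "a' \<in> idx n" for a'
  proof -
    have "(\<Sum>s\<in>idx n. (\<Prod>b\<in>B. inverse z ^ (s b * a b)) * finite_char n z s (pt a')) =
        (\<Sum>s\<in>idx n. \<Prod>b\<in>B. inverse z ^ (s b * a b) * z ^ (s b * a' b))"
      by (simp add: finite_char_pt prod.distrib)
    also have "\<dots> = (\<Prod>b\<in>B. \<Sum>s<p ^ n. inverse z ^ (s * a b) * z ^ (s * a' b))"
      unfolding idx_def by (rule prod_sum_PiE[symmetric]) (auto simp: finite_B)
    also have "\<dots> = (\<Prod>b\<in>B. if a' b = a b then of_nat (p ^ n) else 0)"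
      using idxD[OF a] idxD[OF a'] by (intro prod.cong refl) (simp add: root_orthogonality[OF z])
    also have "\<dots> = (if a' = a then of_nat (p ^ n) ^ card B else 0)"
    proof (cases "a' = a")
      case False
      then obtain b where "b \<in> B" "a' b \<noteq> a b"
        using a a' unfolding idx_def by (metis PiE_ext)
      then have "(\<Prod>b\<in>B. if a' b = a b then of_nat (p ^ n) else 0 :: 'c) = 0"
        using finite_B by (intro prod_zero bexI[of _ b]) auto
      with False show ?thesis
        by simp
    qed simp
    finally show ?thesis .
  qed
  have "(\<Sum>s\<in>idx n. (\<Prod>b\<in>B. inverse z ^ (s b * a b)) * (\<Sum>a'\<in>idx n. \<mu> a' * finite_char n z s (pt a'))) =
      (\<Sum>s\<in>idx n. \<Sum>a'\<in>idx n. \<mu> a' * ((\<Prod>b\<in>B. inverse z ^ (s b * a b)) * finite_char n z s (pt a')))"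
    by (simp add: sum_distrib_left mult.left_commute)
  also have "\<dots> = (\<Sum>a'\<in>idx n. \<Sum>s\<in>idx n. \<mu> a' * ((\<Prod>b\<in>B. inverse z ^ (s b * a b)) * finite_char n z s (pt a')))"
    by (rule sum.swap)
  also have "\<dots> = (\<Sum>a'\<in>idx n. \<mu> a' * (if a' = a then of_nat (p ^ n) ^ card B else 0))"
    by (intro sum.cong refl) (simp only: sum_distrib_left[symmetric] orth)
  also have "\<dots> = of_nat (p ^ n) ^ card B * \<mu> a"
    using a finite_idx by (simp add: if_distrib[of "\<lambda>x. _ * x"] cong: if_cong)
  finally show ?thesis .
qed

end

text \<open>The power series is inserted into the inversion formula. For fixed \<alpha> the sum over
  \<open>s\<close> factors over the basis, which isolates the integers of
  \<open>root_sum_Ints\<close>.\<close>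

lemma measure_cell_has_sum:
  assumes \<mu>: "\<mu> \<in> int_measures F" and z: "primitive_root_of_unity n z" and a: "a \<in> idx n"
    and I: "\<And>s. has_measure_integral F \<mu> (finite_char n z s) (I s)"
    and c: "\<And>s. ((\<lambda>\<alpha>. c \<alpha> * (\<Prod>b\<in>B. (finite_char n z s b - 1) ^ \<alpha> b)) has_sum I s) (B \<rightarrow>\<^sub>E UNIV)"
  shows "((\<lambda>\<alpha>. c \<alpha> * (\<Prod>b\<in>B. \<Sum>s<p ^ n. inverse z ^ (s * a b) * (z ^ s - 1) ^ \<alpha> b))
    has_sum (of_nat (p ^ n) ^ card B * \<mu> (cell n a))) (B \<rightarrow>\<^sub>E UNIV)"
proof -
  have I': "I s = (\<Sum>a\<in>idx n. \<mu> (cell n a) * finite_char n z s (pt a))" for s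
    by (rule integral_locally_constant[OF \<mu> I]) (rule finite_char_locally_constant[OF z])
  have "((\<lambda>\<alpha>. \<Sum>s\<in>idx n. (\<Prod>b\<in>B. inverse z ^ (s b * a b)) * (c \<alpha> * (\<Prod>b\<in>B. (finite_char n z s b - 1) ^ \<alpha> b)))
      has_sum (\<Sum>s\<in>idx n. (\<Prod>b\<in>B. inverse z ^ (s b * a b)) * I s)) (B \<rightarrow>\<^sub>E UNIV)"
    by (intro has_sum_sum_index has_sum_cmult_right c)
  moreover have "(\<Sum>s\<in>idx n. (\<Prod>b\<in>B. inverse z ^ (s b * a b)) * I s) = of_nat (p ^ n) ^ card B * \<mu> (cell n a)"
    unfolding I' by (rule Fourier_inversion[OF z a])
  moreover have "(\<Sum>s\<in>idx n. (\<Prod>b\<in>B. inverse z ^ (s b * a b)) * (c \<alpha> * (\<Prod>b\<in>B. (finite_char n z s b - 1) ^ \<alpha> b))) =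
      c \<alpha> * (\<Prod>b\<in>B. \<Sum>s<p ^ n. inverse z ^ (s * a b) * (z ^ s - 1) ^ \<alpha> b)" for \<alpha>
  proof -
    have "(\<Prod>b\<in>B. \<Sum>s<p ^ n. inverse z ^ (s * a b) * (z ^ s - 1) ^ \<alpha> b) =
        (\<Sum>s\<in>idx n. \<Prod>b\<in>B. inverse z ^ (s b * a b) * (z ^ s b - 1) ^ \<alpha> b)"
      unfolding idx_def by (rule prod_sum_PiE) (auto simp: finite_B)
    also have "\<dots> = (\<Sum>s\<in>idx n. (\<Prod>b\<in>B. inverse z ^ (s b * a b)) * (\<Prod>b\<in>B. (finite_char n z s b - 1) ^ \<alpha> b))"
      by (intro sum.cong refl) (simp add: prod.distrib finite_char_basis[OF z] cong: prod.cong)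
    finally show ?thesis
      by (simp add: sum_distrib_left mult.left_commute)
  qed
  ultimately show ?thesis
    by simp
qed

text \<open>The partial sums are integer combinations of the coefficients, so they lie in
  \<open>L\<close>; the limit does because \<open>L\<close> is closed, and the power of p can be
  divided out.\<close>

lemma measure_cell_in_subfield:
  assumes \<mu>: "\<mu> \<in> int_measures F" and z: "primitive_root_of_unity n z" and a: "a \<in> idx n"
    and I: "\<And>s. has_measure_integral F \<mu> (finite_char n z s) (I s)"
    and c: "\<And>s. ((\<lambda>\<alpha>. c \<alpha> * (\<Prod>b\<in>B. (finite_char n z s b - 1) ^ \<alpha> b)) has_sum I s) (B \<rightarrow>\<^sub>E UNIV)"
    and L: "is_subfield L" "closed L" and cL: "\<And>\<alpha>. \<alpha> \<in> B \<rightarrow>\<^sub>E UNIV \<Longrightarrow> c \<alpha> \<in> L"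
  shows "\<mu> (cell n a) \<in> L"
proof -
  define T where "T \<alpha> = c \<alpha> * (\<Prod>b\<in>B. \<Sum>s<p ^ n. inverse z ^ (s * a b) * (z ^ s - 1) ^ \<alpha> b)" for \<alpha>
  have TL: "T \<alpha> \<in> L" if "\<alpha> \<in> B \<rightarrow>\<^sub>E UNIV" for \<alpha>
  proof -
    have "(\<Prod>b\<in>B. \<Sum>s<p ^ n. inverse z ^ (s * a b) * (z ^ s - 1) ^ \<alpha> b) \<in> \<int>"
      by (intro Ints_prod root_sum_Ints[OF z] idxD[OF a])
    then have "(\<Prod>b\<in>B. \<Sum>s<p ^ n. inverse z ^ (s * a b) * (z ^ s - 1) ^ \<alpha> b) \<in> L"
      using L(1) by (auto elim!: Ints_cases simp: subfield_intros)
    then show ?thesis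
      using that cL L(1) by (simp add: T_def subfield_intros)
  qed
  have "(sum T \<longlongrightarrow> of_nat (p ^ n) ^ card B * \<mu> (cell n a)) (finite_subsets_at_top (B \<rightarrow>\<^sub>E UNIV))"
    using measure_cell_has_sum[OF \<mu> z a I c] unfolding T_def has_sum_def .
  moreover have "eventually (\<lambda>Y. sum T Y \<in> L) (finite_subsets_at_top (B \<rightarrow>\<^sub>E UNIV))"
    by (rule eventually_finite_subsets_at_top_weakI) (use TL L(1) in \<open>auto intro!: sum_in_subfield\<close>)
  ultimately have "of_nat (p ^ n) ^ card B * \<mu> (cell n a) \<in> L"
    by (intro Lim_in_closed_set[OF L(2)]) auto
  then have "(of_nat (p ^ n) ^ card B * \<mu> (cell n a)) / of_nat (p ^ n) ^ card B \<in> L"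
    using L(1) by (intro divide_in_subfield power_in_subfield of_nat_in_subfield)
  then show ?thesis
    using p_gt_1 by simp
qed

text \<open>In a term free of the variable \<open>b\<close> the factor at \<open>b\<close> is the
  sum of z^(-s * a b) over s, which vanishes because \<open>a b\<close> is nonzero and below
  p^n.\<close>

lemma measure_cell_eq_0:
  assumes \<mu>: "\<mu> \<in> int_measures F" and z: "primitive_root_of_unity n z" and a: "a \<in> idx n"
    and I: "\<And>s. has_measure_integral F \<mu> (finite_char n z s) (I s)"
    and c: "\<And>s. ((\<lambda>\<alpha>. c \<alpha> * (\<Prod>b\<in>B. (finite_char n z s b - 1) ^ \<alpha> b)) has_sum I s) (B \<rightarrow>\<^sub>E UNIV)"
    and b: "b \<in> B" "a b \<noteq> 0" and c0: "\<And>\<alpha>. \<alpha> \<in> B \<rightarrow>\<^sub>E UNIV \<Longrightarrow> \<alpha> b \<noteq> 0 \<Longrightarrow> c \<alpha> = 0"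
  shows "\<mu> (cell n a) = 0"
proof -
  define T where "T \<alpha> = c \<alpha> * (\<Prod>b\<in>B. \<Sum>s<p ^ n. inverse z ^ (s * a b) * (z ^ s - 1) ^ \<alpha> b)" for \<alpha>
  have T0: "T \<alpha> = 0" if "\<alpha> \<in> B \<rightarrow>\<^sub>E UNIV" for \<alpha>
  proof (cases "\<alpha> b = 0")
    case True
    have "(\<Sum>s<p ^ n. inverse z ^ (s * a b) * (z ^ s - 1) ^ \<alpha> b) = 0"
      using root_orthogonality[OF z idxD[OF a b(1)], of 0] b(2) True by simp
    then have "(\<Prod>b\<in>B. \<Sum>s<p ^ n. inverse z ^ (s * a b) * (z ^ s - 1) ^ \<alpha> b) = 0"
      using finite_B b(1) by (intro prod_zero bexI[of _ b])
    then show ?thesis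
      by (simp add: T_def)
  qed (use c0 that in \<open>simp add: T_def\<close>)
  have "(T has_sum (of_nat (p ^ n) ^ card B * \<mu> (cell n a))) (B \<rightarrow>\<^sub>E UNIV)"
    using measure_cell_has_sum[OF \<mu> z a I c] unfolding T_def .
  then have "of_nat (p ^ n) ^ card B * \<mu> (cell n a) = 0"
    using has_sum_0[of "B \<rightarrow>\<^sub>E UNIV" T] T0 has_sum_unique by blast
  then show ?thesis
    using p_gt_1 by simp
qed

end

section \<open>Extension of characters\<close>

context padic_field
begin

text \<open>An algebraically closed field has a divisible multiplicative group: a root of \<open>h 1\<close> determines \<open>W\<close>.\<close>

lemma Zp_hom_divide:
  assumes Qp: "is_subfield (Qp :: 'c set)"
    and h: "\<And>u v. u \<in> Zp \<Longrightarrow> v \<in> Zp \<Longrightarrow> h (u + v) = h u * h v" "\<And>u. u \<in> Zp \<Longrightarrow> h u \<noteq> (0::'c)"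
  shows "\<exists>W. (\<forall>u\<in>Zp. \<forall>v\<in>Zp. W (u + v) = W u * W v) \<and> (\<forall>u\<in>Zp. W u \<noteq> 0) \<and>
    (\<forall>v\<in>Zp. W (of_nat (p ^ N) * v) = h v)"
proof -
  let ?q = "of_nat (p ^ N) :: 'c"
  have q: "?q \<noteq> 0" "vabs ?q = 1 / real p ^ N"
    using p_gt_1 vabs_p_power[of N] by auto
  obtain w where w: "w ^ (p ^ N) = h 1"
    using alg_closed_nth_root[OF p_power_pos(1)[of N], of "h 1"] by blast
  have Z: "0 \<in> Zp" "1 \<in> Zp"
    using Qp by (auto simp: int_ring_def subfield_intros)
  have h0: "h 0 = 1"
    using h(1)[of 0 0] h(2)[of 0] Z by simp
  have w0: "w \<noteq> 0"
    using w h(2)[OF Z(2)] p_power_pos(1)[of N] by (metis power_0_left less_irrefl)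
  have rest: "(u - of_nat (res N u)) / ?q \<in> Zp" if u: "u \<in> Zp" for u
  proof -
    have "vabs (u - of_nat (res N u)) * real p ^ N \<le> 1"
      using res_near[OF u, of N] p_power_pos(2)[of N] by (simp add: field_simps)
    then show ?thesis
      using u Qp by (simp add: int_ring_def subfield_intros vabs_divide vabs_p_power)
  qed
  \<comment> \<open>Each element is its residue plus p^N times a quotient in \<open>Zp\<close>: the
    residue becomes an exponent of \<open>w\<close>, and \<open>h\<close> is applied to the
    quotient.\<close>
  define W where "W u = w ^ res N u * h ((u - of_nat (res N u)) / ?q)" for u
  have W_add: "W (u + v) = W u * W v" if u: "u \<in> Zp" and v: "v \<in> Zp" for u v
  proof -
    define k where "k = res N u + res N v"
    have r: "res N (u + v) = k mod p ^ N"
      unfolding k_def by (rule res_add[OF Qp u v])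
    \<comment> \<open>The carry: adding residues moves \<open>d\<close> into the quotient, and
      w^(p^N) = h 1 accounts for it.\<close>
    define d where "d = k div p ^ N"
    have k: "k = k mod p ^ N + p ^ N * d"
      unfolding d_def by simp
    let ?U = "(u - of_nat (res N u)) / ?q" and ?V = "(v - of_nat (res N v)) / ?q"
    have hd: "h (of_nat j) = h 1 ^ j" for j
    proof (induction j)
      case (Suc j)
      then show ?case
        using h(1)[OF Z(2) of_nat_in_int_ring[OF Qp]] by simp
    qed (simp add: h0)
    have "(of_nat k :: 'c) = of_nat (k mod p ^ N) + ?q * of_nat d"
      by (subst k) (simp only: of_nat_add of_nat_mult)
    then have "u + v - of_nat (k mod p ^ N) = (u - of_nat (res N u)) + (v - of_nat (res N v)) + ?q * of_nat d"
      by (simp add: k_def algebra_simps)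
    then have "(u + v - of_nat (k mod p ^ N)) / ?q = ?U + ?V + of_nat d"
      using q(1) by (simp only: add_divide_distrib nonzero_mult_div_cancel_left not_False_eq_True)
    then have "W (u + v) = w ^ (k mod p ^ N) * h (?U + ?V + of_nat d)"
      unfolding W_def r by simp
    also have "h (?U + ?V + of_nat d) = h ?U * h ?V * h 1 ^ d"
      using rest[OF u] rest[OF v] Qp by (simp add: h(1) int_ring_intros hd)
    also have "w ^ (k mod p ^ N) * (h ?U * h ?V * h 1 ^ d) = w ^ (k mod p ^ N + p ^ N * d) * (h ?U * h ?V)"
      by (simp add: power_add power_mult w)
    also have "k mod p ^ N + p ^ N * d = res N u + res N v"
      using k by (simp add: k_def)
    finally show ?thesis
      by (simp add: W_def power_add)
  qed
  have "W (?q * v) = h v" if v: "v \<in> Zp" for v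
  proof -
    have "vabs (?q * v) \<le> 1 / real p ^ N * 1"
      unfolding vabs_mult q(2) using v by (intro mult_left_mono) (auto simp: int_ring_def)
    then have "res N (?q * v) = 0"
      using p_power_pos(1) by (intro res_eqI) auto
    then show ?thesis
      using q(1) by (simp add: W_def)
  qed
  moreover have "W u \<noteq> 0" if "u \<in> Zp" for u
    using w0 h(2)[OF rest[OF that]] by (simp add: W_def)
  ultimately show ?thesis
    using W_add by (intro exI[of _ W]) auto
qed

end

text \<open>Comparing coefficients in \<open>\<phi> (2x) = (\<phi> x)\<^sup>2\<close> shows that \<open>\<phi>\<close> is an exponential near 0.\<close>

lemma exponential_coefficients:
  fixes c :: "nat \<Rightarrow> 'a::field_char_0"
  assumes c0: "c 0 = 1" and rec: "\<And>n. 2 ^ n * c n = (\<Sum>i\<le>n. c i * c (n - i))"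
  shows "c n = c 1 ^ n / fact n"
proof (induction n rule: less_induct)
  case (less n)
  define e where "e n = c 1 ^ n / fact n" for n
  show ?case
  proof (cases "n < 2")
    case True
    then have "n = 0 \<or> n = 1"
      by auto
    then show ?thesis
      using c0 by auto
  next
    case False
    \<comment> \<open>The coefficients of the exponential satisfy the same recursion, because the
      binomial coefficients sum to 2^n.\<close>
    have "(\<Sum>i\<le>n. e i * e (n - i)) = (\<Sum>i\<le>n. of_nat (n choose i) * e n)"
    proof (rule sum.cong)
      fix i assume "i \<in> {..n}"
      then have i: "i \<le> n"
        by simp
      then have "c 1 ^ n = c 1 ^ i * c 1 ^ (n - i)"
        by (simp flip: power_add)
      then show "e i * e (n - i) = of_nat (n choose i) * e n"
        unfolding e_def binomial_fact[OF i] by simp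
    qed simp
    also have "\<dots> = 2 ^ n * e n"
      using choose_row_sum[of n] by (simp flip: sum_distrib_right of_nat_sum)
    finally have "2 ^ n * (c n - e n) = (\<Sum>i\<le>n. c i * c (n - i) - e i * e (n - i))"
      using rec[of n] by (simp add: right_diff_distrib sum_subtractf)
    \<comment> \<open>By induction the inner terms cancel. The outer two leave (2^n - 2) (c n - e n)
      = 0, where 2^n differs from 2 in characteristic 0.\<close>
    also have "\<dots> = (\<Sum>i\<in>{0, n}. c i * c (n - i) - e i * e (n - i))"
    proof (rule sum.mono_neutral_right)
      have "c i = e i" if "i < n" for i
        unfolding e_def by (rule less[OF that])
      then show "\<forall>i\<in>{..n} - {0, n}. c i * c (n - i) - e i * e (n - i) = 0"
        by simp
    qed auto
    also have "\<dots> = 2 * (c n - e n)"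
      using False c0 by (simp add: e_def)
    finally have "(2 ^ n - 2) * (c n - e n) = 0"
      by (simp add: left_diff_distrib)
    moreover have "(2 ^ n :: 'a) \<noteq> 2"
    proof
      assume "(2 ^ n :: 'a) = 2"
      then have "of_nat (2 ^ n) = (of_nat 2 :: 'a)"
        by simp
      then have "2 ^ n = (2 ^ 1 :: nat)"
        unfolding of_nat_eq_iff by simp
      then have "n = 1"
        by (rule power_inject_exp[THEN iffD1, rotated]) simp
      with False show False
        by simp
    qed
    ultimately show ?thesis
      by (simp add: e_def)
  qed
qed

section \<open>A basis of the larger ring adapted to the smaller one\<close>

locale padic_tower = Lo: padic_basis p ty L B + Up: padic_basis p ty K B'
  for p and ty :: "'c::{nonarch_valued_field, alg_closed_field, complete_space} itself"
    and L B K B' :: "'c set" +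
  assumes L_subset: "L \<subseteq> K" and B_subset_B': "B \<subseteq> B'"
begin

lemma OL_subset: "int_ring L \<subseteq> int_ring K"
  by (rule int_ring_mono[OF L_subset])

lemma restrict_char:
  assumes "\<psi> \<in> char_variety K"
  shows "restrict \<psi> (int_ring L) \<in> char_variety L"
  unfolding char_variety_def
proof (intro CollectI conjI ballI)
  show "locally_analytic L (restrict \<psi> (int_ring L))"
    unfolding locally_analytic_def
  proof
    fix a assume "a \<in> int_ring L"
    then obtain r c where rc: "r > 0" "\<forall>x\<in>int_ring K. vabs (x - a) \<le> r \<longrightarrow> (\<lambda>n. c n * (x - a) ^ n) sums \<psi> x"
      using assms OL_subset unfolding char_variety_def locally_analytic_def by blast
    then show "\<exists>r>0. \<exists>c. \<forall>x\<in>int_ring L. vabs (x - a) \<le> r \<longrightarrow> (\<lambda>n. c n * (x - a) ^ n) sums restrict \<psi> (int_ring L) x"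
      using OL_subset by (intro exI[of _ r] conjI exI[of _ c]) auto
  qed
qed (use assms OL_subset Lo.subfield in \<open>auto simp: char_variety_def int_ring_intros\<close>)

text \<open>The retraction onto the integers of L along the span of \<open>B' - B\<close> over the
  p-adic integers.\<close>

definition proj :: "'c \<Rightarrow> 'c" where
  "proj x = (\<Sum>b\<in>B. Up.coord x b * b)"

lemma proj_OL: "x \<in> int_ring K \<Longrightarrow> proj x \<in> int_ring L"
  unfolding proj_def using B_subset_B' by (intro Lo.lin_comb_int_ring Up.coord_Zp) auto

lemma Up_coord_OL:
  assumes "x \<in> int_ring L" "b \<in> B'"
  shows "Up.coord x b = (if b \<in> B then Lo.coord x b else 0)"
proof -
  have "(\<Sum>b\<in>B'. (if b \<in> B then Lo.coord x b else 0) * b) = (\<Sum>b\<in>B. Lo.coord x b * b)"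
    using Up.finite_B B_subset_B' by (intro sum.mono_neutral_cong_right) auto
  then have "x = (\<Sum>b\<in>B'. (if b \<in> B then Lo.coord x b else 0) * b)"
    using Lo.coord(2)[OF assms(1)] by simp
  moreover have "Up.coord (\<Sum>b\<in>B'. (if b \<in> B then Lo.coord x b else 0) * b) b = (if b \<in> B then Lo.coord x b else 0)"
    using Lo.coord_Zp[OF assms(1)] Lo.subfield_Qp by (intro Up.coord_lin_comb assms(2)) (auto simp: int_ring_intros)
  ultimately show ?thesis
    by simp
qed

lemma proj_id: "x \<in> int_ring L \<Longrightarrow> proj x = x"
  using B_subset_B' Lo.coord(2)[of x] by (simp add: proj_def Up_coord_OL subset_iff cong: sum.cong)

lemma proj_add: "x \<in> int_ring K \<Longrightarrow> y \<in> int_ring K \<Longrightarrow> proj (x + y) = proj x + proj y"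
  using B_subset_B' by (simp add: proj_def Up.coord_add subset_iff ring_distribs sum.distrib cong: sum.cong)

lemma proj_near:
  assumes "x \<in> int_ring K" "y \<in> int_ring K" "vabs (x - y) \<le> 1 / real p ^ n"
  shows "vabs (proj x - proj y) \<le> 1 / real p ^ n"
proof -
  have "Lo.coord (proj x) b = Up.coord x b" if "x \<in> int_ring K" "b \<in> B" for x b
    unfolding proj_def using that B_subset_B' by (intro Lo.coord_lin_comb Up.coord_Zp) auto
  then show ?thesis
    using Lo.coord_near_iff[OF proj_OL proj_OL, of x y n] Up.coord_near_iff[of x y n] assms B_subset_B' by auto
qed

lemma coord_decomposition:
  assumes "x \<in> int_ring K"
  shows "x = proj x + (\<Sum>m\<in>B' - B. Up.coord x m * m)"
proof -
  have "(\<Sum>b\<in>B'. Up.coord x b * b) = (\<Sum>b\<in>B. Up.coord x b * b) + (\<Sum>m\<in>B' - B. Up.coord x m * m)"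
    using sum.subset_diff[OF B_subset_B' Up.finite_B, of "\<lambda>b. Up.coord x b * b"] by (simp only: add.commute)
  then show ?thesis
    using Up.coord(2)[OF assms] by (simp add: proj_def)
qed

text \<open>The identity \<phi> (2x) = (\<phi> x)^2 is tested at the points p^(N+k), which tend to
  0; the identity theorem turns it into the recursion of
  \<open>exponential_coefficients\<close>.\<close>

lemma char_exponential:
  assumes \<phi>: "\<phi> \<in> char_variety L"
  shows "\<exists>N c. c 0 = 1 \<and> (\<forall>n. c n = c 1 ^ n / fact n) \<and>
    (\<forall>x\<in>int_ring L. vabs x \<le> 1 / real p ^ N \<longrightarrow> (\<lambda>n. c n * x ^ n) sums \<phi> x)"
proof -
  obtain N c where c0: "c 0 = 1" and c: "\<And>x. x \<in> int_ring L \<Longrightarrow> vabs x \<le> 1 / real p ^ N \<Longrightarrow> (\<lambda>n. c n * x ^ n) sums \<phi> x"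
    using Lo.char_power_series[OF \<phi>] by blast
  define x :: "nat \<Rightarrow> 'c" where "x k = of_nat (p ^ (N + k))" for k
  have vx: "vabs (x k) = 1 / real p ^ (N + k)" for k
    unfolding x_def of_nat_power by (rule Lo.vabs_p_power)
  have xL: "x k \<in> int_ring L" "vabs (x k) \<le> 1 / real p ^ N" for k
    unfolding vx by (simp_all only: x_def of_nat_in_int_ring[OF Lo.subfield] Lo.p_power_decreasing le_add1)
  have "(\<lambda>n. (2 ^ n * c n - (\<Sum>i\<le>n. c i * c (n - i))) * x k ^ n) sums 0" for k
  proof -
    have xx: "x k + x k \<in> int_ring L" "vabs (x k + x k) \<le> 1 / real p ^ N"
      by (rule add_in_int_ring[OF Lo.subfield xL(1) xL(1)], rule vabs_add_le[OF xL(2) xL(2)])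
    have "(\<lambda>n. c n * (x k + x k) ^ n) sums (\<phi> (x k) * \<phi> (x k))"
      using c[OF xx] by (simp only: Lo.char_add[OF \<phi> xL(1) xL(1)])
    moreover have "(\<lambda>n. \<Sum>i\<le>n. (c i * x k ^ i) * (c (n - i) * x k ^ (n - i))) sums (\<phi> (x k) * \<phi> (x k))"
      by (intro nonarch_Cauchy_product_sums c xL)
    ultimately have "(\<lambda>n. c n * (x k + x k) ^ n - (\<Sum>i\<le>n. (c i * x k ^ i) * (c (n - i) * x k ^ (n - i)))) sums 0"
      using nonarch_sums_diff by fastforce
    moreover have "c n * (x k + x k) ^ n - (\<Sum>i\<le>n. (c i * x k ^ i) * (c (n - i) * x k ^ (n - i))) =
        (2 ^ n * c n - (\<Sum>i\<le>n. c i * c (n - i))) * x k ^ n" for n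
    proof -
      have "(c i * x k ^ i) * (c (n - i) * x k ^ (n - i)) = c i * c (n - i) * x k ^ n" if "i \<le> n" for i
      proof -
        have "x k ^ n = x k ^ i * x k ^ (n - i)"
          using that by (simp flip: power_add)
        then show ?thesis
          by simp
      qed
      then have "(\<Sum>i\<le>n. (c i * x k ^ i) * (c (n - i) * x k ^ (n - i))) = (\<Sum>i\<le>n. c i * c (n - i)) * x k ^ n"
        unfolding sum_distrib_right by (intro sum.cong) auto
      moreover have "(x k + x k) ^ n = 2 ^ n * x k ^ n"
        by (simp flip: mult_2 add: power_mult_distrib)
      ultimately show ?thesis
        by (simp add: algebra_simps)
    qed
    ultimately show ?thesis
      by simp
  qed
  moreover have "x k \<noteq> 0" for k
    using Lo.p_gt_1 by (simp add: x_def)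
  moreover have "x \<longlonglongrightarrow> 0"
    unfolding LIMSEQ_vabs_0_iff vx using LIMSEQ_ignore_initial_segment[OF Lo.p_power_tendsto_0, of N]
    by (simp add: add.commute)
  ultimately have "2 ^ n * c n - (\<Sum>i\<le>n. c i * c (n - i)) = 0" for n
    using power_series_eq_0[where x = x and d = "\<lambda>n. 2 ^ n * c n - (\<Sum>i\<le>n. c i * c (n - i))"] by blast
  then have "c n = c 1 ^ n / fact n" for n
    by (intro exponential_coefficients c0) simp
  with c0 c show ?thesis
    by blast
qed

text \<open>Convergence of the exponential series depends on |x| alone, so it defines E on a ball D
  of K. Multiplying \<phi> after the projection by homomorphisms \<open>W m\<close> of
  \<open>Zp\<close> gives a character; the \<open>W m\<close> are chosen to agree with E along m on
  multiples of q = p^N, which makes the product equal to E on D and hence analytic over K.\<close>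

lemma char_extends:
  assumes \<phi>: "\<phi> \<in> char_variety L"
  shows "\<exists>\<psi>\<in>char_variety K. restrict \<psi> (int_ring L) = \<phi>"
proof -
  obtain N c where c0: "c 0 = 1" and cn: "\<And>n. c n = c 1 ^ n / fact n"
    and c: "\<And>x. x \<in> int_ring L \<Longrightarrow> vabs x \<le> 1 / real p ^ N \<Longrightarrow> (\<lambda>n. c n * x ^ n) sums \<phi> x"
    using char_exponential[OF \<phi>] by blast
  define q :: 'c where "q = of_nat (p ^ N)"
  have q: "q \<in> int_ring L" "vabs q = 1 / real p ^ N" "q \<noteq> 0"
    using of_nat_in_int_ring[OF Lo.subfield, of "p ^ N"] Lo.vabs_p_power[of N] Lo.p_gt_1 by (auto simp: q_def)
  define D where "D = {x \<in> int_ring K. vabs x \<le> 1 / real p ^ N}"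
  define E where "E x = (\<Sum>n. c n * x ^ n)" for x
  have E_sums: "(\<lambda>n. c n * x ^ n) sums E x" if "x \<in> D" for x
  proof -
    \<comment> \<open>Comparison with the point \<open>q\<close> of L, whose absolute value is the
      radius of D.\<close>
    have "(\<lambda>n. vabs (c n * x ^ n)) \<longlonglongrightarrow> 0"
    proof (rule tendsto_sandwich[OF _ _ tendsto_const])
      show "(\<lambda>n. vabs (c n * q ^ n)) \<longlonglongrightarrow> 0"
        using sums_imp_LIMSEQ_0[OF c[OF q(1)]] q(2) by (simp add: LIMSEQ_vabs_0_iff)
      have "vabs (c n * x ^ n) \<le> vabs (c n * q ^ n)" for n
        unfolding vabs_mult vabs_power q(2) using that
        by (intro mult_left_mono power_mono vabs_nonneg) (auto simp: D_def)
      then show "eventually (\<lambda>n. vabs (c n * x ^ n) \<le> vabs (c n * q ^ n)) sequentially"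
        by simp
    qed (simp add: vabs_nonneg)
    then have "summable (\<lambda>n. c n * x ^ n)"
      by (intro nonarch_summable) (simp add: LIMSEQ_vabs_0_iff)
    then show ?thesis
      unfolding E_def by (rule summable_sums)
  qed
  have D_add: "x + y \<in> D" if "x \<in> D" "y \<in> D" for x y
    using that Up.subfield by (auto simp: D_def int_ring_intros intro: vabs_add_le)
  have E_add: "E (x + y) = E x * E y" if "x \<in> D" "y \<in> D" for x y
  proof -
    have "(\<lambda>n. \<Sum>i\<le>n. (c i * x ^ i) * (c (n - i) * y ^ (n - i))) sums (E x * E y)"
      by (intro nonarch_Cauchy_product_sums E_sums that)
    moreover have "(\<Sum>i\<le>n. (c i * x ^ i) * (c (n - i) * y ^ (n - i))) = c n * (x + y) ^ n" for n
    proof -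
      have "(c i * x ^ i) * (c (n - i) * y ^ (n - i)) = c n * (of_nat (n choose i) * x ^ i * y ^ (n - i))"
        if "i \<le> n" for i
      proof -
        have "c 1 ^ n = c 1 ^ i * c 1 ^ (n - i)"
          using that by (simp flip: power_add)
        then have "c i * c (n - i) = c n * of_nat (n choose i)"
          unfolding cn[of i] cn[of "n - i"] cn[of n] binomial_fact[OF that] by simp
        then show ?thesis
          by (metis (no_types, lifting) mult.assoc mult.left_commute)
      qed
      then show ?thesis
        unfolding binomial_ring sum_distrib_left by (intro sum.cong) auto
    qed
    ultimately show ?thesis
      using E_sums[OF D_add[OF that]] sums_unique2 by simp
  qed
  have E_0: "0 \<in> D" "E 0 = 1"
  proof -
    show "0 \<in> D"
      using Up.subfield by (simp add: D_def int_ring_intros)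
    from E_sums[OF this] have "(\<lambda>n. if n = 0 then c n else 0) sums E 0"
      by (rule back_subst[of "\<lambda>f. f sums E 0"]) (auto simp: fun_eq_iff power_0_left)
    then show "E 0 = 1"
      using sums_single[of 0 c] c0 sums_unique2 by metis
  qed
  have E_nonzero: "E x \<noteq> 0" if "x \<in> D" for x
  proof -
    have "- x \<in> D"
      using that Up.subfield by (auto simp: D_def int_ring_def subfield_intros vabs_minus)
    then have "E x * E (- x) = 1"
      using E_add[OF that, of "- x"] E_0 by simp
    then show ?thesis
      by auto
  qed
  have E_sum: "(\<Sum>i\<in>A. g i) \<in> D \<and> E (\<Sum>i\<in>A. g i) = (\<Prod>i\<in>A. E (g i))" if "\<And>i. i \<in> A \<Longrightarrow> g i \<in> D" for g and A :: "'c set"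
    using that by (induction A rule: infinite_finite_induct) (auto simp: E_0 E_add D_add)
  have E_\<phi>: "\<phi> x = E x" if "x \<in> int_ring L" "vabs x \<le> 1 / real p ^ N" for x
    using c[OF that] E_sums[of x] that OL_subset sums_unique2 by (auto simp: D_def)
  have qD: "q * v * m \<in> D" if "v \<in> Lo.Zp" "m \<in> int_ring K" for v m
  proof -
    have vm: "v * m \<in> int_ring K"
      using that Up.Zp_subset Up.subfield by (auto intro: int_ring_intros)
    then have "q * (v * m) \<in> int_ring K"
      using q(1) OL_subset Up.subfield by (auto intro: int_ring_intros)
    moreover have "vabs q * vabs (v * m) \<le> 1 / real p ^ N * 1"
      unfolding q(2) using vm by (intro mult_left_mono) (auto simp: int_ring_def)
    ultimately show ?thesis
      by (simp add: D_def vabs_mult mult.assoc)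
  qed
  \<comment> \<open>E prescribes the values on multiples of \<open>q\<close>;
    \<open>Zp_hom_divide\<close> continues them to all of \<open>Zp\<close>.\<close>
  have "\<forall>m\<in>int_ring K. \<exists>W. (\<forall>u\<in>Lo.Zp. \<forall>v\<in>Lo.Zp. W (u + v) = W u * W v) \<and> (\<forall>u\<in>Lo.Zp. W u \<noteq> 0) \<and>
      (\<forall>v\<in>Lo.Zp. W (q * v) = E (q * v * m))"
  proof
    fix m assume m: "m \<in> int_ring K"
    have "E (q * (u + v) * m) = E (q * u * m) * E (q * v * m)" if "u \<in> Lo.Zp" "v \<in> Lo.Zp" for u v
      using E_add[OF qD[OF that(1) m] qD[OF that(2) m]] by (simp add: ring_distribs)
    then show "\<exists>W. (\<forall>u\<in>Lo.Zp. \<forall>v\<in>Lo.Zp. W (u + v) = W u * W v) \<and> (\<forall>u\<in>Lo.Zp. W u \<noteq> 0) \<and>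
        (\<forall>v\<in>Lo.Zp. W (q * v) = E (q * v * m))"
      using E_nonzero[OF qD[OF _ m]] unfolding q_def by (intro Lo.Zp_hom_divide Lo.subfield_Qp)
  qed
  from bchoice[OF this] obtain W where W: "\<forall>m\<in>int_ring K. (\<forall>u\<in>Lo.Zp. \<forall>v\<in>Lo.Zp. W m (u + v) = W m u * W m v) \<and>
      (\<forall>u\<in>Lo.Zp. W m u \<noteq> 0) \<and> (\<forall>v\<in>Lo.Zp. W m (q * v) = E (q * v * m))" ..
  have W_add: "W m (u + v) = W m u * W m v" if "m \<in> int_ring K" "u \<in> Lo.Zp" "v \<in> Lo.Zp" for m u v
    using W that by simp
  have W_nonzero: "W m u \<noteq> 0" if "m \<in> int_ring K" "u \<in> Lo.Zp" for m u
    using W that by simp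
  have W_E: "W m (q * v) = E (q * v * m)" if "m \<in> int_ring K" "v \<in> Lo.Zp" for m v
    using W that by simp
  have M: "m \<in> int_ring K" "m \<in> B'" if "m \<in> B' - B" for m
    using that Up.B_subset by auto
  define \<psi> where "\<psi> = (\<lambda>x\<in>int_ring K. \<phi> (proj x) * (\<Prod>m\<in>B' - B. W m (Up.coord x m)))"
  have \<psi>_add: "\<psi> (x + y) = \<psi> x * \<psi> y" if x: "x \<in> int_ring K" and y: "y \<in> int_ring K" for x y
  proof -
    have "(\<Prod>m\<in>B' - B. W m (Up.coord (x + y) m)) = (\<Prod>m\<in>B' - B. W m (Up.coord x m) * W m (Up.coord y m))"
      using M by (intro prod.cong refl) (simp add: Up.coord_add x y W_add Up.coord_Zp)
    then show ?thesis
      using x y Up.subfield Lo.char_add[OF \<phi> proj_OL proj_OL]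
      by (simp add: \<psi>_def int_ring_intros proj_add prod.distrib)
  qed
  \<comment> \<open>On D all coordinates are divisible by \<open>q\<close>, so every factor of
    \<psi> x is a value of E, and additivity of E reassembles \<open>x\<close>.\<close>
  have \<psi>_E: "\<psi> x = E x" if x: "x \<in> D" for x
  proof -
    have xK: "x \<in> int_ring K" and xv: "vabs (x - 0) \<le> 1 / real p ^ N"
      using x by (auto simp: D_def)
    have K0: "0 \<in> int_ring K" and L0: "0 \<in> int_ring L"
      using Up.subfield Lo.subfield by (auto simp: int_ring_intros)
    have "vabs (Up.coord x m - Up.coord 0 m) \<le> 1 / real p ^ N" if "m \<in> B'" for m
      using Up.coord_near_iff[OF xK K0, of N] xv that by simp
    moreover have "Up.coord 0 m = 0" if "m \<in> B'" for m
      using Up.coord_add[OF K0 K0 that] by simp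
    ultimately have cv: "vabs (Up.coord x m) \<le> 1 / real p ^ N" if "m \<in> B'" for m
      using that by (metis diff_zero)
    have 1: "W m (Up.coord x m) = E (Up.coord x m * m) \<and> Up.coord x m * m \<in> D" if m: "m \<in> B' - B" for m
    proof -
      have "Up.coord x m / q \<in> Lo.Zp"
      proof -
        have "q \<in> Qp"
          unfolding q_def by (rule of_nat_in_subfield[OF Lo.subfield_Qp])
        moreover have "vabs (Up.coord x m) * real p ^ N \<le> 1"
          using cv[OF M(2)[OF m]] Lo.p_power_pos(2)[of N] by (simp add: field_simps)
        ultimately show ?thesis
          using Up.coord_Zp[OF xK M(2)[OF m]] Lo.subfield_Qp
          by (simp add: int_ring_def subfield_intros vabs_divide q(2))
      qed
      then show ?thesis
        using W_E[OF M(1)[OF m], of "Up.coord x m / q"] qD[OF _ M(1)[OF m], of "Up.coord x m / q"] q(3) by simp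
    qed
    have p0: "proj 0 = 0"
      by (rule proj_id[OF L0])
    have projv: "vabs (proj x) \<le> 1 / real p ^ N"
      using proj_near[OF xK K0 xv] p0 by simp
    then have projD: "proj x \<in> D"
      using proj_OL[OF xK] OL_subset by (auto simp: D_def)
    have "\<psi> x = E (proj x) * (\<Prod>m\<in>B' - B. E (Up.coord x m * m))"
      using 1 xK by (simp add: \<psi>_def E_\<phi>[OF proj_OL[OF xK] projv])
    also have "\<dots> = E (proj x + (\<Sum>m\<in>B' - B. Up.coord x m * m))"
      using E_sum[of "B' - B" "\<lambda>m. Up.coord x m * m"] 1 E_add[OF projD] by simp
    also have "proj x + (\<Sum>m\<in>B' - B. Up.coord x m * m) = x"
      using coord_decomposition[OF xK] by simp
    finally show ?thesis .
  qed
  have "\<psi> \<in> char_variety K"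
    unfolding char_variety_def
  proof (intro CollectI conjI ballI \<psi>_add)
    show "\<psi> \<in> extensional (int_ring K)"
      by (simp add: \<psi>_def)
    show "\<psi> x \<noteq> 0" if "x \<in> int_ring K" for x
      using that M Up.finite_B Lo.char_nonzero[OF \<phi> proj_OL] by (simp add: \<psi>_def W_nonzero Up.coord_Zp)
    show "locally_analytic K \<psi>"
      unfolding locally_analytic_def
    proof (intro ballI exI conjI impI)
      fix a x assume a: "a \<in> int_ring K" and x: "x \<in> int_ring K" "vabs (x - a) \<le> 1 / real p ^ N"
      have xa: "x - a \<in> D"
        using a x Up.subfield by (simp add: D_def int_ring_intros)
      \<comment> \<open>The expansion at \<open>a\<close> is the one at 0, translated and multiplied
        by \<psi> a.\<close>
      have "(\<lambda>n. \<psi> a * (c n * (x - a) ^ n)) sums (\<psi> a * E (x - a))"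
        by (intro nonarch_sums_mult E_sums xa)
      moreover have "\<psi> a * E (x - a) = \<psi> x"
        using \<psi>_add[of a "x - a"] \<psi>_E[OF xa] xa a by (simp add: D_def)
      ultimately show "(\<lambda>n. \<psi> a * c n * (x - a) ^ n) sums \<psi> x"
        by (simp add: mult.assoc)
    qed (use Lo.p_power_pos in auto)
  qed
  moreover have "restrict \<psi> (int_ring L) = \<phi>"
  proof
    fix x
    show "restrict \<psi> (int_ring L) x = \<phi> x"
    proof (cases "x \<in> int_ring L")
      case True
      have "W m 0 = 1" if "m \<in> B' - B" for m
        using W_add[OF M(1)[OF that], of 0 0] W_nonzero[OF M(1)[OF that], of 0] Lo.subfield_Qp
        by (simp add: int_ring_intros)
      then have "(\<Prod>m\<in>B' - B. W m (Up.coord x m)) = 1"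
        using True by (intro prod.neutral) (simp add: Up_coord_OL)
      then show ?thesis
        using True OL_subset by (auto simp: \<psi>_def proj_id)
    next
      case False
      then show ?thesis
        using \<phi> by (simp add: char_variety_def extensional_def)
    qed
  qed
  ultimately show ?thesis
    by blast
qed

end

section \<open>Descent of measures\<close>

context padic_tower
begin

text \<open>The same series, regarded as constant in the variables of \<open>B' - B\<close>; its
  coefficients remain in L.\<close>

definition extend_series :: "(('c \<Rightarrow> nat) \<Rightarrow> 'c) \<Rightarrow> ('c \<Rightarrow> nat) \<Rightarrow> 'c" where
  "extend_series c \<alpha> = (if \<forall>b\<in>B' - B. \<alpha> b = 0 then c (restrict \<alpha> B) else 0)"

lemma bij_betw_restrict_index:
  "bij_betw (\<lambda>\<alpha>. restrict \<alpha> B) {\<alpha> \<in> B' \<rightarrow>\<^sub>E (UNIV :: nat set). \<forall>b\<in>B' - B. \<alpha> b = 0} (B \<rightarrow>\<^sub>E UNIV)"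
proof (rule bij_betw_byWitness[where f' = "\<lambda>\<alpha>. \<lambda>b\<in>B'. if b \<in> B then \<alpha> b else 0"])
  show "\<forall>\<alpha>\<in>{\<alpha> \<in> B' \<rightarrow>\<^sub>E (UNIV :: nat set). \<forall>b\<in>B' - B. \<alpha> b = 0}.
      (\<lambda>b\<in>B'. if b \<in> B then restrict \<alpha> B b else 0) = \<alpha>"
    by (auto simp: fun_eq_iff PiE_iff extensional_def)
  show "\<forall>\<alpha>\<in>B \<rightarrow>\<^sub>E (UNIV :: nat set). restrict (\<lambda>b\<in>B'. if b \<in> B then \<alpha> b else 0) B = \<alpha>"
    using B_subset_B' by (auto simp: fun_eq_iff PiE_iff extensional_def)
qed auto

lemma extend_series_tate:
  assumes "c \<in> tate_series L B r"
  shows "extend_series c \<in> tate_series K B' r"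
  unfolding tate_series_def
proof (intro CollectI conjI ballI allI impI)
  fix \<alpha> :: "'c \<Rightarrow> nat" assume "\<alpha> \<in> B' \<rightarrow>\<^sub>E UNIV"
  then show "extend_series c \<alpha> \<in> K"
    using assms L_subset Up.subfield by (auto simp: extend_series_def tate_series_def subfield_intros)
next
  fix e :: real assume e: "e > 0"
  let ?S = "{\<alpha> \<in> B \<rightarrow>\<^sub>E UNIV. vabs (c \<alpha>) * r ^ (\<Sum>b\<in>B. \<alpha> b) \<ge> e}"
  let ?T = "{\<alpha> \<in> B' \<rightarrow>\<^sub>E UNIV. vabs (extend_series c \<alpha>) * r ^ (\<Sum>b\<in>B'. \<alpha> b) \<ge> e}"
  have T0: "\<forall>b\<in>B' - B. \<alpha> b = 0" if "\<alpha> \<in> ?T" for \<alpha>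
    using that e by (auto simp: extend_series_def split: if_splits)
  have "finite ?S"
    using assms e by (simp add: tate_series_def)
  moreover have "(\<lambda>\<alpha>. restrict \<alpha> B) ` ?T \<subseteq> ?S"
  proof
    fix \<beta> assume "\<beta> \<in> (\<lambda>\<alpha>. restrict \<alpha> B) ` ?T"
    then obtain \<alpha> where \<alpha>: "\<alpha> \<in> ?T" "\<beta> = restrict \<alpha> B"
      by blast
    have "(\<Sum>b\<in>B'. \<alpha> b) = (\<Sum>b\<in>B. \<alpha> b)"
      using T0[OF \<alpha>(1)] B_subset_B' Up.finite_B by (intro sum.mono_neutral_right) auto
    then show "\<beta> \<in> ?S"
      using \<alpha> T0[OF \<alpha>(1)] by (simp add: extend_series_def)
  qed
  moreover have "inj_on (\<lambda>\<alpha>. restrict \<alpha> B) ?T"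
  proof (rule inj_on_subset[OF bij_betw_imp_inj_on[OF bij_betw_restrict_index]])
    show "?T \<subseteq> {\<alpha> \<in> B' \<rightarrow>\<^sub>E UNIV. \<forall>b\<in>B' - B. \<alpha> b = 0}"
      using T0 by blast
  qed
  ultimately show "finite ?T"
    by (meson finite_imageD finite_subset)
qed

lemma extend_series_has_sum:
  "((\<lambda>\<alpha>. extend_series c \<alpha> * (\<Prod>b\<in>B'. x b ^ \<alpha> b)) has_sum I) (B' \<rightarrow>\<^sub>E UNIV) \<longleftrightarrow>
    ((\<lambda>\<alpha>. c \<alpha> * (\<Prod>b\<in>B. x b ^ \<alpha> b)) has_sum I) (B \<rightarrow>\<^sub>E UNIV)"
proof -
  let ?T = "{\<alpha> \<in> B' \<rightarrow>\<^sub>E (UNIV :: nat set). \<forall>b\<in>B' - B. \<alpha> b = 0}"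
  have "((\<lambda>\<alpha>. c \<alpha> * (\<Prod>b\<in>B. x b ^ \<alpha> b)) has_sum I) (B \<rightarrow>\<^sub>E UNIV) \<longleftrightarrow>
      ((\<lambda>\<alpha>. c (restrict \<alpha> B) * (\<Prod>b\<in>B. x b ^ (restrict \<alpha> B) b)) has_sum I) ?T"
    by (rule has_sum_reindex_bij_betw[OF bij_betw_restrict_index, symmetric])
  also have "\<dots> \<longleftrightarrow> ((\<lambda>\<alpha>. extend_series c \<alpha> * (\<Prod>b\<in>B'. x b ^ \<alpha> b)) has_sum I) (B' \<rightarrow>\<^sub>E UNIV)"
  proof (rule has_sum_cong_neutral)
    fix \<alpha> assume "\<alpha> \<in> ?T \<inter> (B' \<rightarrow>\<^sub>E UNIV)"
    then have \<alpha>: "\<forall>b\<in>B' - B. \<alpha> b = 0"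
      by simp
    then have "(\<Prod>b\<in>B'. x b ^ \<alpha> b) = (\<Prod>b\<in>B. x b ^ \<alpha> b)"
      using B_subset_B' Up.finite_B by (intro prod.mono_neutral_right) auto
    with \<alpha> show "c (restrict \<alpha> B) * (\<Prod>b\<in>B. x b ^ (restrict \<alpha> B) b) =
        extend_series c \<alpha> * (\<Prod>b\<in>B'. x b ^ \<alpha> b)"
      by (simp add: extend_series_def)
  qed (auto simp: extend_series_def)
  finally show ?thesis
    by simp
qed

definition pullback :: "(('c \<Rightarrow> 'c) \<Rightarrow> 'c) \<Rightarrow> ('c \<Rightarrow> 'c) \<Rightarrow> 'c" where
  "pullback f = (\<lambda>\<psi>\<in>char_variety K. f (restrict \<psi> (int_ring L)))"

text \<open>Restriction keeps the values on \<open>B\<close>, so it maps the affinoid of radius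
  \<open>r\<close> for K into the one for L.\<close>

lemma pullback_has_sum:
  assumes c: "\<And>\<phi>. \<phi> \<in> char_variety L \<Longrightarrow> (\<forall>b\<in>B. vabs (\<phi> b - 1) \<le> r) \<Longrightarrow>
      ((\<lambda>\<alpha>. c \<alpha> * (\<Prod>b\<in>B. (\<phi> b - 1) ^ \<alpha> b)) has_sum f \<phi>) (B \<rightarrow>\<^sub>E UNIV)"
    and \<psi>: "\<psi> \<in> char_variety K" "\<forall>b\<in>B'. vabs (\<psi> b - 1) \<le> r"
  shows "((\<lambda>\<alpha>. extend_series c \<alpha> * (\<Prod>b\<in>B'. (\<psi> b - 1) ^ \<alpha> b)) has_sum pullback f \<psi>) (B' \<rightarrow>\<^sub>E UNIV)"
proof -
  let ?\<phi> = "restrict \<psi> (int_ring L)"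
  have eq: "?\<phi> b = \<psi> b" if "b \<in> B" for b
    using that Lo.B_subset by auto
  have "((\<lambda>\<alpha>. c \<alpha> * (\<Prod>b\<in>B. (?\<phi> b - 1) ^ \<alpha> b)) has_sum f ?\<phi>) (B \<rightarrow>\<^sub>E UNIV)"
    using \<psi>(2) B_subset_B' eq by (intro c restrict_char[OF \<psi>(1)]) auto
  moreover have "(\<Prod>b\<in>B. (?\<phi> b - 1) ^ \<alpha> b) = (\<Prod>b\<in>B. (\<psi> b - 1) ^ \<alpha> b)" for \<alpha> :: "'c \<Rightarrow> nat"
    by (intro prod.cong refl) (simp only: eq)
  moreover have "pullback f \<psi> = f ?\<phi>"
    using \<psi>(1) by (simp add: pullback_def)
  ultimately show ?thesis
    by (simp only: extend_series_has_sum)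
qed

lemma pullback_bounded:
  assumes f: "\<And>\<phi>. \<phi> \<in> char_variety L \<Longrightarrow> vabs (f \<phi>) \<le> 1"
    and c: "\<And>r. 0 < r \<Longrightarrow> r < 1 \<Longrightarrow> \<exists>c\<in>tate_series L B r. \<forall>\<phi>\<in>char_variety L. (\<forall>b\<in>B. vabs (\<phi> b - 1) \<le> r) \<longrightarrow>
      ((\<lambda>\<alpha>. c \<alpha> * (\<Prod>b\<in>B. (\<phi> b - 1) ^ \<alpha> b)) has_sum f \<phi>) (B \<rightarrow>\<^sub>E UNIV)"
  shows "pullback f \<in> bounded_functions K"
  unfolding bounded_functions_def rigid_functions_def
proof (intro CollectI conjI exI[of _ B'] Up.basis allI impI ballI)
  show "pullback f \<in> extensional (char_variety K)"
    by (simp add: pullback_def)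
  show "vabs (pullback f \<psi>) \<le> 1" if "\<psi> \<in> char_variety K" for \<psi>
    using that f[OF restrict_char] by (simp add: pullback_def)
  fix r :: real assume r: "0 < r \<and> r < 1"
  then obtain c where c1: "c \<in> tate_series L B r" and c2: "\<And>\<phi>. \<phi> \<in> char_variety L \<Longrightarrow> (\<forall>b\<in>B. vabs (\<phi> b - 1) \<le> r) \<Longrightarrow>
      ((\<lambda>\<alpha>. c \<alpha> * (\<Prod>b\<in>B. (\<phi> b - 1) ^ \<alpha> b)) has_sum f \<phi>) (B \<rightarrow>\<^sub>E UNIV)"
    using c by blast
  show "\<exists>c\<in>tate_series K B' r. \<forall>\<psi>\<in>char_variety K. (\<forall>b\<in>B'. vabs (\<psi> b - 1) \<le> r) \<longrightarrow>
      ((\<lambda>\<alpha>. c \<alpha> * (\<Prod>b\<in>B'. (\<psi> b - 1) ^ \<alpha> b)) has_sum pullback f \<psi>) (B' \<rightarrow>\<^sub>E UNIV)"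
  proof (intro bexI[OF _ extend_series_tate[OF c1]] ballI impI)
    fix \<psi> assume "\<psi> \<in> char_variety K" "\<forall>b\<in>B'. vabs (\<psi> b - 1) \<le> r"
    then show "((\<lambda>\<alpha>. extend_series c \<alpha> * (\<Prod>b\<in>B'. (\<psi> b - 1) ^ \<alpha> b)) has_sum pullback f \<psi>) (B' \<rightarrow>\<^sub>E UNIV)"
      by (rule pullback_has_sum[rotated]) (rule c2)
  qed
qed

section \<open>The measure on the smaller ring\<close>

context
  fixes f :: "('c \<Rightarrow> 'c) \<Rightarrow> 'c" and \<mu> :: "'c set \<Rightarrow> 'c"
  assumes c: "\<And>r. 0 < r \<Longrightarrow> r < 1 \<Longrightarrow> \<exists>c\<in>tate_series L B r. \<forall>\<phi>\<in>char_variety L. (\<forall>b\<in>B. vabs (\<phi> b - 1) \<le> r) \<longrightarrow>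
      ((\<lambda>\<alpha>. c \<alpha> * (\<Prod>b\<in>B. (\<phi> b - 1) ^ \<alpha> b)) has_sum f \<phi>) (B \<rightarrow>\<^sub>E UNIV)"
    and \<mu>: "\<mu> \<in> int_measures K"
    and integral: "\<And>\<psi>. \<psi> \<in> char_variety K \<Longrightarrow> has_measure_integral K \<mu> \<psi> (pullback f \<psi>)"
begin

text \<open>A radius covering the characters of level n is fixed first, then a series valid there.
  Its dependence on n is harmless, since the conclusion concerns \<mu> alone.\<close>

lemma measure_cell_descent:
  assumes a: "a \<in> Up.idx n"
  shows "\<mu> (Up.cell n a) \<in> L" "b \<in> B' - B \<Longrightarrow> a b \<noteq> 0 \<Longrightarrow> \<mu> (Up.cell n a) = 0"
proof -
  obtain z where z: "Lo.primitive_root_of_unity n z"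
    using Lo.ex_primitive_root_of_unity by blast
  obtain r where r: "0 < r" "r < 1" "\<And>s b. b \<in> B' \<Longrightarrow> vabs (Up.finite_char n z s b - 1) \<le> r"
    using Up.finite_char_radius[OF z] by blast
  obtain c where ct: "c \<in> tate_series L B r" and c: "\<And>\<phi>. \<phi> \<in> char_variety L \<Longrightarrow> (\<forall>b\<in>B. vabs (\<phi> b - 1) \<le> r) \<Longrightarrow>
      ((\<lambda>\<alpha>. c \<alpha> * (\<Prod>b\<in>B. (\<phi> b - 1) ^ \<alpha> b)) has_sum f \<phi>) (B \<rightarrow>\<^sub>E UNIV)"
    using c[OF r(1,2)] by blast
  let ?I = "\<lambda>s. pullback f (Up.finite_char n z s)"
  have char: "Up.finite_char n z s \<in> char_variety K" for s
    by (rule Up.finite_char_in_char_variety[OF z])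
  have I: "has_measure_integral K \<mu> (Up.finite_char n z s) (?I s)" for s
    by (rule integral[OF char])
  have hs: "((\<lambda>\<alpha>. extend_series c \<alpha> * (\<Prod>b\<in>B'. (Up.finite_char n z s b - 1) ^ \<alpha> b)) has_sum ?I s) (B' \<rightarrow>\<^sub>E UNIV)" for s
    using c r(3) by (intro pullback_has_sum[OF _ char]) auto
  have "extend_series c \<alpha> \<in> L" for \<alpha>
    using ct Lo.subfield by (auto simp: extend_series_def tate_series_def subfield_intros)
  then show "\<mu> (Up.cell n a) \<in> L"
    using Up.measure_cell_in_subfield[OF \<mu> z a I hs Lo.subfield Lo.closed_F] by blast
  show "\<mu> (Up.cell n a) = 0" if b: "b \<in> B' - B" "a b \<noteq> 0"
  proof (rule Up.measure_cell_eq_0[OF \<mu> z a I hs, of b])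
    show "extend_series c \<alpha> = 0" if "\<alpha> b \<noteq> 0" for \<alpha>
      using that b by (auto simp: extend_series_def)
  qed (use b in auto)
qed

lemma measure_clopen_descent:
  assumes C: "clopen_in (int_ring K) C"
  shows "\<mu> C \<in> L" "C \<inter> int_ring L = {} \<Longrightarrow> \<mu> C = 0"
proof -
  obtain n where n: "\<mu> C = (\<Sum>a | a \<in> Up.idx n \<and> Up.cell n a \<subseteq> C. \<mu> (Up.cell n a))"
    using Up.measure_clopen_eq_sum_cells[OF \<mu> C] by blast
  show "\<mu> C \<in> L"
    unfolding n using Lo.subfield measure_cell_descent(1) by (intro sum_in_subfield) auto
  show "\<mu> C = 0" if disj: "C \<inter> int_ring L = {}"
    unfolding n
  proof (rule sum.neutral, clarify)
    fix a assume a: "a \<in> Up.idx n" "Up.cell n a \<subseteq> C"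
    \<comment> \<open>Otherwise the representative of the cell would itself be a point of L.\<close>
    have "\<exists>b\<in>B' - B. a b \<noteq> 0"
    proof (rule ccontr)
      assume "\<not> (\<exists>b\<in>B' - B. a b \<noteq> 0)"
      then have "Up.pt a = Lo.pt a"
        unfolding Up.pt_def Lo.pt_def using B_subset_B' Up.finite_B by (intro sum.mono_neutral_right) auto
      then have "Up.pt a \<in> C \<inter> int_ring L"
        using Up.pt_in_cell[of a n] a(2) Lo.pt_OF[of a] by auto
      with disj show False
        by simp
    qed
    then show "\<mu> (Up.cell n a) = 0"
      using measure_cell_descent(2)[OF a(1)] by blast
  qed
qed

text \<open>Stands for the restriction of \<mu> to the integers of L. These are not open in the
  integers of K when L is smaller than K, so clopen subsets are first thickened along the
  retraction; \<mu> vanishes away from L.\<close>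

definition pushforward :: "'c set \<Rightarrow> 'c" where
  "pushforward D = \<mu> {x \<in> int_ring K. proj x \<in> D}"

lemma clopen_preimage:
  assumes "clopen_in (int_ring L) D"
  shows "clopen_in (int_ring K) {x \<in> int_ring K. proj x \<in> D}"
proof -
  obtain n where n: "\<forall>x\<in>D. \<forall>y\<in>int_ring L. vabs (x - y) \<le> 1 / real p ^ n \<longrightarrow> y \<in> D"
    using Lo.clopen_inD(2)[OF assms] by blast
  show ?thesis
  proof (rule Up.clopen_inI)
    fix x y assume x: "x \<in> {x \<in> int_ring K. proj x \<in> D}" and y: "y \<in> int_ring K" and xy: "vabs (x - y) \<le> 1 / real p ^ n"
    then show "y \<in> {x \<in> int_ring K. proj x \<in> D}"
      using n proj_OL[OF y] proj_near[OF _ y xy] by blast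
  qed (use Lo.p_power_pos in auto)
qed

lemma pushforward_int_measure: "pushforward \<in> int_measures L"
  unfolding int_measures_def
proof (intro CollectI conjI allI impI)
  fix D assume "clopen_in (int_ring L) D"
  then show "pushforward D \<in> int_ring L"
    using measure_clopen_descent(1)[OF clopen_preimage] Up.measure_vabs_le[OF \<mu> clopen_preimage]
    by (simp add: pushforward_def int_ring_def)
next
  fix C D assume CD: "clopen_in (int_ring L) C \<and> clopen_in (int_ring L) D \<and> C \<inter> D = {}"
  have "{x \<in> int_ring K. proj x \<in> C \<union> D} = {x \<in> int_ring K. proj x \<in> C} \<union> {x \<in> int_ring K. proj x \<in> D}"
    by auto
  then show "pushforward (C \<union> D) = pushforward C + pushforward D"
    unfolding pushforward_def using CD by (simp only:) (intro Up.measure_Un[OF \<mu>] clopen_preimage; auto)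
qed

text \<open>A Riemann sum of \<phi> is compared with one of an extension \<psi> over cells of K. A
  piece of the refinement that misses L has measure 0; any other contains a point of L, fixed by the
  retraction and so close both to the tag and to the representative of the cell.\<close>

lemma pushforward_integral:
  assumes \<phi>: "\<phi> \<in> char_variety L"
  shows "has_measure_integral L pushforward \<phi> (f \<phi>)"
  unfolding has_measure_integral_def
proof (intro allI impI)
  fix e :: real assume e: "e > 0"
  obtain \<psi> where \<psi>: "\<psi> \<in> char_variety K" "restrict \<psi> (int_ring L) = \<phi>"
    using char_extends[OF \<phi>] by blast
  have \<psi>\<phi>: "\<psi> x = \<phi> x" if "x \<in> int_ring L" for x
    using that by (simp flip: \<psi>(2))
  have f\<phi>: "pullback f \<psi> = f \<phi>"
    using \<psi> by (simp add: pullback_def)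
  obtain m where m: "\<And>x y. x \<in> int_ring K \<Longrightarrow> y \<in> int_ring K \<Longrightarrow> vabs (x - y) \<le> 1 / real p ^ m \<Longrightarrow> vabs (\<psi> x - \<psi> y) \<le> e / 2"
    using Up.char_uniformly_continuous[OF \<psi>(1) half_gt_zero[OF e]] by blast
  have "eventually (\<lambda>n. vabs ((\<Sum>a\<in>Up.idx n. \<mu> (Up.cell n a) * \<psi> (Up.pt a)) - f \<phi>) < e / 2) sequentially"
    using Up.Riemann_sum_cells_tendsto[OF integral[OF \<psi>(1)]] half_gt_zero[OF e]
    unfolding tendsto_vabs_iff f\<phi> by blast
  then obtain n0 where n0: "\<And>n. n \<ge> n0 \<Longrightarrow> vabs ((\<Sum>a\<in>Up.idx n. \<mu> (Up.cell n a) * \<psi> (Up.pt a)) - f \<phi>) < e / 2"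
    unfolding eventually_sequentially by blast
  \<comment> \<open>At least \<open>m\<close> so that \<psi> varies little on cells, at least
    \<open>n0\<close> so that the cell sum is close to the integral.\<close>
  define n where "n = max m n0"
  let ?R = "\<Sum>a\<in>Up.idx n. \<mu> (Up.cell n a) * \<psi> (Up.pt a)"
  have R: "vabs (?R - f \<phi>) < e / 2"
    by (rule n0) (simp add: n_def)
  show "\<exists>d>0. \<forall>P t. finite P \<and> partition_on (int_ring L) P \<and>
      (\<forall>C\<in>P. clopen_in (int_ring L) C \<and> t C \<in> C \<and> (\<forall>x\<in>C. \<forall>y\<in>C. vabs (x - y) < d)) \<longrightarrow>
      vabs ((\<Sum>C\<in>P. pushforward C * \<phi> (t C)) - f \<phi>) < e"
  proof (intro exI[of _ "1 / real p ^ m"] conjI allI impI)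
    fix P t assume P: "finite P \<and> partition_on (int_ring L) P \<and>
      (\<forall>C\<in>P. clopen_in (int_ring L) C \<and> t C \<in> C \<and> (\<forall>x\<in>C. \<forall>y\<in>C. vabs (x - y) < 1 / real p ^ m))"
    let ?C = "\<lambda>D. {x \<in> int_ring K. proj x \<in> D}"
    have PL: "D \<subseteq> int_ring L" if "D \<in> P" for D
      using P that by (auto simp: partition_on_def)
    have "vabs ((\<Sum>D\<in>P. \<mu> (?C D) * \<phi> (t D)) - ?R) \<le> e / 2"
    proof (rule Up.Riemann_sums_near[OF \<mu> _ Up.clopen_partition_cell])
      show "Up.clopen_partition P ?C"
        unfolding Up.clopen_partition_def
      proof (intro conjI ballI)
        show "disjoint_family_on ?C P"
          using P unfolding disjoint_family_on_def partition_on_def disjoint_def by fastforce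
        show "(\<Union>D\<in>P. ?C D) = int_ring K"
          using P proj_OL by (auto simp: partition_on_def)
      qed (use P clopen_preimage in auto)
    next
      fix D a assume D: "D \<in> P" and a: "a \<in> Up.idx n"
      show "\<mu> (?C D \<inter> Up.cell n a) = 0 \<or> vabs (\<phi> (t D) - \<psi> (Up.pt a)) \<le> e / 2"
      proof (cases "?C D \<inter> Up.cell n a \<inter> int_ring L = {}")
        case True
        have "clopen_in (int_ring K) (?C D \<inter> Up.cell n a)"
          using P D by (intro Up.clopen_in_Int clopen_preimage Up.clopen_cell a) auto
        with True show ?thesis
          using measure_clopen_descent(2) by blast
      next
        case False
        then obtain x where x: "x \<in> int_ring K" "proj x \<in> D" "x \<in> Up.cell n a" "x \<in> int_ring L"
          by auto
        have xD: "x \<in> D"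
          using x proj_id by simp
        have tD: "t D \<in> D"
          using P D by auto
        have "vabs (\<psi> (t D) - \<psi> x) \<le> e / 2"
        proof (rule m)
          show "t D \<in> int_ring K" "x \<in> int_ring K"
            using tD PL[OF D] OL_subset x(1) by auto
          show "vabs (t D - x) \<le> 1 / real p ^ m"
            using P D tD xD by (intro less_imp_le) auto
        qed
        moreover have "vabs (\<psi> x - \<psi> (Up.pt a)) \<le> e / 2"
        proof (rule m[OF x(1) Up.pt_OF])
          have "vabs (x - Up.pt a) \<le> 1 / real p ^ n"
            using x(3) by (simp add: Up.cell_def)
          also have "\<dots> \<le> 1 / real p ^ m"
            by (rule Lo.p_power_decreasing) (simp add: n_def)
          finally show "vabs (x - Up.pt a) \<le> 1 / real p ^ m" .
        qed
        ultimately have "vabs (\<psi> (t D) - \<psi> (Up.pt a)) \<le> e / 2"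
          using vabs_triangle[of "\<psi> (t D)" "\<psi> (Up.pt a)" "\<psi> x"] by linarith
        then show ?thesis
          using \<psi>\<phi>[of "t D"] tD PL[OF D] by auto
      qed
    qed (use e in auto)
    then have "vabs ((\<Sum>C\<in>P. pushforward C * \<phi> (t C)) - ?R) \<le> e / 2"
      by (simp only: pushforward_def)
    moreover have "e / 2 < e"
      using e by simp
    ultimately show "vabs ((\<Sum>C\<in>P. pushforward C * \<phi> (t C)) - f \<phi>) < e"
      using R vabs_triangle[of "\<Sum>C\<in>P. pushforward C * \<phi> (t C)" "f \<phi>" ?R] by linarith
  qed (use Lo.p_power_pos in auto)
qed

end

end

theorem theorem6p6:
  fixes p :: nat
    and K L :: "'c::{nonarch_valued_field, alg_closed_field, complete_space} set"
  assumes "is_Cp p TYPE('c)"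
    and "finite_extension Qp L"
    and "finite_extension Qp K"
    and "finite_extension L K"
    and "bounded_functions K = iwasawa_algebra K"
  shows "bounded_functions L = iwasawa_algebra L"
proof
  interpret Lo: padic_extension p "TYPE('c)" L
    using assms by unfold_locales
  interpret Up: padic_extension p "TYPE('c)" K
    using assms by unfold_locales
  have LK: "L \<subseteq> K"
    using assms(4) by (simp add: finite_extension_def)
  show "iwasawa_algebra L \<subseteq> bounded_functions L"
  proof -
    obtain B where "Zp_basis L B"
      using Lo.ex_Zp_basis' by blast
    then interpret padic_basis p "TYPE('c)" L B
      by unfold_locales
    show ?thesis
      by (rule iwasawa_subset_bounded)
  qed
  show "bounded_functions L \<subseteq> iwasawa_algebra L"
  proof
    fix f assume f: "f \<in> bounded_functions L"
    then obtain B where B: "Zp_basis L B" and c: "\<And>r. 0 < r \<Longrightarrow> r < 1 \<Longrightarrow> \<exists>c\<in>tate_series L B r. \<forall>\<phi>\<in>char_variety L.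
        (\<forall>b\<in>B. vabs (\<phi> b - 1) \<le> r) \<longrightarrow> ((\<lambda>\<alpha>. c \<alpha> * (\<Prod>b\<in>B. (\<phi> b - 1) ^ \<alpha> b)) has_sum f \<phi>) (B \<rightarrow>\<^sub>E UNIV)"
      unfolding bounded_functions_def rigid_functions_def by blast
    \<comment> \<open>Rigidity of \<open>f\<close> supplies its own basis, and it is this
      \<open>B\<close> that has to be extended.\<close>
    obtain B' where B': "B \<subseteq> B'" "Zp_basis K B'"
      using Up.ex_Zp_basis[OF Up.Zp_basis_subfield_p_indep[OF B Lo.subfield LK Lo.Qp_subset]] by blast
    interpret padic_tower p "TYPE('c)" L B K B'
      using B B' LK by unfold_locales
    have "pullback f \<in> bounded_functions K"
      using f c by (intro pullback_bounded) (auto simp: bounded_functions_def)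
    then obtain \<mu> where \<mu>: "\<mu> \<in> int_measures K"
      and I: "\<And>\<psi>. \<psi> \<in> char_variety K \<Longrightarrow> has_measure_integral K \<mu> \<psi> (pullback f \<psi>)"
      unfolding assms(5) by (auto simp: iwasawa_algebra_def)
    have "f \<in> extensional (char_variety L)"
      using f by (simp add: bounded_functions_def rigid_functions_def)
    then show "f \<in> iwasawa_algebra L"
      unfolding iwasawa_algebra_def
      using pushforward_int_measure[OF c \<mu> I] pushforward_integral[OF c \<mu> I] by blast
  qed
qed

end
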